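(* Let $K$ be a compact Hausdorff dispersed space and $X=C(K)$ (complex scalars), with open unit ball $B$. Then $X$ satisfies the cluster value theorem for $H^\infty(B)$ at every $x^{**}\in\bar B^{**}$: for every $f\in H^\infty(B)$, $Cl_B(f,x^{**})=\hat f(M_{x^{**}}(B))$, where $M_{x^{**}}(B)$ is the fiber over $x^{**}$ in the spectrum of $H^\infty(B)$.
   Context: A topological space is dispersed (scattered) if it contains no nonempty perfect subset. $H^\infty(B)$ is the uniform algebra (supremum norm) of all bounded holomorphic functions on $B$; $\bar B^{**}$ is the closed unit ball of $X^{**}$. For $x^{**}\in\bar B^{**}$, $M_{x^{**}}(B)$ is the set of nonzero multiplicative linear functionals $\tau$ on $H^\infty(B)$ with $\tau(x^* )=x^{**}(x^* )$ for all $x^*\in X^*$; $\hat f(\tau)=\tau(f)$. $Cl_B(f,x^{**})$ is the set of all $\lambda\in\mathbb C$ with $\lambda=\lim_\alpha f(x_\alpha)$ for some net $(x_\alpha)\subset B$ converging weak-star to $x^{**}$. (The inclusion $Cl_B(f,x^{**})\subset\hat f(M_{x^{**}}(B))$ always holds.) *)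

theory Defs
  imports "HOL-Analysis.Analysis"
begin

definition dispersed :: "'k::topological_space set \<Rightarrow> bool" where
  "dispersed S \<longleftrightarrow> \<not> (\<exists>P. P \<subseteq> S \<and> P \<noteq> {} \<and> closed P \<and> (\<forall>x\<in>P. x islimpt P))"

definition CK :: "('k::topological_space \<Rightarrow> complex) set" where
  "CK = {x. continuous_on UNIV x}"

definition supn :: "('k \<Rightarrow> complex) \<Rightarrow> real" where
  "supn x = (SUP k. cmod (x k))"

definition BallX :: "('k::topological_space \<Rightarrow> complex) set" where
  "BallX = {x \<in> CK. supn x < 1}"

definition dualX :: "(('k::topological_space \<Rightarrow> complex) \<Rightarrow> complex) set" where
  "dualX = {\<phi>. (\<forall>x\<in>CK. \<forall>y\<in>CK. \<forall>a b. \<phi> (\<lambda>k. a * x k + b * y k) = a * \<phi> x + b * \<phi> y)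
              \<and> (\<exists>C. \<forall>x\<in>CK. cmod (\<phi> x) \<le> C * supn x)
              \<and> (\<forall>x. x \<notin> CK \<longrightarrow> \<phi> x = 0)}"

definition dnorm :: "(('k::topological_space \<Rightarrow> complex) \<Rightarrow> complex) \<Rightarrow> real" where
  "dnorm \<phi> = (SUP x\<in>{x\<in>CK. supn x \<le> 1}. cmod (\<phi> x))"

definition bidual_ball :: "((('k::topological_space \<Rightarrow> complex) \<Rightarrow> complex) \<Rightarrow> complex) set" where
  "bidual_ball = {\<Psi>. (\<forall>\<phi>\<in>dualX. \<forall>\<psi>\<in>dualX. \<forall>a b.
                      \<Psi> (\<lambda>x. a * \<phi> x + b * \<psi> x) = a * \<Psi> \<phi> + b * \<Psi> \<psi>)
                 \<and> (\<forall>\<phi>\<in>dualX. cmod (\<Psi> \<phi>) \<le> dnorm \<phi>)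
                 \<and> (\<forall>\<phi>. \<phi> \<notin> dualX \<longrightarrow> \<Psi> \<phi> = 0)}"

definition holo_on_Ball :: "(('k::topological_space \<Rightarrow> complex) \<Rightarrow> complex) \<Rightarrow> bool" where
  "holo_on_Ball f \<longleftrightarrow> (\<forall>x\<in>BallX. \<exists>L\<in>dualX. \<forall>\<epsilon>>0. \<exists>\<delta>>0. \<forall>h\<in>CK. supn h < \<delta> \<longrightarrow>
      cmod (f (\<lambda>k. x k + h k) - f x - L h) \<le> \<epsilon> * supn h)"

definition Hinf :: "(('k::topological_space \<Rightarrow> complex) \<Rightarrow> complex) set" where
  "Hinf = {f. holo_on_Ball f \<and> (\<exists>M. \<forall>x\<in>BallX. cmod (f x) \<le> M) \<and> (\<forall>x. x \<notin> BallX \<longrightarrow> f x = 0)}"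

definition restrB :: "(('k::topological_space \<Rightarrow> complex) \<Rightarrow> complex) \<Rightarrow> (('k \<Rightarrow> complex) \<Rightarrow> complex)" where
  "restrB \<phi> = (\<lambda>x. if x \<in> BallX then \<phi> x else 0)"

definition fiber :: "((('k::topological_space \<Rightarrow> complex) \<Rightarrow> complex) \<Rightarrow> complex)
     \<Rightarrow> ((('k \<Rightarrow> complex) \<Rightarrow> complex) \<Rightarrow> complex) set" where
  "fiber \<Psi> = {\<tau>. (\<forall>f\<in>Hinf. \<forall>g\<in>Hinf. \<forall>a b. \<tau> (\<lambda>x. a * f x + b * g x) = a * \<tau> f + b * \<tau> g)
                \<and> (\<forall>f\<in>Hinf. \<forall>g\<in>Hinf. \<tau> (\<lambda>x. f x * g x) = \<tau> f * \<tau> g)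
                \<and> (\<exists>f\<in>Hinf. \<tau> f \<noteq> 0)
                \<and> (\<forall>\<phi>\<in>dualX. \<tau> (restrB \<phi>) = \<Psi> \<phi>)}"

text \<open>Cluster set: limits of f along nets (filters) in B converging weak-star to x**.\<close>
definition cluster :: "(('k::topological_space \<Rightarrow> complex) \<Rightarrow> complex)
     \<Rightarrow> ((('k \<Rightarrow> complex) \<Rightarrow> complex) \<Rightarrow> complex) \<Rightarrow> complex set" where
  "cluster f \<Psi> = {c. \<exists>F::('k \<Rightarrow> complex) filter. F \<noteq> bot \<and> eventually (\<lambda>x. x \<in> BallX) F
        \<and> (\<forall>\<phi>\<in>dualX. ((\<lambda>x. \<phi> x) \<longlongrightarrow> \<Psi> \<phi>) F) \<and> (f \<longlongrightarrow> c) F}"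

end

theory Submission
  imports Defs "HOL-Complex_Analysis.Complex_Analysis"
begin

text \<open>
  On a dispersed compact space every functional on \<open>C(K)\<close> is a norm limit of finite combinations of point
  evaluations, so a weak-star neighbourhood of \<open>x\<^sup>*\<^sup>*\<close> in the ball is given by finitely many conditions
  \<open>|x(k\<^sub>j) - l\<^sub>j| < e\<close>. If \<open>f\<close> is bounded away from \<open>c = \<tau>(f)\<close> on such a set, then \<open>1/(f - c)\<close> is bounded and
  holomorphic there, and it suffices to extend it to the whole ball modulo the ideal generated by the functions
  \<open>x(k\<^sub>j) - l\<^sub>j\<close>, which \<open>\<tau>\<close> annihilates: this yields \<open>(f - c) g + \<Sum> (x(k\<^sub>j) - l\<^sub>j) u\<^sub>j = 1\<close> and hence the
  contradiction \<open>0 = 1\<close>.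

  The extension is done one coordinate at a time. In the variable \<open>z = x(k)\<close> it is an additive Cousin problem on
  the unit disc near a point \<open>l\<close>, solved with a bounded linear operator (Cauchy integrals along two paths with
  common end points). To freeze the other values of \<open>x\<close> one would like to evaluate at \<open>x + (z - x(k)) 1\<^bsub>{k}\<^esub>\<close>, a
  point of the bidual; this is replaced by an ultrafilter limit over continuous bump functions at \<open>k\<close>.
\<close>

section \<open>Ultrafilter limits and bounded holomorphic functions\<close>

text \<open>The values \<open>\<Psi>\<close> takes at point evaluations may have modulus 1, and this
  shapes the proof: the function G to be extended near such an l has no value at l, yet the
  correction must be (z - l) times a bounded function. For |l| < 1 the constant G(l) serves as an
  extension; for |l| = 1 the free additive constant of the Cousin solution is used to make the error
  vanish at l.

  The operators must be linear and bounded uniformly in G because they act on a function H x that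
  varies with x, and holomorphy in x has to survive. As z is finally set to x(k), x enters twice;
  the two roles are first separated into independent parameters and then joined on the diagonal.

  Holomorphy is handled as boundedness plus differentiability on complex lines. Taylor remainders
  whose constants depend only on the bound and the radius then do the analytic work: they pass to
  ultrafilter limits, go through bounded operators, and give back Frechet differentiability.

  Representing measures are avoided: total variation on open sets is a supremum over test
  functions.\<close>

definition ultrafilter :: "'a filter \<Rightarrow> bool" where
  "ultrafilter U \<longleftrightarrow> U \<noteq> bot \<and> (\<forall>P. eventually P U \<or> eventually (\<lambda>x. \<not> P x) U)"

text \<open>Zorn's lemma on the proper filters below \<open>F\<close>. A minimal proper filter
  \<open>U\<close> decides every \<open>P\<close>: its infimum with the principal filter of
  \<open>P\<close> is either \<open>bot\<close>, so that \<not> P holds eventually, or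
  \<open>U\<close> itself.\<close>

lemma ultrafilter_exists:
  fixes F :: "'a filter"
  assumes "F \<noteq> bot"
  obtains U where "U \<le> F" "ultrafilter U"
proof -
  define A where "A = {G. G \<noteq> bot \<and> G \<le> F}"
  define R :: "'a filter \<Rightarrow> 'a filter \<Rightarrow> bool" where "R = (\<lambda>x y. y \<le> x)"
  have po: "partial_order_on A (relation_of R A)"
    by (auto simp: R_def relation_of_def partial_order_on_def preorder_on_def refl_on_def trans_def antisym_def)
  have ch: "\<exists>u\<in>A. \<forall>a\<in>C. R a u" if C: "C \<in> Chains (relation_of R A)" for C
  proof (cases "C = {}")
    case True
    then show ?thesis using assms by (auto simp: A_def)
  next
    case False
    have CA: "C \<subseteq> A" and lin: "\<And>x y. x \<in> C \<Longrightarrow> y \<in> C \<Longrightarrow> x \<le> y \<or> y \<le> x"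
      using C by (auto simp: Chains_def relation_of_def R_def)
    have base: "\<And>F G. F \<in> C \<Longrightarrow> G \<in> C \<Longrightarrow> \<exists>x\<in>C. x \<le> inf F G"
      using lin by (metis inf.absorb1 inf.absorb2 order_refl)
    \<comment> \<open>A chain is directed, so whatever holds eventually for its infimum already
      holds eventually for one member; a contradiction cannot appear only in the limit.\<close>
    have "Inf C \<noteq> bot"
    proof
      assume "Inf C = bot"
      then have "eventually (\<lambda>_. False) (Inf C)" by simp
      then obtain b where "b \<in> C" "eventually (\<lambda>_. False) b"
        using eventually_Inf_base[OF False base] by blast
      then show False using CA by (auto simp: A_def trivial_limit_def)
    qed
    moreover have "Inf C \<le> F"
    proof -
      obtain G where "G \<in> C" using False by blast
      then have "Inf C \<le> G" "G \<le> F" using CA by (auto simp: A_def intro: Inf_lower)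
      then show ?thesis by (rule order_trans)
    qed
    ultimately show ?thesis
      by (intro bexI[of _ "Inf C"]) (auto simp: A_def R_def intro: Inf_lower)
  qed
  obtain U where U: "U \<in> A" and mx: "\<And>a. a \<in> A \<Longrightarrow> a \<le> U \<Longrightarrow> a = U"
    using predicate_Zorn[OF po ch] by (auto simp: R_def)
  have "eventually P U \<or> eventually (\<lambda>x. \<not> P x) U" for P
  proof (cases "inf U (principal {x. P x}) = bot")
    case True
    then have "eventually (\<lambda>x. False) (inf U (principal {x. P x}))" by simp
    then have "eventually (\<lambda>x. \<not> P x) U"
      unfolding eventually_inf_principal by simp
    then show ?thesis ..
  next
    case False
    then have "inf U (principal {x. P x}) = U"
      using U by (intro mx) (auto simp: A_def intro: le_infI1)
    then have "U \<le> principal {x. P x}" by (metis inf.cobounded2)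
    then show ?thesis by (simp add: le_principal)
  qed
  then show thesis using that U by (auto simp: A_def ultrafilter_def)
qed

text \<open>Compactness of a closed disc gives a cluster point of the values; an ultrafilter must
  choose between a neighbourhood of it and the complement, so the cluster point is the limit. Thus
  \<open>Lim U\<close> is meaningful on all bounded functions at once.\<close>

lemma ultrafilter_bounded_tendsto_Lim:
  fixes g :: "'a \<Rightarrow> complex"
  assumes U: "ultrafilter U" and "eventually (\<lambda>x. cmod (g x) \<le> M) U"
  shows "(g \<longlongrightarrow> Lim U g) U"
proof -
  have nb: "U \<noteq> bot" using U by (simp add: ultrafilter_def)
  have "compact (cball (0::complex) M)" by simp
  moreover have "filtermap g U \<noteq> bot" "eventually (\<lambda>x. x \<in> cball 0 M) (filtermap g U)"
    using assms nb by (auto simp: filtermap_bot_iff eventually_filtermap)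
  ultimately obtain c where c: "inf (nhds c) (filtermap g U) \<noteq> bot"
    unfolding compact_filter by blast
  have "(g \<longlongrightarrow> c) U"
  proof (rule topological_tendstoI)
    fix S assume S: "open S" "c \<in> S"
    show "eventually (\<lambda>x. g x \<in> S) U"
    proof (rule ccontr)
      assume "\<not> ?thesis"
      then have "eventually (\<lambda>x. g x \<notin> S) U" using U by (auto simp: ultrafilter_def)
      then have "eventually (\<lambda>y. y \<notin> S) (filtermap g U)" by (simp add: eventually_filtermap)
      moreover have "eventually (\<lambda>y. y \<in> S) (nhds c)" using S by (rule eventually_nhds_in_open)
      ultimately have "eventually (\<lambda>y. False) (inf (nhds c) (filtermap g U))"
        unfolding eventually_inf by blast
      then show False using c by (simp add: trivial_limit_def)
    qed
  qed
  then show ?thesis using tendsto_Lim[OF nb] by metis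
qed

text \<open>On the circle of radius \<rho> < r the numerator is at most 2 M and the denominator has
  modulus \<rho>; the maximum principle carries the bound inside, and then \<rho> tends to r. The
  detour is due to \<open>g\<close> being defined on the open ball only.\<close>

lemma holomorphic_difference_quotient_bound:
  assumes hol: "g holomorphic_on ball a r" and bd: "\<And>z. z \<in> ball a r \<Longrightarrow> cmod (g z) \<le> M" and r: "0 < r"
  defines "d \<equiv> (\<lambda>z. if z = a then deriv g a else (g z - g a) / (z - a))"
  shows "d holomorphic_on ball a r" and "\<And>z. z \<in> ball a r \<Longrightarrow> cmod (d z) \<le> 2 * M / r"
proof -
  show hd: "d holomorphic_on ball a r"
    unfolding d_def by (rule pole_lemma_open[OF hol]) simp
  fix z assume z: "z \<in> ball a r"
  have M: "0 \<le> M" using bd[OF z] norm_ge_zero order_trans by blast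
  have *: "cmod (d z) \<le> 2 * M / \<rho>" if \<rho>: "dist a z < \<rho>" "\<rho> < r" for \<rho>
  proof (rule maximum_modulus_frontier[of d "cball a \<rho>"])
    have "0 < \<rho>" using \<rho>(1) zero_le_dist[of a z] by linarith
    show "d holomorphic_on interior (cball a \<rho>)"
      using \<rho> by (auto intro!: holomorphic_on_subset[OF hd])
    show "continuous_on (closure (cball a \<rho>)) d"
      using \<rho> by (intro holomorphic_on_imp_continuous_on holomorphic_on_subset[OF hd]) auto
    show "cmod (d w) \<le> 2 * M / \<rho>" if "w \<in> frontier (cball a \<rho>)" for w
    proof -
      have w: "dist a w = \<rho>" using that \<open>0 < \<rho>\<close> by simp
      then have "w \<in> ball a r" "a \<in> ball a r" "w \<noteq> a" using \<rho> r \<open>0 < \<rho>\<close> by auto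
      then have "cmod (g w - g a) \<le> 2 * M"
        using norm_triangle_ineq4[of "g w" "g a"] bd[of w] bd[of a] by linarith
      then show ?thesis using w \<open>w \<noteq> a\<close> \<open>0 < \<rho>\<close>
        by (simp add: d_def norm_divide dist_norm norm_minus_commute divide_right_mono)
    qed
    show "z \<in> cball a \<rho>" using \<rho> by simp
  qed auto
  show "cmod (d z) \<le> 2 * M / r"
  proof (rule tendsto_lowerbound[of "\<lambda>\<rho>. 2 * M / \<rho>" _ "at_left r"])
    show "((\<lambda>\<rho>. 2 * M / \<rho>) \<longlongrightarrow> 2 * M / r) (at_left r)"
      using r by (auto intro!: tendsto_eq_intros)
    have "eventually (\<lambda>\<rho>. \<rho> \<in> {dist a z<..<r}) (at_left r)"
      using z by (intro eventually_at_left_real) auto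
    then show "eventually (\<lambda>\<rho>. cmod (d z) \<le> 2 * M / \<rho>) (at_left r)"
      by eventually_elim (use * in auto)
  qed auto
qed

text \<open>Two successive divisions by z, each costing a factor 2 / r. What matters later is that
  the constants depend on \<open>M\<close> and \<open>r\<close> alone, so that the estimates are
  uniform over families of functions.\<close>

lemma holomorphic_taylor2_bound:
  assumes hol: "g holomorphic_on ball 0 r" and bd: "\<And>z. z \<in> ball 0 r \<Longrightarrow> cmod (g z) \<le> M" and r: "0 < r"
    and z: "cmod z < r"
  shows "cmod (g z - g 0 - z * deriv g 0) \<le> 4 * M / r\<^sup>2 * (cmod z)\<^sup>2"
    and "cmod (g z - g 0) \<le> 2 * M / r * cmod z"
    and "cmod (deriv g 0) \<le> 2 * M / r"
proof -
  define d where "d = (\<lambda>z. if z = 0 then deriv g 0 else (g z - g 0) / (z - 0))"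
  have 1: "d holomorphic_on ball 0 r" "\<And>z. z \<in> ball 0 r \<Longrightarrow> cmod (d z) \<le> 2 * M / r"
    using holomorphic_difference_quotient_bound[OF hol _ r, of M] bd unfolding d_def by auto
  define e where "e = (\<lambda>z. if z = 0 then deriv d 0 else (d z - d 0) / (z - 0))"
  have 2: "\<And>z. z \<in> ball 0 r \<Longrightarrow> cmod (e z) \<le> 2 * (2 * M / r) / r"
    using holomorphic_difference_quotient_bound[OF 1(1) _ r, of "2*M/r"] 1(2) unfolding e_def by auto
  have gz: "g z - g 0 = z * d z" by (simp add: d_def)
  have "d z - d 0 = z * e z" by (simp add: e_def)
  then have "g z - g 0 - z * deriv g 0 = z * (z * e z)"
    unfolding gz by (metis d_def right_diff_distrib)
  moreover have "cmod (e z) \<le> 4 * M / r\<^sup>2" using 2[of z] z by (simp add: power2_eq_square)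
  ultimately show "cmod (g z - g 0 - z * deriv g 0) \<le> 4 * M / r\<^sup>2 * (cmod z)\<^sup>2"
    using mult_right_mono[of "cmod (e z)" "4 * M / r\<^sup>2" "(cmod z)\<^sup>2"]
    by (simp add: norm_mult power2_eq_square mult_ac)
  show "cmod (g z - g 0) \<le> 2 * M / r * cmod z"
    unfolding gz using 1(2)[of z] z mult_right_mono[of "cmod (d z)" "2*M/r" "cmod z"]
    by (simp add: norm_mult mult_ac)
  show "cmod (deriv g 0) \<le> 2 * M / r" using 1(2)[of 0] r by (simp add: d_def)
qed

lemma has_field_derivative_quadratic_remainder:
  fixes g :: "complex \<Rightarrow> complex"
  assumes "0 < r" and "\<And>z. cmod z < r \<Longrightarrow> cmod (g z - g 0 - z * L) \<le> C * (cmod z)\<^sup>2"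
  shows "(g has_field_derivative L) (at 0)"
proof -
  have "((\<lambda>z. (g z - g 0) / z - L) \<longlongrightarrow> 0) (at 0)"
  proof (rule Lim_null_comparison)
    have "eventually (\<lambda>z. z \<in> ball 0 r) (at (0::complex))"
      using assms(1) by (intro eventually_at_in_open') auto
    moreover have "eventually (\<lambda>z. z \<noteq> 0) (at (0::complex))" by (simp add: eventually_at_filter)
    ultimately show "eventually (\<lambda>z. cmod ((g z - g 0) / z - L) \<le> C * cmod z) (at 0)"
    proof eventually_elim
      case (elim z)
      have "(g z - g 0) / z - L = (g z - g 0 - z * L) / z" using elim by (simp add: field_simps)
      then show ?case using assms(2)[of z] elim
        by (simp add: norm_divide divide_simps power2_eq_square mult_ac)
    qed
    show "((\<lambda>z. C * cmod z) \<longlongrightarrow> 0) (at (0::complex))" by (auto intro!: tendsto_eq_intros)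
  qed
  then show ?thesis by (simp add: DERIV_def LIM_zero_iff)
qed

text \<open>The derivatives at 0 are bounded and so have a limit along \<open>U\<close>. The
  quadratic remainder bound is uniform in \<open>u\<close> and a closed condition, hence it survives
  in the limit.\<close>

lemma field_differentiable_Lim_ultrafilter:
  fixes g :: "'u \<Rightarrow> complex \<Rightarrow> complex"
  assumes U: "ultrafilter U" and r: "0 < r"
    and ev: "eventually (\<lambda>u. g u holomorphic_on ball 0 r \<and> (\<forall>z\<in>ball 0 r. cmod (g u z) \<le> M)) U"
  shows "(\<lambda>z. Lim U (\<lambda>u. g u z)) field_differentiable at 0"
proof -
  have nb: "U \<noteq> bot" using U by (simp add: ultrafilter_def)
  have lim: "((\<lambda>u. g u z) \<longlongrightarrow> Lim U (\<lambda>u. g u z)) U" if "cmod z < r" for z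
    using that by (intro ultrafilter_bounded_tendsto_Lim[OF U, of _ M] eventually_mono[OF ev]) auto
  have limd: "((\<lambda>u. deriv (g u) 0) \<longlongrightarrow> Lim U (\<lambda>u. deriv (g u) 0)) U"
    using holomorphic_taylor2_bound(3)[where z=0 and r=r and M=M] r
    by (intro ultrafilter_bounded_tendsto_Lim[OF U, of _ "2*M/r"] eventually_mono[OF ev]) auto
  have "((\<lambda>z. Lim U (\<lambda>u. g u z)) has_field_derivative Lim U (\<lambda>u. deriv (g u) 0)) (at 0)"
  proof (rule has_field_derivative_quadratic_remainder[OF r])
    fix z :: complex assume z: "cmod z < r"
    have "((\<lambda>u. cmod (g u z - g u 0 - z * deriv (g u) 0)) \<longlongrightarrow>
        cmod (Lim U (\<lambda>u. g u z) - Lim U (\<lambda>u. g u 0) - z * Lim U (\<lambda>u. deriv (g u) 0))) U"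
      by (intro tendsto_intros lim limd z) (use r in auto)
    moreover have "eventually (\<lambda>u. cmod (g u z - g u 0 - z * deriv (g u) 0) \<le> 4 * M / r\<^sup>2 * (cmod z)\<^sup>2) U"
      using ev by eventually_elim (use holomorphic_taylor2_bound(1)[OF _ _ r z] in auto)
    ultimately show "cmod (Lim U (\<lambda>u. g u z) - Lim U (\<lambda>u. g u 0) - z * Lim U (\<lambda>u. deriv (g u) 0))
        \<le> 4 * M / r\<^sup>2 * (cmod z)\<^sup>2"
      using tendsto_upperbound nb by blast
  qed
  then show ?thesis unfolding field_differentiable_def by blast
qed

text \<open>Split p(z,z) - p(0,0) into p(z,z) - p(z,0) and p(z,0) - p(0,0). The first quotient is
  within C |z| of the partial derivative \<open>d z\<close>, so everything rests on continuity of
  \<open>d\<close> at 0.\<close>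

lemma has_field_derivative_diagonal:
  fixes p :: "complex \<Rightarrow> complex \<Rightarrow> complex"
  assumes r: "0 < r"
    and h1: "\<And>w. w \<in> ball 0 r \<Longrightarrow> (\<lambda>z. p z w) holomorphic_on ball 0 r"
    and h2: "\<And>z. z \<in> ball 0 r \<Longrightarrow> p z holomorphic_on ball 0 r"
    and bd: "\<And>z w. z \<in> ball 0 r \<Longrightarrow> w \<in> ball 0 r \<Longrightarrow> cmod (p z w) \<le> M"
  shows "((\<lambda>z. p z z) has_field_derivative deriv (\<lambda>z. p z 0) 0 + deriv (p 0) 0) (at 0)"
proof -
  have M: "0 \<le> M" using order_trans[OF norm_ge_zero bd[of 0 0]] r by simp
  define d where "d = (\<lambda>z. deriv (p z) 0)"
  define C where "C = 4 * M / r\<^sup>2"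
  have C: "0 \<le> C" using M by (simp add: C_def)
  have tay: "cmod (p z w - p z 0 - w * d z) \<le> C * (cmod w)\<^sup>2" if "cmod z < r" "cmod w < r" for z w
    using holomorphic_taylor2_bound(1)[of "p z" r M w] h2[of z] bd[of z] r that
    unfolding C_def d_def by simp
  have lip: "cmod (p z w - p 0 w) \<le> 2 * M / r * cmod z" if "cmod z < r" "cmod w < r" for z w
    using holomorphic_taylor2_bound(2)[of "\<lambda>z. p z w" r M z] h1[of w] bd[of _ w] r that by simp
  have dcont: "(d \<longlongrightarrow> d 0) (at 0)"
  proof (rule tendstoI)
    fix e :: real assume e: "0 < e"
    \<comment> \<open>\<open>d\<close> is compared with difference quotients of a fixed step t. The
      two Taylor errors cost 2 C t, here made less than e / 2; for this t the Lipschitz bound in z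
      makes the rest small as z tends to 0.\<close>
    define t where "t = min (r/2) (e / (4 * C + 4))"
    have t: "0 < t" "t < r" using e r C by (auto simp: t_def min_less_iff_disj)
    have "t \<le> e / (4 * C + 4)" by (simp add: t_def)
    then have "t * (4 * C + 4) \<le> e" using C by (subst (asm) pos_le_divide_eq) auto
    then have Ct: "2 * C * t < e / 2" using t by (simp add: algebra_simps)
    have "((\<lambda>z. 4 * M / r * cmod z / t + 2 * C * t) \<longlongrightarrow> 4 * M / r * cmod 0 / t + 2 * C * t) (at (0::complex))"
      by (intro tendsto_intros) (use t in auto)
    then have "eventually (\<lambda>z::complex. 4 * M / r * cmod z / t + 2 * C * t < e) (at 0)"
      by (rule order_tendstoD) (use Ct e in auto)
    moreover have "eventually (\<lambda>z. z \<in> ball 0 r) (at (0::complex))"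
      using r by (intro eventually_at_in_open') auto
    ultimately show "eventually (\<lambda>z. dist (d z) (d 0) < e) (at 0)"
    proof eventually_elim
      case (elim z)
      let ?t = "complex_of_real t"
      have "?t * (d z - d 0) = (p z ?t - p 0 ?t) - (p z 0 - p 0 0) - (p z ?t - p z 0 - ?t * d z)
            + (p 0 ?t - p 0 0 - ?t * d 0)" by (simp add: algebra_simps)
      also have "cmod \<dots> \<le> 2 * M / r * cmod z + 2 * M / r * cmod z + C * t\<^sup>2 + C * t\<^sup>2"
      proof (rule order_trans)
        show "cmod (A - B - D + E) \<le> cmod A + cmod B + cmod D + cmod E" for A B D E :: complex
          using norm_triangle_ineq[of "A - B - D" E] norm_triangle_ineq4[of "A - B" D]
            norm_triangle_ineq4[of A B] by linarith
      qed (use lip[of z ?t] lip[of z 0] tay[of z ?t] tay[of 0 ?t] t r elim in \<open>auto intro!: add_mono\<close>)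
      also have "\<dots> = t * (4 * M / r * cmod z / t + 2 * C * t)"
        using t by (simp add: field_simps power2_eq_square)
      finally have "t * cmod (d z - d 0) \<le> t * (4 * M / r * cmod z / t + 2 * C * t)"
        using t unfolding norm_mult by simp
      then have "cmod (d z - d 0) \<le> 4 * M / r * cmod z / t + 2 * C * t" using t by simp
      then show ?case using elim by (simp add: dist_norm)
    qed
  qed
  have A: "((\<lambda>z. (p z z - p z 0) / z) \<longlongrightarrow> d 0) (at 0)"
  proof -
    have "((\<lambda>z. (p z z - p z 0) / z - d z) \<longlongrightarrow> 0) (at 0)"
    proof (rule Lim_null_comparison)
      have "eventually (\<lambda>z. z \<in> ball 0 r) (at (0::complex))"
        using r by (intro eventually_at_in_open') auto
      moreover have "eventually (\<lambda>z. z \<noteq> 0) (at (0::complex))" by (simp add: eventually_at_filter)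
      ultimately show "eventually (\<lambda>z. cmod ((p z z - p z 0) / z - d z) \<le> C * cmod z) (at 0)"
      proof eventually_elim
        case (elim z)
        have "(p z z - p z 0) / z - d z = (p z z - p z 0 - z * d z) / z" using elim by (simp add: field_simps)
        then show ?case using tay[of z z] elim
          by (simp add: norm_divide divide_simps power2_eq_square mult_ac)
      qed
      show "((\<lambda>z. C * cmod z) \<longlongrightarrow> 0) (at (0::complex))" by (auto intro!: tendsto_eq_intros)
    qed
    from tendsto_add[OF this dcont] show ?thesis by simp
  qed
  have "(\<lambda>z. p z 0) field_differentiable at 0"
    using h1[of 0] r by (auto intro: holomorphic_on_imp_differentiable_at)
  then have B: "((\<lambda>z. (p z 0 - p 0 0) / z) \<longlongrightarrow> deriv (\<lambda>z. p z 0) 0) (at 0)"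
    by (simp add: DERIV_deriv_iff_field_differentiable[symmetric] DERIV_def)
  have "((\<lambda>z. (p z z - p 0 0) / z) \<longlongrightarrow> deriv (\<lambda>z. p z 0) 0 + d 0) (at 0)"
    using tendsto_add[OF B A] by (simp add: diff_divide_distrib)
  then show ?thesis by (simp add: DERIV_def d_def)
qed

section \<open>Extension operators on the disc\<close>

text \<open>\<open>P\<close> extends functions on the disc near \<open>l\<close> to the whole disc modulo multiples of \<open>z - l\<close>, and \<open>Q\<close> gives the
  cofactor. Linearity in \<open>G\<close> makes the extension holomorphic in parameters.\<close>

definition extension_operators ::
  "complex \<Rightarrow> real \<Rightarrow> ((complex \<Rightarrow> complex) \<Rightarrow> complex \<Rightarrow> complex) \<Rightarrow> ((complex \<Rightarrow> complex) \<Rightarrow> complex \<Rightarrow> complex) \<Rightarrow> real \<Rightarrow> bool" where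
  "extension_operators l e P Q C \<longleftrightarrow> 0 \<le> C \<and>
     (\<forall>G M. G holomorphic_on (ball 0 1 \<inter> ball l e) \<longrightarrow> (\<forall>z\<in>ball 0 1 \<inter> ball l e. cmod (G z) \<le> M) \<longrightarrow>
        P G holomorphic_on ball 0 1 \<and> (\<forall>z\<in>ball 0 1. cmod (P G z) \<le> C * M) \<and>
        Q G holomorphic_on (ball 0 1 \<inter> ball l e) \<and> (\<forall>z\<in>ball 0 1 \<inter> ball l e. cmod (Q G z) \<le> C * M) \<and>
        (\<forall>z\<in>ball 0 1 \<inter> ball l e. P G z = G z + (z - l) * Q G z)) \<and>
     (\<forall>G1 G2 M a b. G1 holomorphic_on (ball 0 1 \<inter> ball l e) \<longrightarrow> G2 holomorphic_on (ball 0 1 \<inter> ball l e) \<longrightarrow>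
        (\<forall>z\<in>ball 0 1 \<inter> ball l e. cmod (G1 z) \<le> M \<and> cmod (G2 z) \<le> M) \<longrightarrow>
        (\<forall>z\<in>ball 0 1. P (\<lambda>w. a * G1 w + b * G2 w) z = a * P G1 z + b * P G2 z) \<and>
        (\<forall>z\<in>ball 0 1 \<inter> ball l e. Q (\<lambda>w. a * G1 w + b * G2 w) z = a * Q G1 z + b * Q G2 z))"

text \<open>With l inside the disc the constant G(l) is an extension, and the cofactor is minus the
  difference quotient of G at l.\<close>

lemma extension_operators_interior:
  assumes l: "cmod l < 1" and e: "0 < e"
  shows "\<exists>P Q C. extension_operators l e P Q C"
proof -
  let ?O = "ball 0 1 \<inter> ball l e"
  \<comment> \<open>A full disc around l inside the domain: on it the quotient is bounded by the
    maximum principle, off it by |z - l| \<ge> \<rho>. Both give 2 M / \<rho>.\<close>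
  define \<rho> where "\<rho> = min e (1 - cmod l)"
  have \<rho>: "0 < \<rho>" using l e by (simp add: \<rho>_def)
  have sub: "ball l \<rho> \<subseteq> ?O"
  proof
    fix z assume "z \<in> ball l \<rho>"
    then show "z \<in> ?O" using norm_triangle_ineq2[of z l]
      by (auto simp: \<rho>_def dist_norm norm_minus_commute)
  qed
  have lO: "l \<in> ?O" using l e by auto
  have oO: "open ?O" by auto
  define P where "P = (\<lambda>(G::complex\<Rightarrow>complex) (z::complex). G l)"
  define Q where "Q = (\<lambda>G z. - (if z = l then deriv G l else (G z - G l) / (z - l)))"
  define C where "C = 1 + 2 / \<rho>"
  have "extension_operators l e P Q C"
    unfolding extension_operators_def
  proof (intro conjI allI impI)
    show "0 \<le> C" using \<rho> by (simp add: C_def)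
  next
    fix G M assume G: "G holomorphic_on ?O" and M: "\<forall>z\<in>?O. cmod (G z) \<le> M"
    have M0: "0 \<le> M" using M lO norm_ge_zero order_trans by blast
    show "P G holomorphic_on ball 0 1" by (simp add: P_def)
    show "\<forall>z\<in>ball 0 1. cmod (P G z) \<le> C * M"
    proof
      have "M \<le> C * M" using M0 \<rho> by (simp add: C_def algebra_simps)
      then show "cmod (P G z) \<le> C * M" for z using M lO unfolding P_def by force
    qed
    show "Q G holomorphic_on ?O"
      unfolding Q_def by (intro holomorphic_on_minus pole_lemma_open[OF G oO])
    show "\<forall>z\<in>?O. P G z = G z + (z - l) * Q G z" by (simp add: P_def Q_def)
    show "\<forall>z\<in>?O. cmod (Q G z) \<le> C * M"
    proof
      fix z assume z: "z \<in> ?O"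
      have "cmod (Q G z) \<le> 2 * M / \<rho>"
      proof (cases "z \<in> ball l \<rho>")
        case True
        have "cmod (G w) \<le> M" if "w \<in> ball l \<rho>" for w using M sub that by blast
        from holomorphic_difference_quotient_bound(2)[OF holomorphic_on_subset[OF G sub] this \<rho> True]
        show ?thesis by (simp add: Q_def)
      next
        case False
        then have d: "\<rho> \<le> cmod (z - l)" by (simp add: dist_norm norm_minus_commute)
        have "cmod (G z - G l) \<le> 2 * M"
          using norm_triangle_ineq4[of "G z" "G l"] M[rule_format, OF z] M[rule_format, OF lO] by linarith
        then have "cmod (G z - G l) / cmod (z - l) \<le> 2 * M / \<rho>"
          using d \<rho> M0 by (intro frac_le) auto
        then show ?thesis using d \<rho> by (auto simp: Q_def norm_divide)
      qed
      also have "\<dots> \<le> C * M" using M0 by (simp add: C_def algebra_simps)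
      finally show "cmod (Q G z) \<le> C * M" .
    qed
  next
    fix G1 G2 :: "complex \<Rightarrow> complex" and M :: real and a b :: complex
    assume G: "G1 holomorphic_on ?O" "G2 holomorphic_on ?O"
    show "\<forall>z\<in>ball 0 1. P (\<lambda>w. a * G1 w + b * G2 w) z = a * P G1 z + b * P G2 z" by (simp add: P_def)
    have "G1 field_differentiable at l" "G2 field_differentiable at l"
      using G lO oO by (auto intro: holomorphic_on_imp_differentiable_at)
    then have "((\<lambda>w. a * G1 w + b * G2 w) has_field_derivative a * deriv G1 l + b * deriv G2 l) (at l)"
      by (auto intro!: derivative_eq_intros simp: DERIV_deriv_iff_field_differentiable[symmetric])
    then have "deriv (\<lambda>w. a * G1 w + b * G2 w) l = a * deriv G1 l + b * deriv G2 l"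
      by (rule DERIV_imp_deriv)
    then show "\<forall>z\<in>?O. Q (\<lambda>w. a * G1 w + b * G2 w) z = a * Q G1 z + b * Q G2 z"
      by (auto simp: Q_def diff_divide_distrib add_divide_distrib algebra_simps)
  qed
  then show ?thesis by blast
qed

section \<open>Cauchy integrals and extension near a boundary point of the disc\<close>

lemma Cauchy_transform_linepath:
  assumes f: "continuous_on (closed_segment a b) f"
  shows "(\<lambda>z. contour_integral (linepath a b) (\<lambda>w. f w / (w - z))) holomorphic_on - closed_segment a b"
    and "z \<notin> closed_segment a b \<Longrightarrow> (\<lambda>w. f w / (w - z)) contour_integrable_on linepath a b"
proof -
  show int: "(\<lambda>w. f w / (w - z)) contour_integrable_on linepath a b" if "z \<notin> closed_segment a b" for z
    using that by (intro contour_integrable_continuous_linepath continuous_intros f) auto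
  have "((\<lambda>z. contour_integral (linepath a b) (\<lambda>w. f w / (w - z))) has_field_derivative
      (of_nat 1 * contour_integral (linepath a b) (\<lambda>w. f w / (w - z) ^ Suc 1))) (at z)"
    if "z \<notin> closed_segment a b" for z
    by (rule Cauchy_next_derivative(2)[where S=UNIV and B="cmod (b - a)"])
      (use f that int in \<open>auto intro: has_contour_integral_integral\<close>)
  then show "(\<lambda>z. contour_integral (linepath a b) (\<lambda>w. f w / (w - z))) holomorphic_on - closed_segment a b"
    by (subst holomorphic_on_open) (auto simp: closed_segment_def[symmetric] open_Compl)
qed

lemma Cauchy_transform_linepath_linear:
  assumes "continuous_on (closed_segment p q) f" "continuous_on (closed_segment p q) g"
    and z: "z \<notin> closed_segment p q"
  shows "contour_integral (linepath p q) (\<lambda>w. (a * f w + b * g w) / (w - z)) =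
      a * contour_integral (linepath p q) (\<lambda>w. f w / (w - z)) + b * contour_integral (linepath p q) (\<lambda>w. g w / (w - z))"
proof -
  note i = Cauchy_transform_linepath(2)[OF assms(1) z] Cauchy_transform_linepath(2)[OF assms(2) z]
  have "(\<lambda>w. (a * f w + b * g w) / (w - z)) = (\<lambda>w. a * (f w / (w - z)) + b * (g w / (w - z)))"
    by (simp add: add_divide_distrib)
  then show ?thesis
    by (simp only: contour_integral_add contour_integrable_lmul contour_integral_lmul i)
qed

text \<open>The chord \<open>[a, b]\<close> and the broken line \<open>a, m, b\<close> bound a triangle \<open>T\<close> in the disc, close to \<open>1\<close>.
  With \<open>q\<close> vanishing at \<open>a\<close>, \<open>b\<close> and \<open>q 1 = 1\<close>, the Cauchy integrals \<open>C1\<close>, \<open>C2\<close> of \<open>q G\<close> along the two paths satisfy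
  \<open>C2 - C1 = q G\<close> inside \<open>T\<close>, so \<open>- C1\<close> on the left and \<open>q G - C2\<close> on the right fit together. The zeros of \<open>q\<close>
  compensate the kernel at the end points, and using each integral only on its side of the broken line
  \<open>Re z = c - \<phi> z / 2\<close> keeps it bounded.\<close>

lemma extension_operator_one:
  assumes e: "0 < e"
  shows "\<exists>P C. 0 \<le> C \<and>
    (\<forall>G M. G holomorphic_on (ball 0 1 \<inter> ball 1 e) \<longrightarrow> (\<forall>z\<in>ball 0 1 \<inter> ball 1 e. cmod (G z) \<le> M) \<longrightarrow>
        P G holomorphic_on ball 0 1 \<and> (\<forall>z\<in>ball 0 1. cmod (P G z) \<le> C * M) \<and>
        (\<forall>z\<in>ball 0 1 \<inter> ball 1 e. cmod (P G z - G z) \<le> C * M * cmod (z - 1))) \<and>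
    (\<forall>G1 G2 M a b. G1 holomorphic_on (ball 0 1 \<inter> ball 1 e) \<longrightarrow> G2 holomorphic_on (ball 0 1 \<inter> ball 1 e) \<longrightarrow>
        (\<forall>z\<in>ball 0 1 \<inter> ball 1 e. cmod (G1 z) \<le> M \<and> cmod (G2 z) \<le> M) \<longrightarrow>
        (\<forall>z\<in>ball 0 1. P (\<lambda>w. a * G1 w + b * G2 w) z = a * P G1 z + b * P G2 z))"
proof -
  let ?O = "ball (0::complex) 1 \<inter> ball 1 e"
  have oO: "open ?O" by auto
  \<comment> \<open>The corners c + i s and c - i s will lie on the unit circle. As 1 - c \<le> s,
    all points with c - s \<le> Re z \<le> 1 and |Im z| \<le> s are within 3 s of 1, hence closer
    than e.\<close>
  define s where "s = min (e/4) (1/2)"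
  define c where "c = sqrt (1 - s\<^sup>2)"
  have s: "0 < s" "s \<le> 1/2" "4 * s \<le> e" using e by (auto simp: s_def)
  have s2: "s\<^sup>2 \<le> (1/2)\<^sup>2" using s by (intro power_mono) auto
  then have c2: "c\<^sup>2 + s\<^sup>2 = 1" by (simp add: c_def power2_eq_square)
  have chalf: "1/2 < c" unfolding c_def by (rule real_less_rsqrt) (use s2 in \<open>simp add: power2_eq_square\<close>)
  have c1: "c < 1" using c2 s by (smt (verit) one_le_power zero_less_power)
  have cs: "1 - c \<le> s"
  proof (rule ccontr)
    assume "\<not> ?thesis"
    then have "(1 - s)\<^sup>2 > c\<^sup>2" using chalf by (intro power_strict_mono) auto
    then have "1 - 2 * s + s\<^sup>2 > 1 - s\<^sup>2" using c2 by (simp add: power2_eq_square algebra_simps)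
    then have "s * s > s * 1" by (simp add: power2_eq_square)
    then show False using s by simp
  qed
  define a where "a = Complex c s"
  define b where "b = Complex c (-s)"
  define m where "m = Complex (c - s) 0"
  \<comment> \<open>The horizontal width of the triangle at the height of z: its slice there is
    [c - \<phi> z, c]. It vanishes at the corners \<open>a\<close> and \<open>b\<close>.\<close>
  define \<phi> where "\<phi> = (\<lambda>z. s - \<bar>Im z\<bar>)"
  define T where "T = convex hull {a, m, b}"
  have memT: "z \<in> T \<longleftrightarrow> c - \<phi> z \<le> Re z \<and> Re z \<le> c" for z
  proof
    assume "z \<in> T"
    then obtain u v w where uvw: "0 \<le> u" "0 \<le> v" "0 \<le> w" "u + v + w = 1" and z: "z = u *\<^sub>R a + v *\<^sub>R m + w *\<^sub>R b"
      unfolding T_def convex_hull_3 by auto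
    have v: "v = 1 - u - w" using uvw by simp
    have Re: "Re z = c - s * v" unfolding z v by (simp add: a_def b_def m_def algebra_simps)
    have Im: "Im z = s * u - s * w" unfolding z by (simp add: a_def b_def m_def algebra_simps)
    have "0 \<le> s * u" "0 \<le> s * v" "0 \<le> s * w" using s uvw by auto
    moreover have "s * u + s * v + s * w = s" using uvw(4) by (metis distrib_left mult.right_neutral)
    ultimately show "c - \<phi> z \<le> Re z \<and> Re z \<le> c" unfolding Re \<phi>_def Im by (auto simp: abs_if)
  next
    assume z: "c - \<phi> z \<le> Re z \<and> Re z \<le> c"
    \<comment> \<open>Barycentric coordinates of z: v belongs to \<open>m\<close>, u to
      \<open>a\<close> and w to \<open>b\<close>.\<close>
    define v where "v = (c - Re z) / s"
    define u where "u = (1 - v + Im z / s) / 2"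
    define w where "w = (1 - v - Im z / s) / 2"
    have sv: "s * v = c - Re z" "s * (Im z / s) = Im z" "0 \<le> v" using s z by (auto simp: v_def)
    have "0 \<le> s * (1 - v + Im z / s)" "0 \<le> s * (1 - v - Im z / s)"
      unfolding distrib_left right_diff_distrib sv using z by (auto simp: \<phi>_def abs_if split: if_splits)
    then have "0 \<le> u" "0 \<le> v" "0 \<le> w" using s sv(3) by (auto simp: u_def w_def zero_le_mult_iff)
    moreover have "u + v + w = 1" by (simp add: u_def w_def field_simps)
    moreover have "z = u *\<^sub>R a + v *\<^sub>R m + w *\<^sub>R b"
      using s by (auto simp: complex_eq_iff a_def b_def m_def u_def w_def v_def field_simps)
    ultimately show "z \<in> T" unfolding T_def convex_hull_3 by blast
  qed
  have convT: "convex T" by (simp add: T_def)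
  have abT: "a \<in> T" "b \<in> T" "m \<in> T" using s by (auto simp: memT a_def b_def m_def \<phi>_def)
  have segT: "closed_segment a b \<subseteq> T" "closed_segment a m \<subseteq> T" "closed_segment m b \<subseteq> T" "closed_segment b a \<subseteq> T"
    using abT convT by (auto simp: closed_segment_subset)
  have chord: "Re z = c" if seg: "z \<in> closed_segment a b" for z
  proof -
    obtain u where "z = (1 - u) *\<^sub>R a + u *\<^sub>R b" using seg by (auto simp: closed_segment_def)
    then have "Re z = (1 - u) * c + u * c" by (simp add: a_def b_def)
    then show ?thesis by (simp add: algebra_simps)
  qed
  have gam: "Re z = c - \<phi> z" if seg: "z \<in> closed_segment a m \<union> closed_segment m b" for z
  proof -
    consider "z \<in> closed_segment a m" | "z \<in> closed_segment m b" using seg by blast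
    then show ?thesis
    proof cases
      case 1
      then obtain u where u: "0 \<le> u" "u \<le> 1" "z = (1 - u) *\<^sub>R a + u *\<^sub>R m" by (auto simp: closed_segment_def)
      have "0 \<le> (1 - u) * s" using u s by simp
      then show ?thesis unfolding \<phi>_def u(3) by (simp add: a_def m_def algebra_simps)
    next
      case 2
      then obtain u where u: "0 \<le> u" "u \<le> 1" "z = (1 - u) *\<^sub>R m + u *\<^sub>R b" by (auto simp: closed_segment_def)
      have "0 \<le> u * s" using u s by simp
      then show ?thesis unfolding \<phi>_def u(3) by (simp add: b_def m_def algebra_simps)
    qed
  qed
  have phiT: "0 \<le> \<phi> z" if "z \<in> T" for z using that by (simp add: memT)
  have near: "cmod (z - 1) < e" if "c - s \<le> Re z" "Re z \<le> 1" "\<bar>Im z\<bar> \<le> s" for z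
    using cmod_le[of "z - 1"] that cs s by simp
  have disc: "\<bar>Im z\<bar> < s" if "cmod z < 1" "c \<le> Re z" for z
  proof (rule ccontr)
    assume "\<not> ?thesis"
    then have "s\<^sup>2 \<le> \<bar>Im z\<bar>\<^sup>2" using s by (intro power_mono) auto
    moreover have "c\<^sup>2 \<le> (Re z)\<^sup>2" using that chalf by (intro power_mono) auto
    ultimately have "1 \<le> (cmod z)\<^sup>2" using c2 by (simp add: cmod_power2)
    then show False using that(1) by (simp add: power2_nonneg_ge_1_iff)
  qed
  \<comment> \<open>\<open>T\<close> meets the unit circle only at \<open>a\<close> and
    \<open>b\<close>, so these are the only points of \<open>T\<close> where G is
    uncontrolled.\<close>
  have TO: "z \<in> ?O \<or> z = a \<or> z = b" if "z \<in> T" for z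
  proof (cases "\<bar>Im z\<bar> = s")
    case True
    then have "Re z = c" using that by (simp add: memT \<phi>_def)
    then show ?thesis using True by (auto simp: a_def b_def complex_eq_iff abs_if split: if_splits)
  next
    case False
    then have i: "\<bar>Im z\<bar> < s" using phiT[OF that] by (simp add: \<phi>_def)
    have R: "c - s \<le> Re z" "Re z \<le> c" using that by (auto simp: memT \<phi>_def)
    have "\<bar>Im z\<bar>\<^sup>2 < s\<^sup>2" using i by (intro power_strict_mono) auto
    moreover have "\<bar>Re z\<bar>\<^sup>2 \<le> c\<^sup>2" using R s chalf by (intro power_mono) auto
    ultimately have "(cmod z)\<^sup>2 < 1" using c2 by (simp add: cmod_power2)
    then have "cmod z < 1" by (simp add: power_less_one_iff)
    moreover have "cmod (z - 1) < e" using near[of z] R c1 i by simp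
    ultimately show ?thesis by (simp add: dist_norm norm_minus_commute)
  qed
  have RO: "z \<in> ?O" "0 < \<phi> z" if "cmod z < 1" "c - \<phi> z < Re z" for z
  proof -
    show p: "0 < \<phi> z"
      using that disc[of z] by (cases "c \<le> Re z") (auto simp: \<phi>_def)
    have "Re z \<le> 1" using that(1) complex_Re_le_cmod[of z] by simp
    then have "cmod (z - 1) < e" using near[of z] p that by (simp add: \<phi>_def)
    then show "z \<in> ?O" using that by (simp add: dist_norm norm_minus_commute)
  qed
  have ab1: "cmod a = 1" "cmod b = 1" using c2 by (auto simp: a_def b_def cmod_def)
  define D where "D = cmod ((1 - a) * (1 - b))"
  have "Re a = c" "Re b = c" by (simp_all add: a_def b_def)
  then have ab: "a \<noteq> 1" "b \<noteq> 1" using c1 by auto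
  then have D: "0 < D" by (simp add: D_def)
  define q where "q = (\<lambda>z. (z - a) * (z - b) / ((1 - a) * (1 - b)))"
  have qle: "cmod (q z) \<le> 4 / D" if "cmod z \<le> 1" for z
  proof -
    have "cmod (z - a) \<le> 2" "cmod (z - b) \<le> 2"
      using norm_triangle_ineq4[of z a] norm_triangle_ineq4[of z b] ab1 that by auto
    then have "cmod (z - a) * cmod (z - b) \<le> 2 * 2" by (intro mult_mono) auto
    then show ?thesis using D by (simp add: q_def norm_divide norm_mult D_def divide_right_mono)
  qed
  have T1: "cmod z \<le> 1" if "z \<in> T" for z using TO[OF that] ab1 by auto
  \<comment> \<open>In the upper half the horizontal and the vertical distance from z to
    \<open>a\<close> are each at most \<phi> z, and |z - b| \<le> 2; in the lower half
    \<open>a\<close> and \<open>b\<close> exchange roles.\<close>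
  have qT: "cmod (q z) \<le> 4 * \<phi> z / D" if z: "z \<in> T" for z
  proof -
    have 2: "cmod (z - a) \<le> 2" "cmod (z - b) \<le> 2"
      using norm_triangle_ineq4[of z a] norm_triangle_ineq4[of z b] ab1 T1[OF z] by auto
    have "cmod (z - a) * cmod (z - b) \<le> 4 * \<phi> z"
    proof (cases "0 \<le> Im z")
      case True
      then have "cmod (z - a) \<le> 2 * \<phi> z"
        using cmod_le[of "z - a"] z phiT[OF z] by (auto simp: memT \<phi>_def a_def)
      then have "cmod (z - a) * cmod (z - b) \<le> (2 * \<phi> z) * 2" using 2 phiT[OF z] by (intro mult_mono) auto
      then show ?thesis by simp
    next
      case False
      then have "cmod (z - b) \<le> 2 * \<phi> z"
        using cmod_le[of "z - b"] z phiT[OF z] by (auto simp: memT \<phi>_def b_def)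
      then have "cmod (z - a) * cmod (z - b) \<le> 2 * (2 * \<phi> z)" using 2 phiT[OF z] by (intro mult_mono) auto
      then show ?thesis by simp
    qed
    then show ?thesis using D by (simp add: q_def norm_divide norm_mult D_def divide_right_mono)
  qed
  have phiL: "\<bar>\<phi> w - \<phi> z\<bar> \<le> cmod (w - z)" for w z
    using abs_Im_le_cmod[of "w - z"] by (auto simp: \<phi>_def)
  \<comment> \<open>The horizontal gap bounds |w - z| below by \<phi> z / 2; since \<phi> is
    1-Lipschitz, this becomes a bound in terms of \<phi> w, which is the quantity that the zeros of
    \<open>q\<close> can compensate.\<close>
  have sep1: "\<phi> w / 4 \<le> cmod (w - z)" if "w \<in> closed_segment a b" "Re z \<le> c - \<phi> z / 2" for w z
  proof -
    have "Re w = c" "w \<in> T" using chord segT that by auto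
    moreover have "Re w - Re z \<le> cmod (w - z)" using complex_Re_le_cmod[of "w - z"] by simp
    ultimately show ?thesis using phiT[of w] that(2) phiL[of w z] by linarith
  qed
  have sep2: "\<phi> w / 4 \<le> cmod (w - z)" if "w \<in> closed_segment a m \<union> closed_segment m b" "c - \<phi> z / 2 \<le> Re z" for w z
  proof -
    have "Re w = c - \<phi> w" "w \<in> T" using gam segT that by auto
    moreover have "Re z - Re w \<le> cmod (w - z)" using abs_Re_le_cmod[of "w - z"] by simp
    ultimately show ?thesis using phiT[of w] that(2) phiL[of w z] by linarith
  qed
  \<comment> \<open>(4 / D) times 4: the estimate 4 \<phi> / D for \<open>q\<close> from
    \<open>qT\<close> divided by the distance \<phi> / 4 from \<open>sep1\<close> and
    \<open>sep2\<close>.\<close>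
  define B where "B = 16 / D"
  have B: "0 < B" using D by (simp add: B_def)
  define C1 where "C1 = (\<lambda>G z. contour_integral (linepath a b) (\<lambda>w. q w * G w / (w - z)) / (2 * pi * \<i>))"
  define C2 where "C2 = (\<lambda>G z. (contour_integral (linepath a m) (\<lambda>w. q w * G w / (w - z)) +
      contour_integral (linepath m b) (\<lambda>w. q w * G w / (w - z))) / (2 * pi * \<i>))"
  \<comment> \<open>The constant \<open>C2 G 1\<close> makes the error vanish at 1: near 1, P G - G
    = (q - 1) G - (C2 G z - C2 G 1), and both terms are O(|z - 1|).\<close>
  define P where "P = (\<lambda>G z. (if Re z \<le> c - \<phi> z / 2 then - C1 G z else q z * G z - C2 G z) + C2 G 1)"
  have left: "Re z < c" if "cmod z < 1" "Re z \<le> c - \<phi> z / 2" for z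
  proof (rule ccontr)
    assume n: "\<not> ?thesis"
    then have "\<bar>Im z\<bar> < s" using disc[of z] that by simp
    then have "0 < \<phi> z" by (simp add: \<phi>_def)
    then show False using n that(2) by linarith
  qed
  have right: "c - \<phi> z < Re z" if "cmod z < 1" "\<not> Re z \<le> c - \<phi> z / 2" for z
  proof (cases "c \<le> Re z")
    case True
    then show ?thesis using disc[of z] that by (simp add: \<phi>_def)
  next
    case False
    then show ?thesis using that by linarith
  qed
  have notab: "z \<notin> closed_segment a b" if "Re z \<noteq> c" for z using chord that by auto
  have notgam: "z \<notin> closed_segment a m" "z \<notin> closed_segment m b" if "Re z \<noteq> c - \<phi> z" for z
    using gam that by auto
  have one: "c - \<phi> 1 < Re 1" "c - \<phi> 1 / 2 \<le> Re 1" using s c1 by (auto simp: \<phi>_def)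
  \<comment> \<open>At \<open>a\<close> and \<open>b\<close> the values of G are arbitrary, but
    \<open>q\<close> vanishes there and G is bounded on the rest of \<open>T\<close>, so the product
    is continuous up to the corners.\<close>
  have cont: "continuous_on T (\<lambda>w. q w * G w)" 
    if G: "G holomorphic_on ?O" and M: "\<And>z. z\<in>?O \<Longrightarrow> cmod (G z) \<le> M" for G M
    unfolding continuous_on_eq_continuous_within
  proof
    fix x assume x: "x \<in> T"
    show "continuous (at x within T) (\<lambda>w. q w * G w)"
    proof (cases "x \<in> ?O")
      case True
      then have "continuous (at x) G"
        using holomorphic_on_imp_continuous_on[OF G] oO continuous_on_eq_continuous_at by blast
      then have "continuous (at x) (\<lambda>w. q w * G w)"
        using ab unfolding q_def by (intro continuous_intros) auto
      then show ?thesis by (rule continuous_at_imp_continuous_at_within)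
    next
      case False
      then have q0: "q x = 0" using TO[OF x] by (auto simp: q_def)
      have "((\<lambda>w. q w * G w) \<longlongrightarrow> 0) (at x within T)"
      proof (rule Lim_null_comparison)
        show "eventually (\<lambda>w. cmod (q w * G w) \<le> cmod (q w) * M) (at x within T)"
          unfolding eventually_at_filter
        proof (rule always_eventually, intro allI impI)
          fix w assume "w \<in> T"
          then have "w \<in> ?O \<or> q w = 0" using TO[of w] by (auto simp: q_def)
          then show "cmod (q w * G w) \<le> cmod (q w) * M"
            using M[of w] by (auto simp: norm_mult intro: mult_left_mono)
        qed
        have "((\<lambda>w. cmod (q w) * M) \<longlongrightarrow> cmod (q x) * M) (at x within T)"
          unfolding q_def using ab by (intro tendsto_intros) auto
        then show "((\<lambda>w. cmod (q w) * M) \<longlongrightarrow> 0) (at x within T)" by (simp add: q0)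
      qed
      then show ?thesis by (simp add: continuous_within q0)
    qed
  qed
  have kernel: "cmod (q w * G w / (w - z)) \<le> B * M"
    if M: "\<And>z. z\<in>?O \<Longrightarrow> cmod (G z) \<le> M" and M0: "0 \<le> M" and w: "w \<in> T" and d: "\<phi> w / 4 \<le> cmod (w - z)" for G M w z
  proof (cases "w \<in> ?O \<and> w \<noteq> z")
    case True
    have "cmod (q w * G w) \<le> (4 * \<phi> w / D) * M"
      unfolding norm_mult using True M[of w] qT[OF w] M0 phiT[OF w] D by (intro mult_mono) auto
    also have "\<dots> = B * M * (\<phi> w / 4)" by (simp add: B_def)
    also have "\<dots> \<le> B * M * cmod (w - z)" using d B M0 by (intro mult_left_mono) auto
    finally show ?thesis using True by (simp add: norm_divide pos_divide_le_eq)
  next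
    case False
    then have "q w = 0 \<or> w = z" using TO[OF w] by (auto simp: q_def)
    then show ?thesis using B M0 by auto
  qed
  have C1b: "cmod (C1 G z) \<le> B * M" 
    if G: "G holomorphic_on ?O" and M: "\<And>z. z\<in>?O \<Longrightarrow> cmod (G z) \<le> M" and M0: "0 \<le> M" 
      and z: "Re z < c" "Re z \<le> c - \<phi> z / 2" for G M z
  proof -
    have "cmod (contour_integral (linepath a b) (\<lambda>w. q w * G w / (w - z))) \<le> B * M * cmod (b - a)"
      using z segT B M0 notab[of z]
      by (intro contour_integral_bound_linepath Cauchy_transform_linepath(2) continuous_on_subset[OF cont[OF G M]] kernel M sep1) auto
    also have "\<dots> \<le> B * M * 2"
      using norm_triangle_ineq4[of b a] ab1 B M0 by (intro mult_left_mono) auto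
    also have "\<dots> \<le> B * M * (2 * pi)" using B M0 pi_gt3 by (intro mult_left_mono) auto
    finally show ?thesis by (simp add: C1_def norm_divide norm_mult pos_divide_le_eq)
  qed
  have C2b: "cmod (C2 G z) \<le> B * M" 
    if G: "G holomorphic_on ?O" and M: "\<And>z. z\<in>?O \<Longrightarrow> cmod (G z) \<le> M" and M0: "0 \<le> M" 
      and z: "c - \<phi> z < Re z" "c - \<phi> z / 2 \<le> Re z" for G M z
  proof -
    have m1: "cmod m \<le> 1" using T1 abT by blast
    have "cmod (contour_integral (linepath a m) (\<lambda>w. q w * G w / (w - z))) \<le> B * M * cmod (m - a)"
      using z segT B M0 notgam[of z]
      by (intro contour_integral_bound_linepath Cauchy_transform_linepath(2) continuous_on_subset[OF cont[OF G M]] kernel M sep2) auto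
    also have "\<dots> \<le> B * M * 2"
      using norm_triangle_ineq4[of m a] ab1 m1 B M0 by (intro mult_left_mono) auto
    finally have 1: "cmod (contour_integral (linepath a m) (\<lambda>w. q w * G w / (w - z))) \<le> B * M * 2" .
    have "cmod (contour_integral (linepath m b) (\<lambda>w. q w * G w / (w - z))) \<le> B * M * cmod (b - m)"
      using z segT B M0 notgam[of z]
      by (intro contour_integral_bound_linepath Cauchy_transform_linepath(2) continuous_on_subset[OF cont[OF G M]] kernel M sep2) auto
    also have "\<dots> \<le> B * M * 2"
      using norm_triangle_ineq4[of b m] ab1 m1 B M0 by (intro mult_left_mono) auto
    finally have 2: "cmod (contour_integral (linepath m b) (\<lambda>w. q w * G w / (w - z))) \<le> B * M * 2" .
    have "cmod (contour_integral (linepath a m) (\<lambda>w. q w * G w / (w - z)) +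
      contour_integral (linepath m b) (\<lambda>w. q w * G w / (w - z))) \<le> B * M * 4"
      by (rule norm_triangle_le) (use 1 2 in linarith)
    also have "\<dots> \<le> B * M * (2 * pi)" using B M0 pi_gt3 by (intro mult_left_mono) auto
    finally show ?thesis by (simp add: C2_def norm_divide norm_mult pos_divide_le_eq)
  qed
  have overlap: "C2 G z - C1 G z = q z * G z"
    if G: "G holomorphic_on ?O" and M: "\<And>z. z\<in>?O \<Longrightarrow> cmod (G z) \<le> M" 
      and z: "c - \<phi> z < Re z" "Re z < c" for G M z
  proof -
    let ?f = "\<lambda>w. q w * G w"
    have cG: "continuous_on T ?f" by (rule cont[OF G M])
    \<comment> \<open>The boundary of \<open>T\<close>, run through counterclockwise. The corners
      \<open>a\<close> and \<open>b\<close> are put into the exceptional set of Cauchy's formula,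
      since only continuity of q G is known there.\<close>
    let ?\<gamma> = "linepath a m +++ linepath m b +++ linepath b a"
    have "open {w. c - (s - \<bar>Im w\<bar>) < Re w \<and> Re w < c}"
      by (intro open_Collect_conj open_Collect_less continuous_intros)
    then have zi: "z \<in> interior T"
      using z by (intro interiorI[of "{w. c - \<phi> w < Re w \<and> Re w < c}"]) (auto simp: memT \<phi>_def)
    have img: "path_image ?\<gamma> = closed_segment a m \<union> closed_segment m b \<union> closed_segment b a"
      by (simp add: path_image_join Un_assoc)
    have "((\<lambda>w. ?f w / (w - z)) has_contour_integral (2*pi * \<i> * winding_number ?\<gamma> z * ?f z)) ?\<gamma>"
    proof (rule Cauchy_integral_formula_weak[of T "{a,b}"])
      fix x assume x: "x \<in> interior T - {a, b}"
      then have "x \<in> ?O" using TO[of x] interior_subset by blast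
      then have "G field_differentiable at x" using G oO by (auto intro: holomorphic_on_imp_differentiable_at)
      then show "?f field_differentiable at x"
        unfolding q_def by (intro derivative_intros field_differentiable_mult field_differentiable_divide) (use ab in auto)
    next
      show "z \<in> interior T - {a, b}" using zi z by (auto simp: a_def b_def)
      show "path_image ?\<gamma> \<subseteq> T - {z}"
        unfolding img using segT notgam[of z] notab[of z] z closed_segment_commute[of a b] by auto
    qed (use convT cG in auto)
    moreover have "winding_number ?\<gamma> z = 1"
    proof -
      have "0 < Im ((m - a) * cnj (m - z))"
      proof -
        have "Im ((m - a) * cnj (m - z)) = s * (Re z - (c - s) - Im z)"
          by (simp add: m_def a_def algebra_simps)
        moreover have "Re z - (c - s) - Im z > 0" using z by (simp add: \<phi>_def abs_if split: if_splits)
        ultimately show ?thesis using s by simp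
      qed
      then show ?thesis using winding_number_triangle[of z a m b] zi by (simp add: T_def)
    qed
    ultimately have *: "((\<lambda>w. ?f w / (w - z)) has_contour_integral (2*pi * \<i> * ?f z)) ?\<gamma>" by simp
    have int: "(\<lambda>w. ?f w / (w - z)) contour_integrable_on linepath a m"
      "(\<lambda>w. ?f w / (w - z)) contour_integrable_on linepath m b"
      "(\<lambda>w. ?f w / (w - z)) contour_integrable_on linepath a b"
      using segT notgam[of z] notab[of z] z
      by (auto intro!: Cauchy_transform_linepath(2) continuous_on_subset[OF cont[OF G M]])
    have rev: "reversepath (linepath a b) = linepath b a" by simp
    have int': "(\<lambda>w. ?f w / (w - z)) contour_integrable_on linepath b a"
      "contour_integral (linepath b a) (\<lambda>w. ?f w / (w - z)) = - contour_integral (linepath a b) (\<lambda>w. ?f w / (w - z))"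
      using contour_integrable_reversepath[OF _ int(3)] contour_integral_reversepath[of "linepath a b" "\<lambda>w. ?f w / (w - z)"]
      unfolding rev by auto
    have "((\<lambda>w. ?f w / (w - z)) has_contour_integral (contour_integral (linepath a m) (\<lambda>w. ?f w / (w - z)) +
       (contour_integral (linepath m b) (\<lambda>w. ?f w / (w - z)) + - contour_integral (linepath a b) (\<lambda>w. ?f w / (w - z))))) ?\<gamma>"
      unfolding int'(2)[symmetric]
      by (intro has_contour_integral_join has_contour_integral_integral int int') auto
    from has_contour_integral_unique[OF this *]
    show ?thesis by (simp add: C1_def C2_def field_simps)
  qed
  have holC1: "C1 G holomorphic_on {z. Re z < c}"
    if G: "G holomorphic_on ?O" and M: "\<And>z. z\<in>?O \<Longrightarrow> cmod (G z) \<le> M" for G M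
    unfolding C1_def using segT notab
    by (intro holomorphic_intros holomorphic_on_subset[OF Cauchy_transform_linepath(1)] continuous_on_subset[OF cont[OF G M]]) auto
  have holC2: "C2 G holomorphic_on {z. c - \<phi> z < Re z}"
    if G: "G holomorphic_on ?O" and M: "\<And>z. z\<in>?O \<Longrightarrow> cmod (G z) \<le> M" for G M
    unfolding C2_def using segT notgam
    by (intro holomorphic_intros holomorphic_on_subset[OF Cauchy_transform_linepath(1)] continuous_on_subset[OF cont[OF G M]]) auto
  \<comment> \<open>The disc of radius 1 - c around 1 lies to the right of the broken line,
    including its part outside the unit disc. So \<open>C2 G\<close> is holomorphic and bounded
    around 1 although G is not controlled there, and its increment from 1 is O(|z - 1|).\<close>
  define \<delta> where "\<delta> = 1 - c"
  have \<delta>: "0 < \<delta>" using c1 by (simp add: \<delta>_def)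
  \<comment> \<open>The sum of three bounds: for the supremum of P G, for the error quotient within
    \<delta> of 1, and for the error quotient where |z - 1| \<ge> \<delta>.\<close>
  define C where "C = 3 * B + 4 / D + 2 * B / \<delta> + (3 * B + 1) / \<delta>"
  have C: "0 \<le> C" "3 * B \<le> C" "4 / D + 2 * B / \<delta> \<le> C" "(3 * B + 1) / \<delta> \<le> C"
    using B D \<delta> by (auto simp: C_def)
  show ?thesis
  proof (rule exI[of _ P], rule exI[of _ C], rule conjI[OF C(1)], rule conjI, intro allI impI)
    fix G M assume G: "G holomorphic_on ?O" and M': "\<forall>z\<in>?O. cmod (G z) \<le> M"
    have M: "\<And>z. z\<in>?O \<Longrightarrow> cmod (G z) \<le> M" using M' by blast
    have "c - \<phi> (of_real c) < Re (of_real c)" "cmod (of_real c) < 1" using s c1 chalf by (auto simp: \<phi>_def)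
    then have "complex_of_real c \<in> ?O" using RO(1) by blast
    then have M0: "0 \<le> M" using M norm_ge_zero order_trans by blast
    let ?L = "ball 0 1 \<inter> {z. Re z < c}" and ?R = "ball 0 1 \<inter> {z. c - \<phi> z < Re z}"
    have oL: "open ?L" by (intro open_Int open_ball open_Collect_less continuous_intros)
    have oR: "open ?R" unfolding \<phi>_def by (intro open_Int open_ball open_Collect_less continuous_intros)
    have "(\<lambda>z. - C1 G z + C2 G 1) holomorphic_on ?L"
      by (intro holomorphic_intros holomorphic_on_subset[OF holC1[OF G M]]) auto
    then have hL: "P G holomorphic_on ?L"
    proof (rule holomorphic_transform)
      fix z assume z: "z \<in> ?L"
      show "- C1 G z + C2 G 1 = P G z"
        using overlap[OF G M, of z] z right[of z] by (auto simp: P_def algebra_simps)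
    qed
    have "G holomorphic_on ?R" using RO(1) by (intro holomorphic_on_subset[OF G]) (auto simp: dist_norm)
    then have "(\<lambda>z. q z * G z - C2 G z + C2 G 1) holomorphic_on ?R"
      unfolding q_def using ab by (intro holomorphic_intros holomorphic_on_subset[OF holC2[OF G M]]) auto
    then have hR: "P G holomorphic_on ?R"
    proof (rule holomorphic_transform)
      fix z assume z: "z \<in> ?R"
      show "q z * G z - C2 G z + C2 G 1 = P G z"
        using overlap[OF G M, of z] z left[of z] by (auto simp: P_def algebra_simps)
    qed
    have "ball 0 1 \<subseteq> ?L \<union> ?R"
    proof
      fix z :: complex assume "z \<in> ball 0 1"
      then show "z \<in> ?L \<union> ?R" using disc[of z] by (cases "Re z < c") (auto simp: \<phi>_def)
    qed
    then have hP: "P G holomorphic_on ball 0 1"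
      using holomorphic_on_Un[OF hL hR oL oR] holomorphic_on_subset by blast
    have P3: "cmod (P G z) \<le> 3 * B * M" if z: "z \<in> ball 0 1" for z
    proof (cases "Re z \<le> c - \<phi> z / 2")
      case True
      have "cmod (P G z) \<le> cmod (C1 G z) + cmod (C2 G 1)"
        unfolding P_def using True norm_triangle_ineq[of "- C1 G z" "C2 G 1"] by simp
      also have "\<dots> \<le> B * M + B * M"
        using z True left[of z] one by (intro add_mono C1b[OF G M M0] C2b[OF G M M0]) auto
      finally show ?thesis using mult_nonneg_nonneg[of B M] B M0 by linarith
    next
      case False
      have zr: "c - \<phi> z < Re z" using right[of z] z False by simp
      have zO: "z \<in> ?O" using RO(1)[of z] zr z by simp
      have "cmod (P G z) \<le> cmod (q z * G z) + cmod (C2 G z) + cmod (C2 G 1)"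
        unfolding P_def using False norm_triangle_ineq[of "q z * G z - C2 G z" "C2 G 1"]
          norm_triangle_ineq4[of "q z * G z" "C2 G z"] by simp
      also have "cmod (q z * G z) \<le> 4 / D * M"
        unfolding norm_mult using qle[of z] M[OF zO] z D by (intro mult_mono) auto
      also have "\<dots> \<le> B * M" using D M0 by (intro mult_right_mono) (auto simp: B_def divide_right_mono)
      also have "cmod (C2 G z) \<le> B * M" using zr False by (intro C2b[OF G M M0]) auto
      also have "cmod (C2 G 1) \<le> B * M" using one by (intro C2b[OF G M M0]) auto
      finally show ?thesis by simp
    qed
    have "cmod (P G z) \<le> C * M" if z: "z \<in> ball 0 1" for z
      using P3[OF z] mult_right_mono[OF C(2) M0] by linarith
    moreover have "cmod (P G z - G z) \<le> C * M * cmod (z - 1)" if z: "z \<in> ?O" for z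
    proof (cases "z \<in> ball 1 \<delta>")
      case True
      have R1: "c - \<phi> w < Re w" "c - \<phi> w / 2 \<le> Re w" if "w \<in> ball 1 \<delta>" for w
      proof -
        have "cmod (1 - w) < 1 - c" using that by (simp add: \<delta>_def dist_norm)
        then have "1 - Re w < 1 - c" "\<bar>Im w\<bar> < 1 - c"
          using abs_Re_le_cmod[of "1 - w"] abs_Im_le_cmod[of "1 - w"] by auto
        moreover from this have "0 < \<phi> w" using cs by (simp add: \<phi>_def)
        ultimately show "c - \<phi> w < Re w" "c - \<phi> w / 2 \<le> Re w" by linarith+
      qed
      have "\<not> Re z \<le> c - \<phi> z / 2"
      proof -
        have "0 < \<phi> z" using RO(2)[of z] R1[OF True] z by simp
        moreover have "1 - Re z < 1 - c"
          using True abs_Re_le_cmod[of "1 - z"] by (simp add: \<delta>_def dist_norm)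
        ultimately show ?thesis by simp
      qed
      then have "P G z - G z = (q z - 1) * G z - (C2 G z - C2 G 1)"
        by (simp add: P_def algebra_simps)
      also have "cmod \<dots> \<le> cmod (q z - 1) * cmod (G z) + cmod (C2 G z - C2 G 1)"
        using norm_triangle_ineq4 norm_mult by metis
      also have "cmod (q z - 1) \<le> 4 / D * cmod (z - 1)"
      proof -
        have "q z - 1 = (z - 1) * (z + 1 - a - b) / ((1 - a) * (1 - b))"
        proof -
          have "q z - 1 = ((z - a) * (z - b) - (1 - a) * (1 - b)) / ((1 - a) * (1 - b))"
            using ab by (simp add: q_def diff_divide_distrib)
          then show ?thesis by (simp add: algebra_simps)
        qed
        moreover have "cmod (z + 1 - a - b) \<le> 4"
          using norm_triangle_ineq[of z 1] norm_triangle_ineq4[of "z + 1" a] norm_triangle_ineq4[of "z + 1 - a" b] ab1 z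
          by simp
        ultimately show ?thesis
          using D mult_left_mono[of "cmod (z + 1 - a - b)" 4 "cmod (z - 1)"] unfolding D_def
          by (simp add: norm_mult norm_divide divide_right_mono)
      qed
      also have "cmod (C2 G z - C2 G 1) \<le> 2 * (B * M) / \<delta> * cmod (z - 1)"
      proof -
        have h: "C2 G holomorphic_on ball 1 \<delta>"
          using R1 by (intro holomorphic_on_subset[OF holC2[OF G M]]) auto
        have "cmod (C2 G w) \<le> B * M" if "w \<in> ball 1 \<delta>" for w
          using R1[OF that] by (intro C2b[OF G M M0])
        from holomorphic_difference_quotient_bound(2)[OF h this \<delta> True]
        show ?thesis by (cases "z = 1") (auto simp: norm_divide field_simps)
      qed
      also have "4 / D * cmod (z - 1) * cmod (G z) \<le> 4 / D * cmod (z - 1) * M"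
        using M[OF z] D by (intro mult_left_mono) auto
      finally have "cmod (P G z - G z) \<le> (4 / D + 2 * B / \<delta>) * (M * cmod (z - 1))"
        by (simp add: algebra_simps mult_right_mono)
      also have "\<dots> \<le> C * (M * cmod (z - 1))" using C M0 by (intro mult_right_mono) auto
      finally show ?thesis by simp
    next
      case False
      then have d: "\<delta> \<le> cmod (z - 1)" by (simp add: dist_norm norm_minus_commute)
      have "cmod (P G z - G z) \<le> (3 * B + 1) * M"
        using norm_triangle_ineq4[of "P G z" "G z"] P3[of z] M[OF z] z by (simp add: algebra_simps)
      also have "\<dots> = (3 * B + 1) / \<delta> * (M * \<delta>)" using \<delta> by simp
      also have "\<dots> \<le> C * (M * cmod (z - 1))" using C M0 d \<delta> B by (intro mult_mono) auto
      finally show ?thesis by simp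
    qed
    ultimately show "P G holomorphic_on ball 0 1 \<and> (\<forall>z\<in>ball 0 1. cmod (P G z) \<le> C * M) \<and>
        (\<forall>z\<in>?O. cmod (P G z - G z) \<le> C * M * cmod (z - 1))" using hP by blast
  next
    show "\<forall>G1 G2 M a b. G1 holomorphic_on ?O \<longrightarrow> G2 holomorphic_on ?O \<longrightarrow>
        (\<forall>z\<in>?O. cmod (G1 z) \<le> M \<and> cmod (G2 z) \<le> M) \<longrightarrow>
        (\<forall>z\<in>ball 0 1. P (\<lambda>w. a * G1 w + b * G2 w) z = a * P G1 z + b * P G2 z)"
    proof (intro allI impI ballI)
      fix G1 G2 :: "complex \<Rightarrow> complex" and M :: real and \<alpha> \<beta> z :: complex
      assume G: "G1 holomorphic_on ?O" "G2 holomorphic_on ?O"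
        and M: "\<forall>z\<in>?O. cmod (G1 z) \<le> M \<and> cmod (G2 z) \<le> M" and z: "z \<in> ball 0 1"
      have M12: "\<And>z. z\<in>?O \<Longrightarrow> cmod (G1 z) \<le> M" "\<And>z. z\<in>?O \<Longrightarrow> cmod (G2 z) \<le> M" using M by auto
      note c12 = cont[OF G(1) M12(1)] cont[OF G(2) M12(2)]
      have eq: "(\<lambda>w. q w * (\<alpha> * G1 w + \<beta> * G2 w) / (w - z)) = (\<lambda>w. (\<alpha> * (q w * G1 w) + \<beta> * (q w * G2 w)) / (w - z))" for z
        by (simp add: algebra_simps)
      have l1: "C1 (\<lambda>w. \<alpha> * G1 w + \<beta> * G2 w) z = \<alpha> * C1 G1 z + \<beta> * C1 G2 z" if "Re z < c" for z
      proof -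
        have ns: "z \<notin> closed_segment a b" using notab[of z] that by auto
        have "contour_integral (linepath a b) (\<lambda>w. q w * (\<alpha> * G1 w + \<beta> * G2 w) / (w - z)) =
            \<alpha> * contour_integral (linepath a b) (\<lambda>w. q w * G1 w / (w - z)) + \<beta> * contour_integral (linepath a b) (\<lambda>w. q w * G2 w / (w - z))"
          unfolding eq
          by (rule Cauchy_transform_linepath_linear[OF continuous_on_subset[OF c12(1) segT(1)] continuous_on_subset[OF c12(2) segT(1)] ns])
        then show ?thesis by (simp add: C1_def add_divide_distrib)
      qed
      have l2: "C2 (\<lambda>w. \<alpha> * G1 w + \<beta> * G2 w) z = \<alpha> * C2 G1 z + \<beta> * C2 G2 z" if "c - \<phi> z < Re z" for z
      proof -
        have ns: "z \<notin> closed_segment a m" "z \<notin> closed_segment m b" using notgam[of z] that by auto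
        have "contour_integral (linepath a m) (\<lambda>w. q w * (\<alpha> * G1 w + \<beta> * G2 w) / (w - z)) =
            \<alpha> * contour_integral (linepath a m) (\<lambda>w. q w * G1 w / (w - z)) + \<beta> * contour_integral (linepath a m) (\<lambda>w. q w * G2 w / (w - z))"
          unfolding eq
          by (rule Cauchy_transform_linepath_linear[OF continuous_on_subset[OF c12(1) segT(2)] continuous_on_subset[OF c12(2) segT(2)] ns(1)])
        moreover have "contour_integral (linepath m b) (\<lambda>w. q w * (\<alpha> * G1 w + \<beta> * G2 w) / (w - z)) =
            \<alpha> * contour_integral (linepath m b) (\<lambda>w. q w * G1 w / (w - z)) + \<beta> * contour_integral (linepath m b) (\<lambda>w. q w * G2 w / (w - z))"
          unfolding eq
          by (rule Cauchy_transform_linepath_linear[OF continuous_on_subset[OF c12(1) segT(3)] continuous_on_subset[OF c12(2) segT(3)] ns(2)])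
        ultimately show ?thesis by (simp add: C2_def add_divide_distrib distrib_left)
      qed
      show "P (\<lambda>w. \<alpha> * G1 w + \<beta> * G2 w) z = \<alpha> * P G1 z + \<beta> * P G2 z"
        using left[of z] right[of z] z l1[of z] l2[of z] l2[OF one(1)] unfolding P_def
        by (simp add: algebra_simps)
    qed
  qed
qed

text \<open>Multiplication by the conjugate of l rotates the base point to 1. A point l on the
  circle is outside the domain, so the cofactor can be defined by division; its bound is the error
  estimate of order |z - l|.\<close>

lemma extension_operators_boundary:
  assumes l: "cmod l = 1" and e: "0 < e"
  shows "\<exists>P Q C. extension_operators l e P Q C"
proof -
  let ?O = "ball 0 1 \<inter> ball l e" and ?O1 = "ball 0 1 \<inter> ball 1 e"
  obtain P C where C: "0 \<le> C" and
    P0: "\<forall>G M. G holomorphic_on ?O1 \<longrightarrow> (\<forall>z\<in>?O1. cmod (G z) \<le> M) \<longrightarrow>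
        P G holomorphic_on ball 0 1 \<and> (\<forall>z\<in>ball 0 1. cmod (P G z) \<le> C * M) \<and>
        (\<forall>z\<in>?O1. cmod (P G z - G z) \<le> C * M * cmod (z - 1))"
    and lin0: "\<forall>G1 G2 M a b. G1 holomorphic_on ?O1 \<longrightarrow> G2 holomorphic_on ?O1 \<longrightarrow>
        (\<forall>z\<in>?O1. cmod (G1 z) \<le> M \<and> cmod (G2 z) \<le> M) \<longrightarrow>
        (\<forall>z\<in>ball 0 1. P (\<lambda>w. a * G1 w + b * G2 w) z = a * P G1 z + b * P G2 z)"
    using extension_operator_one[OF e] by (elim exE conjE)
  have ll: "l * cnj l = 1" "cnj l * l = 1" using l by (simp_all add: complex_norm_square[symmetric] mult.commute)
  have rot: "cmod (l * z - l) = cmod (z - 1)" "cmod (cnj l * z - 1) = cmod (z - l)" for z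
  proof -
    show "cmod (l * z - l) = cmod (z - 1)"
      using l norm_mult[of l "z - 1"] by (simp add: right_diff_distrib)
    have "cnj l * z - 1 = cnj l * (z - l)" using ll by (simp add: right_diff_distrib)
    then show "cmod (cnj l * z - 1) = cmod (z - l)" using l by (simp add: norm_mult)
  qed
  have O1: "l * z \<in> ?O" if "z \<in> ?O1" for z
    using that rot(1)[of z] l by (auto simp: dist_norm norm_mult norm_minus_commute)
  have O2: "cnj l * z \<in> ?O1" if "z \<in> ?O" for z
    using that rot(2)[of z] l by (auto simp: dist_norm norm_mult norm_minus_commute)
  have lO: "l \<notin> ?O" using l by simp
  define R where "R = (\<lambda>(G::complex\<Rightarrow>complex) w. G (l * w))"
  define P' where "P' = (\<lambda>G z. P (R G) (cnj l * z))"
  define Q' where "Q' = (\<lambda>G z. (P' G z - G z) / (z - l))"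
  have Rhol: "R G holomorphic_on ?O1" if "G holomorphic_on ?O" for G
    unfolding R_def using O1 by (intro holomorphic_on_compose_gen[OF _ that, unfolded o_def] holomorphic_intros) auto
  have RG: "R G (cnj l * z) = G z" for G z using ll by (simp add: R_def mult.assoc[symmetric])
  have "extension_operators l e P' Q' C"
    unfolding extension_operators_def
  proof (intro conjI allI impI)
    show "0 \<le> C" by fact
  next
    fix G M assume G: "G holomorphic_on ?O" and M: "\<forall>z\<in>?O. cmod (G z) \<le> M"
    have "\<forall>z\<in>?O1. cmod (R G z) \<le> M" using M O1 by (auto simp: R_def)
    note PR0 = P0[THEN spec, THEN spec, THEN mp, OF Rhol[OF G], THEN mp, OF this]
    note PR = PR0[THEN conjunct1] PR0[THEN conjunct2, THEN conjunct1, rule_format]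
      PR0[THEN conjunct2, THEN conjunct2, rule_format]
    show hP: "P' G holomorphic_on ball 0 1"
    proof -
      have "(\<lambda>z. cnj l * z) holomorphic_on ball 0 1" "(\<lambda>z. cnj l * z) ` ball 0 1 \<subseteq> ball 0 1"
        using l by (auto simp: norm_mult intro: holomorphic_intros)
      from holomorphic_on_compose_gen[OF this(1) PR(1) this(2)]
      show ?thesis by (simp add: P'_def o_def)
    qed
    show "\<forall>z\<in>ball 0 1. cmod (P' G z) \<le> C * M"
      using PR l by (auto simp: P'_def norm_mult)
    show "Q' G holomorphic_on ?O"
      unfolding Q'_def using lO by (intro holomorphic_intros holomorphic_on_subset[OF hP] G) auto
    show "\<forall>z\<in>?O. P' G z = G z + (z - l) * Q' G z" using lO by (auto simp: Q'_def)
    show "\<forall>z\<in>?O. cmod (Q' G z) \<le> C * M"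
    proof
      fix z assume z: "z \<in> ?O"
      have "cmod (P' G z - G z) \<le> C * M * cmod (z - l)"
        using PR(3)[OF O2[OF z]] by (simp add: P'_def RG rot(2))
      moreover have "z \<noteq> l" using z lO by blast
      ultimately show "cmod (Q' G z) \<le> C * M" by (simp add: Q'_def norm_divide pos_divide_le_eq)
    qed
  next
    fix G1 G2 :: "complex \<Rightarrow> complex" and M :: real and a b :: complex
    assume G: "G1 holomorphic_on ?O" "G2 holomorphic_on ?O"
      and M: "\<forall>z\<in>?O. cmod (G1 z) \<le> M \<and> cmod (G2 z) \<le> M"
    have eq: "R (\<lambda>w. a * G1 w + b * G2 w) = (\<lambda>w. a * R G1 w + b * R G2 w)" by (simp add: R_def)
    have "\<forall>z\<in>?O1. cmod (R G1 z) \<le> M \<and> cmod (R G2 z) \<le> M" using M O1 by (auto simp: R_def)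
    note lin' = lin0[THEN spec, THEN spec, THEN spec, THEN spec, THEN spec, THEN mp, OF Rhol[OF G(1)], THEN mp, OF Rhol[OF G(2)], THEN mp, OF this]
    show *: "\<forall>z\<in>ball 0 1. P' (\<lambda>w. a * G1 w + b * G2 w) z = a * P' G1 z + b * P' G2 z"
      unfolding P'_def eq using lin' l by (auto simp: norm_mult)
    show "\<forall>z\<in>?O. Q' (\<lambda>w. a * G1 w + b * G2 w) z = a * Q' G1 z + b * Q' G2 z"
      using * by (simp add: Q'_def add_divide_distrib diff_divide_distrib ring_distribs)
  qed
  then show ?thesis by blast
qed

lemma extension_operators_exist:
  assumes "cmod l \<le> 1" "0 < e"
  obtains P Q C where "extension_operators l e P Q C"
  using assms extension_operators_interior extension_operators_boundary by (metis order_le_less)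

section \<open>Bounded holomorphic functions on subsets of C(K)\<close>

lemma CK_add_scaled: "x \<in> CK \<Longrightarrow> v \<in> CK \<Longrightarrow> (\<lambda>k. x k + \<xi> * v k) \<in> CK"
  by (auto simp: CK_def intro!: continuous_intros)

lemma CK_lincomb: "x \<in> CK \<Longrightarrow> v \<in> CK \<Longrightarrow> (\<lambda>k. a * x k + b * v k) \<in> CK"
  by (auto simp: CK_def intro!: continuous_intros)

lemma CK_scaled: "v \<in> CK \<Longrightarrow> (\<lambda>k. a * v k) \<in> CK"
  by (auto simp: CK_def intro!: continuous_intros)

lemma dualX_linear:
  "\<phi> \<in> dualX \<Longrightarrow> x \<in> CK \<Longrightarrow> y \<in> CK \<Longrightarrow> \<phi> (\<lambda>k. a * x k + b * y k) = a * \<phi> x + b * \<phi> y"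
  unfolding dualX_def by blast

lemma dualX_scaled: "\<phi> \<in> dualX \<Longrightarrow> x \<in> CK \<Longrightarrow> \<phi> (\<lambda>k. a * x k) = a * \<phi> x"
  using dualX_linear[of \<phi> x x a 0] by simp

lemma norm_le_supn:
  fixes x :: "'k::topological_space \<Rightarrow> complex"
  assumes "compact (UNIV :: 'k set)" "x \<in> CK"
  shows "cmod (x k) \<le> supn x"
proof -
  have "compact (range (\<lambda>k. cmod (x k)))"
    using assms by (intro compact_continuous_image continuous_intros) (auto simp: CK_def)
  then have "bdd_above (range (\<lambda>k. cmod (x k)))"
    by (intro bounded_imp_bdd_above compact_imp_bounded)
  then show ?thesis unfolding supn_def by (rule cSUP_upper[OF UNIV_I])
qed

lemma supn_le: "(\<And>k. cmod (x k) \<le> M) \<Longrightarrow> supn x \<le> M"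
  unfolding supn_def by (rule cSUP_least) auto

lemma supn_nonneg:
  fixes x :: "'k::topological_space \<Rightarrow> complex"
  assumes "compact (UNIV :: 'k set)" "x \<in> CK"
  shows "0 \<le> supn x"
  using norm_le_supn[OF assms] norm_ge_zero order_trans by blast

section \<open>Gateaux holomorphy\<close>

definition gateaux_at :: "(('k::topological_space \<Rightarrow> complex) \<Rightarrow> complex) \<Rightarrow> ('k \<Rightarrow> complex) \<Rightarrow> bool" where
  "gateaux_at h x \<longleftrightarrow> (\<forall>v\<in>CK. (\<lambda>\<xi>. h (\<lambda>k. x k + \<xi> * v k)) field_differentiable at 0)"

text \<open>Checked one line at a time, closed under the algebraic operations below, and meaningful
  on the small sets where 1/(f - c) lives. On the whole ball it matches \<open>Hinf\<close>, by
  \<open>Hinf_imp_bhol\<close> and \<open>bhol_imp_Hinf\<close>.\<close>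

definition bhol :: "('k::topological_space \<Rightarrow> complex) set \<Rightarrow> (('k \<Rightarrow> complex) \<Rightarrow> complex) \<Rightarrow> bool" where
  "bhol A h \<longleftrightarrow> (\<exists>M. \<forall>x\<in>A. cmod (h x) \<le> M) \<and> (\<forall>x\<in>A. gateaux_at h x)"

definition sup_open :: "('k::topological_space \<Rightarrow> complex) set \<Rightarrow> bool" where
  "sup_open A \<longleftrightarrow> A \<subseteq> CK \<and> (\<forall>x\<in>A. \<exists>r>0. \<forall>y\<in>CK. (\<forall>k. cmod (y k - x k) < r) \<longrightarrow> y \<in> A)"

lemma scaled_lt:
  fixes v :: "'k::topological_space \<Rightarrow> complex"
  assumes K: "compact (UNIV :: 'k set)" and v: "v \<in> CK" and r: "0 < r"
    and \<xi>: "cmod \<xi> < r / (supn v + 1)"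
  shows "cmod (\<xi> * v k) < r"
proof -
  have n: "0 \<le> supn v" by (rule supn_nonneg[OF K v])
  have "cmod \<xi> * (supn v + 1) < r" using \<xi> n by (simp add: pos_less_divide_eq)
  moreover have "cmod (\<xi> * v k) \<le> cmod \<xi> * (supn v + 1)"
    unfolding norm_mult using norm_le_supn[OF K v, of k] by (intro mult_left_mono) auto
  ultimately show ?thesis by linarith
qed

lemma sup_open_line:
  fixes A :: "('k::topological_space \<Rightarrow> complex) set"
  assumes K: "compact (UNIV :: 'k set)" and A: "sup_open A" and x: "x \<in> A" and v: "v \<in> CK"
  obtains r where "0 < r" "\<And>\<xi>. cmod \<xi> < r \<Longrightarrow> (\<lambda>k. x k + \<xi> * v k) \<in> A"
proof -
  obtain r where r: "r > 0" and y: "\<And>y. y\<in>CK \<Longrightarrow> (\<And>k. cmod (y k - x k) < r) \<Longrightarrow> y \<in> A" and xC: "x \<in> CK"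
    using A x unfolding sup_open_def by (meson subsetD)
  have n: "0 \<le> supn v" by (rule supn_nonneg[OF K v])
  show thesis
  proof (rule that[of "r / (supn v + 1)"])
    show "0 < r / (supn v + 1)" using r n by simp
    fix \<xi> assume "cmod \<xi> < r / (supn v + 1)"
    then show "(\<lambda>k. x k + \<xi> * v k) \<in> A"
      using scaled_lt[OF K v r] by (intro y CK_add_scaled xC v) simp
  qed
qed

lemma gateaux_line_holomorphic:
  assumes v: "v \<in> CK" and g: "\<And>\<xi>. \<xi> \<in> S \<Longrightarrow> gateaux_at h (\<lambda>k. x k + \<xi> * v k)"
  shows "(\<lambda>\<xi>. h (\<lambda>k. x k + \<xi> * v k)) holomorphic_on S"
  unfolding holomorphic_on_def
proof
  fix \<xi>0 assume "\<xi>0 \<in> S"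
  then have "(\<lambda>\<xi>. h (\<lambda>k. (x k + \<xi>0 * v k) + \<xi> * v k)) field_differentiable at 0"
    using g v unfolding gateaux_at_def by blast
  also have "(\<lambda>\<xi>. h (\<lambda>k. (x k + \<xi>0 * v k) + \<xi> * v k)) = (\<lambda>\<xi>. h (\<lambda>k. x k + (\<xi> + \<xi>0) * v k))"
    by (simp add: algebra_simps)
  finally have "(\<lambda>\<xi>. h (\<lambda>k. x k + \<xi> * v k)) field_differentiable at \<xi>0"
    using DERIV_shift[of "\<lambda>\<xi>. h (\<lambda>k. x k + \<xi> * v k)" _ 0 \<xi>0] unfolding field_differentiable_def by auto
  then show "(\<lambda>\<xi>. h (\<lambda>k. x k + \<xi> * v k)) field_differentiable at \<xi>0 within S"
    by (rule field_differentiable_at_within)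
qed

text \<open>Locality: a short piece of each line through x stays in the open set \<open>A\<close>.
  This is what handles functions defined by cases.\<close>

lemma gateaux_at_cong:
  fixes A :: "('k::topological_space \<Rightarrow> complex) set"
  assumes K: "compact (UNIV :: 'k set)" and A: "sup_open A" and x: "x \<in> A" 
    and eq: "\<And>y. y \<in> A \<Longrightarrow> h y = h' y" and g: "gateaux_at h x"
  shows "gateaux_at h' x"
  unfolding gateaux_at_def
proof
  fix v :: "'k \<Rightarrow> complex" assume v: "v \<in> CK"
  obtain r where r: "0 < r" "\<And>\<xi>. cmod \<xi> < r \<Longrightarrow> (\<lambda>k. x k + \<xi> * v k) \<in> A"
    using sup_open_line[OF K A x v] by blast
  obtain D where D: "((\<lambda>\<xi>. h (\<lambda>k. x k + \<xi> * v k)) has_field_derivative D) (at 0)"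
    using g v unfolding gateaux_at_def field_differentiable_def by blast
  have "((\<lambda>\<xi>. h' (\<lambda>k. x k + \<xi> * v k)) has_field_derivative D) (at 0)"
    by (rule has_field_derivative_transform_within_open[OF D, of "ball 0 r"]) (use r eq in auto)
  then show "(\<lambda>\<xi>. h' (\<lambda>k. x k + \<xi> * v k)) field_differentiable at 0"
    unfolding field_differentiable_def by blast
qed

lemma bhol_subset: "bhol A h \<Longrightarrow> B \<subseteq> A \<Longrightarrow> bhol B h"
  unfolding bhol_def by blast

lemma gateaux_at_add: "gateaux_at f x \<Longrightarrow> gateaux_at g x \<Longrightarrow> gateaux_at (\<lambda>y. f y + g y) x"
  unfolding gateaux_at_def by (auto intro: field_differentiable_add)

lemma gateaux_at_mult: "gateaux_at f x \<Longrightarrow> gateaux_at g x \<Longrightarrow> gateaux_at (\<lambda>y. f y * g y) x"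
  unfolding gateaux_at_def by (auto intro: field_differentiable_mult)

lemma gateaux_at_const: "gateaux_at (\<lambda>y. c) x"
  unfolding gateaux_at_def by auto

lemma gateaux_at_eval: "gateaux_at (\<lambda>y. y k) x"
  unfolding gateaux_at_def by (auto intro!: derivative_intros)

lemma gateaux_at_inverse: "gateaux_at f x \<Longrightarrow> f x \<noteq> 0 \<Longrightarrow> gateaux_at (\<lambda>y. inverse (f y)) x"
  unfolding gateaux_at_def by (auto intro!: field_differentiable_inverse)

lemma bhol_add:
  assumes "bhol A f" "bhol A g" shows "bhol A (\<lambda>y. f y + g y)"
proof -
  obtain M N where M: "\<forall>x\<in>A. cmod (f x) \<le> M" and N: "\<forall>x\<in>A. cmod (g x) \<le> N" using assms unfolding bhol_def by blast
  have "\<forall>x\<in>A. cmod (f x + g x) \<le> M + N" using M N by (auto intro: norm_triangle_le add_mono)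
  then show ?thesis using assms unfolding bhol_def by (blast intro: gateaux_at_add)
qed

lemma bhol_mult:
  assumes "bhol A f" "bhol A g" shows "bhol A (\<lambda>y. f y * g y)"
proof -
  obtain M N where M: "\<forall>x\<in>A. cmod (f x) \<le> M" and N: "\<forall>x\<in>A. cmod (g x) \<le> N" using assms unfolding bhol_def by blast
  have "\<forall>x\<in>A. cmod (f x * g x) \<le> \<bar>M\<bar> * \<bar>N\<bar>"
    unfolding norm_mult
  proof
    fix x assume "x \<in> A"
    then show "cmod (f x) * cmod (g x) \<le> \<bar>M\<bar> * \<bar>N\<bar>"
      using M[rule_format, of x] N[rule_format, of x] by (intro mult_mono) auto
  qed
  then show ?thesis using assms unfolding bhol_def by (blast intro: gateaux_at_mult)
qed

lemma bhol_const: "bhol A (\<lambda>y. c)"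
  unfolding bhol_def using gateaux_at_const by auto

lemma bhol_cmult: "bhol A f \<Longrightarrow> bhol A (\<lambda>y. c * f y)"
  by (rule bhol_mult[OF bhol_const])

lemma bhol_diff: "bhol A f \<Longrightarrow> bhol A g \<Longrightarrow> bhol A (\<lambda>y. f y - g y)"
  using bhol_add[of A f "\<lambda>y. (-1) * g y"] bhol_cmult[of A g "-1"] by simp

lemma bhol_sum:
  assumes "\<And>i. i \<in> I \<Longrightarrow> bhol A (f i)"
  shows "bhol A (\<lambda>y. \<Sum>i\<in>I. f i y)"
  using assms by (induction I rule: infinite_finite_induct) (auto intro: bhol_const bhol_add)

lemma BallX_norm_less:
  fixes x :: "'k::topological_space \<Rightarrow> complex"
  assumes "compact (UNIV :: 'k set)" "x \<in> BallX"
  shows "cmod (x k) < 1"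
  using norm_le_supn[OF assms(1), of x k] assms(2) by (simp add: BallX_def)

lemma BallX_I: "x \<in> CK \<Longrightarrow> (\<And>k. cmod (x k) \<le> r) \<Longrightarrow> r < 1 \<Longrightarrow> x \<in> BallX"
  using supn_le[of x r] by (simp add: BallX_def)

lemma bhol_eval:
  fixes A :: "('k::topological_space \<Rightarrow> complex) set"
  assumes "compact (UNIV :: 'k set)" "A \<subseteq> BallX"
  shows "bhol A (\<lambda>y. y k)"
  unfolding bhol_def using gateaux_at_eval BallX_norm_less[OF assms(1)] assms(2) by (blast intro: less_imp_le)

lemma sup_open_BallX:
  assumes K: "compact (UNIV :: 'k::topological_space set)"
  shows "sup_open (BallX :: ('k \<Rightarrow> complex) set)"
  unfolding sup_open_def
proof (intro conjI ballI)
  fix x :: "'k \<Rightarrow> complex" assume x: "x \<in> BallX"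
  define r where "r = (1 - supn x) / 2"
  have xC: "x \<in> CK" "supn x < 1" using x by (auto simp: BallX_def)
  have "y \<in> BallX" if "y \<in> CK" "\<forall>k. cmod (y k - x k) < r" for y
  proof (rule BallX_I[of _ "supn x + r"])
    show "cmod (y k) \<le> supn x + r" for k
      using norm_triangle_ineq[of "x k" "y k - x k"] that(2)[rule_format, of k] norm_le_supn[OF K xC(1), of k] by simp
    show "supn x + r < 1" using xC by (simp add: r_def field_simps)
  qed (fact that)
  moreover have "r > 0" using xC by (simp add: r_def)
  ultimately show "\<exists>r>0. \<forall>y\<in>CK. (\<forall>k. cmod (y k - x k) < r) \<longrightarrow> y \<in> BallX" by blast
qed (auto simp: BallX_def)

section \<open>Gateaux and Frechet holomorphy of bounded functions\<close>

lemma Hinf_imp_bhol: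
  fixes f :: "('k::topological_space \<Rightarrow> complex) \<Rightarrow> complex"
  assumes K: "compact (UNIV :: 'k set)" and f: "f \<in> Hinf"
  shows "bhol BallX f"
proof -
  have "gateaux_at f x" if x: "x \<in> BallX" for x
    unfolding gateaux_at_def
  proof
    fix v :: "'k \<Rightarrow> complex" assume v: "v \<in> CK"
    obtain L where L: "L \<in> dualX" and d: "\<And>e. e > 0 \<Longrightarrow> \<exists>\<delta>>0. \<forall>h\<in>CK. supn h < \<delta> \<longrightarrow>
      cmod (f (\<lambda>k. x k + h k) - f x - L h) \<le> e * supn h"
      using f x unfolding Hinf_def holo_on_Ball_def by blast
    have n: "0 \<le> supn v" by (rule supn_nonneg[OF K v])
    have "((\<lambda>\<xi>. f (\<lambda>k. x k + \<xi> * v k)) has_field_derivative L v) (at 0)"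
      unfolding DERIV_def LIM_def
    proof (intro allI impI)
      fix e :: real assume e: "0 < e"
      obtain \<delta> where \<delta>: "\<delta> > 0" "\<And>h. h \<in> CK \<Longrightarrow> supn h < \<delta> \<Longrightarrow>
          cmod (f (\<lambda>k. x k + h k) - f x - L h) \<le> e / (supn v + 1) * supn h"
        using d[of "e / (supn v + 1)"] e n by fastforce
      have "dist ((f (\<lambda>k. x k + (0 + z) * v k) - f (\<lambda>k. x k + 0 * v k)) / z) (L v) < e"
        if z: "z \<noteq> 0" "dist z 0 < (\<delta> / 2) / (supn v + 1)" for z
      proof -
        let ?h = "\<lambda>k. z * v k"
        have h: "?h \<in> CK" using v by (rule CK_scaled)
        have "supn ?h \<le> \<delta> / 2"
          using scaled_lt[OF K v, of "\<delta>/2" z] \<delta> z by (intro supn_le less_imp_le) auto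
        then have "cmod (f (\<lambda>k. x k + z * v k) - f x - L ?h) \<le> e / (supn v + 1) * supn ?h"
          using \<delta> by (intro \<delta>(2) h) auto
        also have "\<dots> \<le> e / (supn v + 1) * (cmod z * supn v)"
          using norm_le_supn[OF K v] e n
          by (intro mult_left_mono supn_le) (auto simp: norm_mult intro: mult_left_mono)
        also have "\<dots> < e * cmod z" using e n z by (simp add: field_simps)
        finally have *: "cmod (f (\<lambda>k. x k + z * v k) - f x - L ?h) < e * cmod z" .
        have "L ?h = z * L v"
          by (rule dualX_scaled[OF L v])
        then have "(f (\<lambda>k. x k + z * v k) - f x) / z - L v = (f (\<lambda>k. x k + z * v k) - f x - L ?h) / z"
          using z by (simp add: field_simps)
        then show ?thesis using * z by (simp add: dist_norm norm_divide pos_divide_less_eq)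
      qed
      moreover have "0 < (\<delta> / 2) / (supn v + 1)" using \<delta> n by simp
      ultimately show "\<exists>s>0. \<forall>z. z \<noteq> 0 \<and> dist z 0 < s \<longrightarrow>
          dist ((f (\<lambda>k. x k + (0 + z) * v k) - f (\<lambda>k. x k + 0 * v k)) / z) (L v) < e" by blast
    qed
    then show "(\<lambda>\<xi>. f (\<lambda>k. x k + \<xi> * v k)) field_differentiable at 0"
      unfolding field_differentiable_def by blast
  qed
  then show ?thesis using f by (auto simp: bhol_def Hinf_def)
qed

text \<open>Along v the slice is bounded and holomorphic on the disc of radius R / supn v, where R =
  1 - supn x. The one-variable Taylor bound at the parameter 1 then reads 4 M / R^2 (supn v)^2,
  which is Frechet differentiability. Additivity of the derivative in v comes from the diagonal of a
  function of two parameters.\<close>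

lemma bhol_imp_Hinf:
  fixes g :: "('k::topological_space \<Rightarrow> complex) \<Rightarrow> complex"
  assumes K: "compact (UNIV :: 'k set)" and g: "bhol BallX g"
  shows "restrB g \<in> Hinf"
proof -
  obtain M where M: "\<And>x. x \<in> BallX \<Longrightarrow> cmod (g x) \<le> M" and gd: "\<And>x. x \<in> BallX \<Longrightarrow> gateaux_at g x"
    using g unfolding bhol_def by blast
  have "\<exists>L\<in>dualX. \<forall>\<epsilon>>0. \<exists>\<delta>>0. \<forall>h\<in>CK. supn h < \<delta> \<longrightarrow>
      cmod (restrB g (\<lambda>k. x k + h k) - restrB g x - L h) \<le> \<epsilon> * supn h" if x: "x \<in> BallX" for x
  proof -
    have xC: "x \<in> CK" "supn x < 1" using x by (auto simp: BallX_def)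
    define R where "R = 1 - supn x"
    have R: "0 < R" using xC by (simp add: R_def)
    have M0: "0 \<le> M" using M[OF x] norm_ge_zero order_trans by blast
    have ball: "(\<lambda>k. x k + h k) \<in> BallX" if "h \<in> CK" "\<And>k. cmod (h k) \<le> \<rho>" "\<rho> < R" for h \<rho>
    proof (rule BallX_I[of _ "supn x + \<rho>"])
      show "(\<lambda>k. x k + h k) \<in> CK" using CK_add_scaled[OF xC(1) that(1), of 1] by simp
      show "cmod (x k + h k) \<le> supn x + \<rho>" for k
        using norm_triangle_ineq[of "x k" "h k"] that(2)[of k] norm_le_supn[OF K xC(1), of k] by simp
    qed (use that in \<open>simp add: R_def\<close>)
    define D where "D = (\<lambda>v. deriv (\<lambda>\<xi>. g (\<lambda>k. x k + \<xi> * v k)) 0)"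
    define L where "L = (\<lambda>v. if v \<in> CK then D v else 0)"
    have line: "(\<lambda>k. x k + \<xi> * v k) \<in> BallX" if v: "v \<in> CK" and \<xi>: "cmod \<xi> * supn v < R" for v \<xi>
    proof (rule ball[OF CK_scaled[OF v] _ \<xi>])
      show "cmod (\<xi> * v k) \<le> cmod \<xi> * supn v" for k
        unfolding norm_mult using norm_le_supn[OF K v, of k] by (intro mult_left_mono) auto
    qed
    have hol: "(\<lambda>\<xi>. g (\<lambda>k. x k + \<xi> * v k)) holomorphic_on ball 0 r"
      and bd: "\<And>\<xi>. \<xi> \<in> ball 0 r \<Longrightarrow> cmod (g (\<lambda>k. x k + \<xi> * v k)) \<le> M"
      if v: "v \<in> CK" and r: "r * supn v \<le> R" "0 < supn v" for v r
    proof -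
      have *: "(\<lambda>k. x k + \<xi> * v k) \<in> BallX" if "\<xi> \<in> ball 0 r" for \<xi>
      proof (rule line[OF v])
        have "cmod \<xi> * supn v < r * supn v" using that r by (intro mult_strict_right_mono) auto
        then show "cmod \<xi> * supn v < R" using r by linarith
      qed
      show "(\<lambda>\<xi>. g (\<lambda>k. x k + \<xi> * v k)) holomorphic_on ball 0 r"
        by (rule gateaux_line_holomorphic[OF v]) (use * gd in blast)
      show "cmod (g (\<lambda>k. x k + \<xi> * v k)) \<le> M" if "\<xi> \<in> ball 0 r" for \<xi> using M[OF *[OF that]] .
    qed
    \<comment> \<open>The radius R / supn v is of no use when v = 0, which is therefore treated
      apart.\<close>
    have zero: "v = (\<lambda>_. 0)" if "v \<in> CK" "\<not> 0 < supn v" for v :: "'k \<Rightarrow> complex"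
    proof
      fix k
      have "cmod (v k) \<le> 0" using norm_le_supn[OF K that(1), of k] that(2) by linarith
      then show "v k = 0" by simp
    qed
    have D0: "D (\<lambda>_. 0) = 0" by (simp add: D_def)
    have Dbd: "cmod (D v) \<le> 2 * M / R * supn v" if v: "v \<in> CK" for v
    proof (cases "0 < supn v")
      case True
      define r where "r = R / supn v"
      have r: "0 < r" "r * supn v \<le> R" using True R by (auto simp: r_def)
      have "cmod (D v) \<le> 2 * M / r"
        unfolding D_def by (rule holomorphic_taylor2_bound(3)[OF hol[OF v r(2) True] bd[OF v r(2) True] r(1), of 0]) (use r in auto)
      then show ?thesis by (simp add: r_def)
    next
      case False
      then show ?thesis using zero[OF v False] D0 by (simp add: supn_def)
    qed
    have tay: "cmod (g (\<lambda>k. x k + v k) - g x - D v) \<le> 4 * M / R\<^sup>2 * (supn v)\<^sup>2" if v: "v \<in> CK" "supn v < R" for v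
    proof (cases "0 < supn v")
      case True
      define r where "r = R / supn v"
      have r: "0 < r" "r * supn v \<le> R" "1 < r" using True R v by (auto simp: r_def)
      have "cmod (g (\<lambda>k. x k + 1 * v k) - g (\<lambda>k. x k + 0 * v k) - 1 * D v) \<le> 4 * M / r\<^sup>2 * (cmod 1)\<^sup>2"
        unfolding D_def by (rule holomorphic_taylor2_bound(1)[OF hol[OF v(1) r(2) True] bd[OF v(1) r(2) True] r(1)]) (use r in auto)
      then show ?thesis by (simp add: r_def power_divide)
    next
      case False
      then show ?thesis using zero[OF v(1) False] D0 by (simp add: supn_def)
    qed
    have lin: "D (\<lambda>k. a * v k + b * w k) = a * D v + b * D w" if v: "v \<in> CK" and w: "w \<in> CK" for a b v w
    proof -
      define N where "N = cmod a * supn v + cmod b * supn w"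
      have N: "0 \<le> N" using supn_nonneg[OF K v] supn_nonneg[OF K w] by (simp add: N_def)
      \<comment> \<open>\<open>N\<close> bounds the combined size of the two directions, so both
        parameters may range independently over the disc of radius r; the + 1 covers N = 0.\<close>
      define r where "r = R / (N + 1)"
      have r: "0 < r" "r * N < R" using N R by (auto simp: r_def field_simps)
      define p where "p = (\<lambda>\<xi> \<eta>. g (\<lambda>k. x k + \<xi> * (a * v k) + \<eta> * (b * w k)))"
      have av: "(\<lambda>k. a * v k) \<in> CK" "(\<lambda>k. b * w k) \<in> CK" using v w by (auto intro: CK_scaled)
      have inB: "(\<lambda>k. x k + \<xi> * (a * v k) + \<eta> * (b * w k)) \<in> BallX" if "\<xi> \<in> ball 0 r" "\<eta> \<in> ball 0 r" for \<xi> \<eta>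
      proof -
        have "(\<lambda>k. x k + (\<xi> * (a * v k) + \<eta> * (b * w k))) \<in> BallX"
        proof (rule ball[of _ "r * N"])
          show "(\<lambda>k. \<xi> * (a * v k) + \<eta> * (b * w k)) \<in> CK" using av by (rule CK_lincomb)
          show "cmod (\<xi> * (a * v k) + \<eta> * (b * w k)) \<le> r * N" for k
          proof -
            have "cmod (\<xi> * (a * v k)) \<le> r * (cmod a * supn v)"
              unfolding norm_mult using that norm_le_supn[OF K v, of k] r by (intro mult_mono) auto
            moreover have "cmod (\<eta> * (b * w k)) \<le> r * (cmod b * supn w)"
              unfolding norm_mult using that norm_le_supn[OF K w, of k] r by (intro mult_mono) auto
            ultimately show ?thesis unfolding N_def distrib_left by (intro norm_triangle_le add_mono)
          qed
        qed (fact r)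
        then show ?thesis by (simp add: add.assoc)
      qed
      have "((\<lambda>z. p z z) has_field_derivative deriv (\<lambda>z. p z 0) 0 + deriv (p 0) 0) (at 0)"
      proof (rule has_field_derivative_diagonal[OF r(1)])
        fix w' :: complex assume w': "w' \<in> ball 0 r"
        have "(\<lambda>\<xi>. g (\<lambda>k. (x k + w' * (b * w k)) + \<xi> * (a * v k))) holomorphic_on ball 0 r"
          using inB[OF _ w'] by (intro gateaux_line_holomorphic av gd) (simp add: add_ac)
        then show "(\<lambda>z. p z w') holomorphic_on ball 0 r" by (simp add: p_def add_ac)
        have "(\<lambda>\<xi>. g (\<lambda>k. (x k + w' * (a * v k)) + \<xi> * (b * w k))) holomorphic_on ball 0 r"
          using inB[OF w'] by (intro gateaux_line_holomorphic av gd) simp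
        then show "p w' holomorphic_on ball 0 r" by (simp add: p_def)
      next
        show "cmod (p z w') \<le> M" if "z \<in> ball 0 r" "w' \<in> ball 0 r" for z w'
          unfolding p_def by (rule M[OF inB[OF that]])
      qed
      moreover have "(\<lambda>z. p z z) = (\<lambda>z. g (\<lambda>k. x k + z * (a * v k + b * w k)))"
        by (simp add: p_def algebra_simps)
      ultimately have 1: "D (\<lambda>k. a * v k + b * w k) = deriv (\<lambda>z. p z 0) 0 + deriv (p 0) 0"
        unfolding D_def by (metis DERIV_imp_deriv)
      have scal: "deriv (\<lambda>z. g (\<lambda>k. x k + z * (c * u k))) 0 = c * D u" if u: "u \<in> CK" for c u
      proof -
        have "(\<lambda>\<xi>. g (\<lambda>k. x k + \<xi> * u k)) field_differentiable at 0" using gd[OF x] u by (simp add: gateaux_at_def)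
        then have "((\<lambda>\<xi>. g (\<lambda>k. x k + \<xi> * u k)) has_field_derivative D u) (at (c * 0))"
          by (simp add: D_def DERIV_deriv_iff_field_differentiable)
        moreover have "((\<lambda>z. c * z) has_field_derivative c) (at 0)" by (auto intro!: derivative_eq_intros)
        ultimately have "((\<lambda>z. g (\<lambda>k. x k + (c * z) * u k)) has_field_derivative D u * c) (at 0)"
          by (rule DERIV_chain2)
        moreover have "(\<lambda>z. g (\<lambda>k. x k + (c * z) * u k)) = (\<lambda>z. g (\<lambda>k. x k + z * (c * u k)))"
          by (simp add: mult_ac)
        ultimately show ?thesis by (metis DERIV_imp_deriv mult.commute)
      qed
      show ?thesis unfolding 1 using scal[OF v, of a] scal[OF w, of b] by (simp add: p_def)
    qed
    have "L \<in> dualX"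
      unfolding dualX_def
    proof (intro CollectI conjI ballI allI)
      show "L (\<lambda>k. a * v k + b * w k) = a * L v + b * L w" if "v \<in> CK" "w \<in> CK" for v w a b
        using lin[OF that] CK_lincomb[OF that] that by (simp add: L_def)
      show "\<exists>C. \<forall>x\<in>CK. cmod (L x) \<le> C * supn x" 
        by (rule exI[of _ "2 * M / R"]) (use Dbd in \<open>simp add: L_def\<close>)
      show "x \<notin> CK \<longrightarrow> L x = 0" for x by (simp add: L_def)
    qed
    moreover have "\<exists>\<delta>>0. \<forall>h\<in>CK. supn h < \<delta> \<longrightarrow> cmod (restrB g (\<lambda>k. x k + h k) - restrB g x - L h) \<le> \<epsilon> * supn h"
      if e: "\<epsilon> > 0" for \<epsilon>
    proof -
      define C where "C = 4 * M / R\<^sup>2"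
      have C: "0 \<le> C" using M0 by (simp add: C_def)
      define \<delta> where "\<delta> = min R (\<epsilon> / (C + 1))"
      have \<delta>: "0 < \<delta>" using R e C by (simp add: \<delta>_def)
      have "cmod (restrB g (\<lambda>k. x k + h k) - restrB g x - L h) \<le> \<epsilon> * supn h" if h: "h \<in> CK" "supn h < \<delta>" for h
      proof -
        have n: "0 \<le> supn h" by (rule supn_nonneg[OF K h(1)])
        have hR: "supn h < R" "supn h < \<epsilon> / (C + 1)" using h by (auto simp: \<delta>_def)
        have "(\<lambda>k. x k + h k) \<in> BallX" using ball[OF h(1) norm_le_supn[OF K h(1)] hR(1)] .
        then have "cmod (restrB g (\<lambda>k. x k + h k) - restrB g x - L h) \<le> C * (supn h)\<^sup>2"
          using tay[OF h(1) hR(1)] x h by (simp add: restrB_def L_def C_def)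
        also have "\<dots> = (C * supn h) * supn h" by (simp add: power2_eq_square)
        also have "\<dots> \<le> \<epsilon> * supn h"
        proof (rule mult_right_mono[OF _ n])
          have "(C + 1) * supn h < \<epsilon>" using hR(2) C by (simp add: field_simps)
          then show "C * supn h \<le> \<epsilon>" using n by (simp add: algebra_simps)
        qed
        finally show ?thesis .
      qed
      then show ?thesis using \<delta> by blast
    qed
    ultimately show ?thesis by blast
  qed
  then have "holo_on_Ball (restrB g)" unfolding holo_on_Ball_def by blast
  moreover have "\<exists>M. \<forall>x\<in>BallX. cmod (restrB g x) \<le> M" using M by (auto simp: restrB_def)
  moreover have "\<forall>x. x \<notin> BallX \<longrightarrow> restrB g x = 0" by (simp add: restrB_def)
  ultimately show ?thesis unfolding Hinf_def by blast
qed

section \<open>Extension in one coordinate\<close>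

lemma Urysohn_compact:
  fixes S T :: "'k::t2_space set"
  assumes K: "compact (UNIV :: 'k set)" and "closed S" "closed T" "S \<inter> T = {}"
  obtains p :: "'k \<Rightarrow> real" where "continuous_on UNIV p" "\<And>t. 0 \<le> p t \<and> p t \<le> 1"
    "\<And>t. t \<in> S \<Longrightarrow> p t = 0" "\<And>t. t \<in> T \<Longrightarrow> p t = 1"
proof -
  have "Hausdorff_space (euclidean :: 'k topology)"
    unfolding Hausdorff_space_def using hausdorff by (auto simp: disjnt_def)
  then have "normal_space (euclidean :: 'k topology)"
    using K by (intro compact_Hausdorff_or_regular_imp_normal_space) (auto simp: compact_space_def)
  moreover have "closedin euclidean S" "closedin euclidean T" "disjnt S T"
    using assms by (simp_all add: closed_closedin[symmetric] disjnt_def)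
  ultimately obtain p where p: "continuous_map euclidean (top_of_set {0..1::real}) p" "p ` S \<subseteq> {0}" "p ` T \<subseteq> {1}"
    by (rule Urysohn_lemma[of euclidean S T 0 1]) auto
  from p(1) have "continuous_map euclidean euclideanreal p" "range p \<subseteq> {0..1}"
    unfolding continuous_map_in_subtopology by auto
  then have c: "continuous_on UNIV p" "\<And>t. 0 \<le> p t \<and> p t \<le> 1" by (auto simp: image_subset_iff)
  show thesis by (rule that[OF c]) (use p in auto)
qed

section \<open>Bump functions shrinking to a point\<close>

definition bump_at :: "'k::t2_space \<Rightarrow> 'k set \<Rightarrow> ('k \<Rightarrow> complex) set" where
  "bump_at k V = {u \<in> CK. u k = 1 \<and> (\<forall>t. \<exists>s. 0 \<le> s \<and> s \<le> 1 \<and> u t = of_real s) \<and> (\<forall>t. t \<notin> V \<longrightarrow> u t = 0)}"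

lemma bump_at_nonempty:
  fixes k :: "'k::t2_space"
  assumes K: "compact (UNIV :: 'k set)" and "open V" "k \<in> V"
  shows "bump_at k V \<noteq> {}"
proof -
  obtain p :: "'k \<Rightarrow> real" where p: "continuous_on UNIV p" "\<And>t. 0 \<le> p t \<and> p t \<le> 1"
    "\<And>t. t \<in> - V \<Longrightarrow> p t = 0" "\<And>t. t \<in> {k} \<Longrightarrow> p t = 1"
    by (rule Urysohn_compact[OF K, of "- V" "{k}"]) (use assms in auto)
  have "(\<lambda>t. complex_of_real (p t)) \<in> bump_at k V"
    unfolding bump_at_def CK_def using p by (auto intro!: continuous_intros)
  then show ?thesis by blast
qed

text \<open>The sets \<open>bump_at k V\<close> are nonempty and decrease with V, so over the open
  neighbourhoods of k they form a filter base, which some ultrafilter refines.\<close>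

lemma bump_ultrafilter:
  fixes k :: "'k::t2_space"
  assumes K: "compact (UNIV :: 'k set)"
  obtains U where "ultrafilter U" "\<And>V. open V \<Longrightarrow> k \<in> V \<Longrightarrow> eventually (\<lambda>u. u \<in> bump_at k V) U"
proof -
  define B where "B = {V :: 'k set. open V \<and> k \<in> V}"
  define F where "F = (INF V\<in>B. principal (bump_at k V))"
  have ev: "eventually P F \<longleftrightarrow> (\<exists>V\<in>B. eventually P (principal (bump_at k V)))" for P
    unfolding F_def
  proof (rule eventually_INF_base)
    show "B \<noteq> {}" by (auto simp: B_def)
    fix V W assume "V \<in> B" "W \<in> B"
    then show "\<exists>x\<in>B. principal (bump_at k x) \<le> inf (principal (bump_at k V)) (principal (bump_at k W))"
      by (intro bexI[of _ "V \<inter> W"]) (auto simp: B_def bump_at_def)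
  qed
  have "F \<noteq> bot"
    unfolding trivial_limit_def ev eventually_principal using bump_at_nonempty[OF K, of _ k] by (auto simp: B_def)
  then obtain U where U: "U \<le> F" "ultrafilter U" by (rule ultrafilter_exists)
  have "eventually (\<lambda>u. u \<in> bump_at k V) U" if "open V" "k \<in> V" for V
  proof (rule filter_leD[OF U(1)])
    show "eventually (\<lambda>u. u \<in> bump_at k V) F"
      unfolding ev using that by (auto simp: B_def eventually_principal)
  qed
  then show thesis using that U by blast
qed

definition slab :: "('k::topological_space \<Rightarrow> complex) \<Rightarrow> real \<Rightarrow> 'k set \<Rightarrow> ('k \<Rightarrow> complex) set" where
  "slab l e J = {x \<in> BallX. \<forall>j\<in>J. cmod (x j - l j) < e}"

lemma slab_sub_BallX: "slab l e J \<subseteq> BallX"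
  by (auto simp: slab_def)

lemma slab_empty: "slab l e {} = BallX"
  by (auto simp: slab_def)

lemma slab_margin:
  assumes "finite J" "\<forall>j\<in>J. cmod (x j - l j) < e"
  obtains r where "0 < r" "\<And>y. (\<And>j. j \<in> J \<Longrightarrow> cmod (y j - x j) < r) \<Longrightarrow> \<forall>j\<in>J. cmod (y j - l j) < e"
proof -
  have "\<exists>r>0. \<forall>y. (\<forall>j\<in>J. cmod (y j - x j) < r) \<longrightarrow> (\<forall>j\<in>J. cmod (y j - l j) < e)"
    using assms
  proof (induction J rule: finite_induct)
    case empty
    then show ?case by (auto intro: exI[of _ 1])
  next
    case (insert i J)
    then obtain r where r: "r > 0" "\<forall>y. (\<forall>j\<in>J. cmod (y j - x j) < r) \<longrightarrow> (\<forall>j\<in>J. cmod (y j - l j) < e)" by auto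
    define r' where "r' = min r (e - cmod (x i - l i))"
    have "0 < r'" using r insert by (auto simp: r'_def)
    moreover have "\<forall>j\<in>insert i J. cmod (y j - l j) < e" if y: "\<forall>j\<in>insert i J. cmod (y j - x j) < r'" for y
    proof -
      have "cmod (y i - l i) \<le> cmod (y i - x i) + cmod (x i - l i)"
        using norm_triangle_ineq[of "y i - x i" "x i - l i"] by simp
      moreover have "cmod (y i - x i) < e - cmod (x i - l i)" using y by (auto simp: r'_def)
      ultimately have "cmod (y i - l i) < e" by linarith
      moreover have "\<forall>j\<in>J. cmod (y j - x j) < r" using y by (auto simp: r'_def)
      ultimately show ?thesis using r(2) by auto
    qed
    ultimately show ?case by blast
  qed
  then show thesis using that by blast
qed

lemma sup_open_slab:
  assumes K: "compact (UNIV :: 'k::topological_space set)" and J: "finite J"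
  shows "sup_open (slab l e J :: ('k \<Rightarrow> complex) set)"
  unfolding sup_open_def
proof (intro conjI ballI)
  show "slab l e J \<subseteq> CK" by (auto simp: slab_def BallX_def)
  fix x :: "'k \<Rightarrow> complex" assume x: "x \<in> slab l e J"
  obtain r where r: "0 < r" "\<And>y. (\<And>j. j \<in> J \<Longrightarrow> cmod (y j - x j) < r) \<Longrightarrow> \<forall>j\<in>J. cmod (y j - l j) < e"
    using slab_margin[OF J, of x l e] x by (auto simp: slab_def)
  obtain s where s: "s > 0" "\<forall>y\<in>CK. (\<forall>k. cmod (y k - x k) < s) \<longrightarrow> y \<in> BallX"
    using sup_open_BallX[OF K] x unfolding sup_open_def by (meson slab_sub_BallX subsetD)
  show "\<exists>r>0. \<forall>y\<in>CK. (\<forall>k. cmod (y k - x k) < r) \<longrightarrow> y \<in> slab l e J"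
    by (intro exI[of _ "min r s"]) (use r s in \<open>auto simp: slab_def\<close>)
qed

definition shift :: "'k \<Rightarrow> ('k \<Rightarrow> complex) \<Rightarrow> ('k \<Rightarrow> complex) \<Rightarrow> complex \<Rightarrow> 'k \<Rightarrow> complex" where
  "shift k u x z = (\<lambda>t. x t + (z - x k) * u t)"

text \<open>Adding (z - x k) u could push values out of the disc. Where x is close to x(k), however,
  the new value is nearly the convex combination (1 - s) x(t) + s z with s = u(t), so the bump has
  to live where x oscillates little. One r serves all nearby y and w, as differentiation in x and in
  z requires.\<close>

lemma shift_in_slab:
  fixes x :: "'k::t2_space \<Rightarrow> complex"
  assumes K: "compact (UNIV :: 'k set)" and J: "finite J" "k \<notin> J" and x: "x \<in> slab l e J"
    and z: "cmod z < 1" "cmod (z - l k) < e"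
    and U: "\<And>V. open V \<Longrightarrow> k \<in> V \<Longrightarrow> eventually (\<lambda>u. u \<in> bump_at k V) U"
  obtains r where "0 < r"
    "eventually (\<lambda>u. u \<in> CK \<and> (\<forall>y\<in>CK. \<forall>w. (\<forall>t. cmod (y t - x t) < r) \<longrightarrow> cmod (w - z) < r \<longrightarrow>
        shift k u y w \<in> slab l e (insert k J))) U"
proof -
  have xC: "x \<in> CK" "supn x < 1" using x by (auto simp: slab_def BallX_def)
  define m where "m = max (supn x) (cmod z)"
  \<comment> \<open>\<open>m\<close> < 1 bounds x and z. Replacing them by y and w costs \<eta>, and
    the oscillation of y on the carrier of the bump costs 3 \<eta>, so m + 4 \<eta> has to stay
    below 1.\<close>
  define \<eta> where "\<eta> = (1 - m) / 8"
  have m: "supn x \<le> m" "cmod z \<le> m" "m < 1" using xC z by (auto simp: m_def)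
  have \<eta>: "0 < \<eta>" "m + 4 * \<eta> < 1" using m by (auto simp: \<eta>_def field_simps)
  obtain r0 where r0: "0 < r0" "\<And>y. (\<And>j. j \<in> J \<Longrightarrow> cmod (y j - x j) < r0) \<Longrightarrow> \<forall>j\<in>J. cmod (y j - l j) < e"
    using slab_margin[OF J(1), of x l e] x by (auto simp: slab_def)
  define r where "r = min \<eta> (min r0 (e - cmod (z - l k)))"
  have r: "0 < r" "r \<le> \<eta>" "r \<le> r0" "r \<le> e - cmod (z - l k)" using \<eta> r0 z by (auto simp: r_def)
  \<comment> \<open>Removing the finite set \<open>J\<close> keeps \<open>V\<close> open and makes
    the bump vanish on \<open>J\<close>, so the conditions there are unaffected by the
    shift.\<close>
  define V where "V = {t. cmod (x t - x k) < \<eta>} - J"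
  have "open {t. cmod (x t - x k) < \<eta>}"
    using xC by (intro open_Collect_less continuous_intros) (auto simp: CK_def)
  then have "open V" "k \<in> V" using J \<eta> by (auto simp: V_def finite_imp_closed intro: open_Diff)
  then have ev: "eventually (\<lambda>u. u \<in> bump_at k V) U" by (rule U)
  show thesis
  proof (rule that[OF r(1)], rule eventually_mono[OF ev], intro conjI ballI allI impI)
    fix u assume u: "u \<in> bump_at k V"
    show uC: "u \<in> CK" using u by (simp add: bump_at_def)
    fix y w assume y: "y \<in> CK" "\<forall>t. cmod (y t - x t) < r" and w: "cmod (w - z) < r"
    have uk: "u k = 1" using u by (simp add: bump_at_def)
    have sC: "shift k u y w \<in> CK" unfolding shift_def using y(1) uC by (rule CK_add_scaled)
    have bd: "cmod (shift k u y w t) \<le> m + 4 * \<eta>" for t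
    proof -
      obtain s where s: "0 \<le> s" "s \<le> 1" "u t = of_real s" using u by (auto simp: bump_at_def)
      have yt: "cmod (y t) \<le> m + \<eta>"
        using norm_triangle_ineq[of "x t" "y t - x t"] y(2)[rule_format, of t] norm_le_supn[OF K xC(1), of t] m r by simp
      have wt: "cmod w \<le> m + \<eta>"
        using norm_triangle_ineq[of z "w - z"] w m r by simp
      have d: "s * cmod (y t - y k) \<le> 3 * \<eta>"
      proof (cases "t \<in> V")
        case True
        then have "cmod (x t - x k) < \<eta>" by (simp add: V_def)
        moreover have "y t - y k = (y t - x t) + (x t - x k) - (y k - x k)" by simp
        then have "cmod (y t - y k) \<le> cmod (y t - x t) + cmod (x t - x k) + cmod (y k - x k)"
          using norm_triangle_ineq[of "y t - x t" "x t - x k"] norm_triangle_ineq4[of "(y t - x t) + (x t - x k)" "y k - x k"]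
          by simp
        ultimately have "cmod (y t - y k) \<le> 3 * \<eta>"
          using y(2)[rule_format, of t] y(2)[rule_format, of k] r by linarith
        moreover have "s * cmod (y t - y k) \<le> 1 * cmod (y t - y k)" using s by (intro mult_right_mono) auto
        ultimately show ?thesis by simp
      next
        case False
        then have "u t = 0" using u by (simp add: bump_at_def)
        then show ?thesis using s \<eta> by simp
      qed
      have "shift k u y w t = of_real (1 - s) * y t + (of_real s * w + of_real s * (y t - y k))"
        by (simp add: shift_def s algebra_simps)
      also have "cmod \<dots> \<le> cmod (of_real (1 - s) * y t) + (cmod (of_real s * w) + cmod (of_real s * (y t - y k)))"
        by (intro norm_triangle_le add_mono order_refl norm_triangle_ineq)
      also have "\<dots> = (1 - s) * cmod (y t) + (s * cmod w + s * cmod (y t - y k))"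
        unfolding norm_mult norm_of_real using s by simp
      also have "\<dots> \<le> (1 - s) * (m + \<eta>) + (s * (m + \<eta>) + 3 * \<eta>)"
        using s yt wt d by (intro add_mono mult_left_mono) auto
      also have "\<dots> = m + 4 * \<eta>" by (simp add: algebra_simps)
      finally show ?thesis .
    qed
    have "shift k u y w \<in> BallX" by (rule BallX_I[OF sC bd \<eta>(2)])
    moreover have "shift k u y w k = w" by (simp add: shift_def uk)
    moreover have "cmod (w - l k) < e"
      using norm_triangle_ineq[of "w - z" "z - l k"] w r by simp
    moreover have "shift k u y w j = y j" if "j \<in> J" for j
      using that u by (auto simp: shift_def bump_at_def V_def)
    moreover have "\<forall>j\<in>J. cmod (y j - l j) < e"
      using y(2) r by (intro r0(2)) (meson less_le_trans)
    ultimately show "shift k u y w \<in> slab l e (insert k J)" by (auto simp: slab_def)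
  qed
qed

lemma shift_linear:
  "shift k u (\<lambda>t. x t + \<xi> * v t) z = (\<lambda>t. shift k u x z t + \<xi> * (v t - v k * u t))"
  "shift k u x (z + \<xi>) = (\<lambda>t. shift k u x z t + \<xi> * u t)"
  by (simp_all add: shift_def algebra_simps)

text \<open>The limit of \<open>shift k u x z\<close> as \<open>u\<close> shrinks to \<open>k\<close> is \<open>x + (z - x k) 1\<^bsub>{k}\<^esub>\<close>, which is in the bidual
  but not in \<open>C(K)\<close>; taking the limit of the values of \<open>h\<close> along an ultrafilter extends \<open>h\<close> to such points.\<close>

lemma shift_limit:
  fixes h :: "('k::t2_space \<Rightarrow> complex) \<Rightarrow> complex"
  assumes K: "compact (UNIV :: 'k set)" and J: "finite J" "k \<notin> J" and h: "bhol (slab l e (insert k J)) h"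
    and M': "\<forall>x\<in>slab l e (insert k J). cmod (h x) \<le> M"
    and U: "ultrafilter U" and U': "\<forall>V. open V \<longrightarrow> k \<in> V \<longrightarrow> eventually (\<lambda>u. u \<in> bump_at k V) U"
  defines "H \<equiv> (\<lambda>x z. Lim U (\<lambda>u. h (shift k u x z)))"
  shows "\<And>x z. x \<in> slab l e J \<Longrightarrow> z \<in> ball 0 1 \<inter> ball (l k) e \<Longrightarrow> cmod (H x z) \<le> M"
    and "\<And>x z. x \<in> slab l e J \<Longrightarrow> z \<in> ball 0 1 \<inter> ball (l k) e \<Longrightarrow> gateaux_at (\<lambda>x. H x z) x"
    and "\<And>x. x \<in> slab l e J \<Longrightarrow> H x holomorphic_on (ball 0 1 \<inter> ball (l k) e)"
    and "\<And>x. x \<in> slab l e (insert k J) \<Longrightarrow> H x (x k) = h x"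
proof -
  have M: "\<And>x. x \<in> slab l e (insert k J) \<Longrightarrow> cmod (h x) \<le> M" using M' by blast
  have nb: "U \<noteq> bot" using U by (simp add: ultrafilter_def)
  have gd: "\<And>x. x \<in> slab l e (insert k J) \<Longrightarrow> gateaux_at h x" using h by (simp add: bhol_def)
  have ex: "\<exists>r>0. eventually (\<lambda>u. u \<in> CK \<and> (\<forall>y\<in>CK. \<forall>w. (\<forall>t. cmod (y t - x t) < r) \<longrightarrow> cmod (w - z) < r \<longrightarrow>
        shift k u y w \<in> slab l e (insert k J))) U" 
    if "x \<in> slab l e J" "z \<in> ball 0 1 \<inter> ball (l k) e" for x z
    using shift_in_slab[OF K J that(1) _ _ U'[rule_format], of z] that(2) by (auto simp: dist_norm norm_minus_commute)
  have xC: "x \<in> CK" if "x \<in> slab l e J" for x J using that by (auto simp: slab_def BallX_def)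
  {
    fix x z assume x: "x \<in> slab l e J" and z: "z \<in> ball 0 1 \<inter> ball (l k) e"
    obtain r where r: "r > 0" and ev: "eventually (\<lambda>u. u \<in> CK \<and> (\<forall>y\<in>CK. \<forall>w. (\<forall>t. cmod (y t - x t) < r) \<longrightarrow> cmod (w - z) < r \<longrightarrow>
        shift k u y w \<in> slab l e (insert k J))) U" using ex[OF x z] by blast
    have evM: "eventually (\<lambda>u. cmod (h (shift k u x z)) \<le> M) U"
      using ev by eventually_elim (use xC[OF x] r M in auto)
    then have "((\<lambda>u. h (shift k u x z)) \<longlongrightarrow> H x z) U"
      unfolding H_def by (rule ultrafilter_bounded_tendsto_Lim[OF U])
    then show "cmod (H x z) \<le> M"
      using tendsto_upperbound[OF tendsto_norm evM nb] by blast
    show "gateaux_at (\<lambda>x. H x z) x"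
      unfolding gateaux_at_def H_def
    proof
      fix v :: "'k \<Rightarrow> complex" assume v: "v \<in> CK"
      have n: "0 \<le> supn v" by (rule supn_nonneg[OF K v])
      show "(\<lambda>\<xi>. Lim U (\<lambda>u. h (shift k u (\<lambda>t. x t + \<xi> * v t) z))) field_differentiable at 0"
      proof (rule field_differentiable_Lim_ultrafilter[OF U, of "r / (supn v + 1)" _ M])
        show "0 < r / (supn v + 1)" using r n by simp
        show "eventually (\<lambda>u. (\<lambda>\<xi>. h (shift k u (\<lambda>t. x t + \<xi> * v t) z)) holomorphic_on ball 0 (r / (supn v + 1)) \<and>
           (\<forall>\<xi>\<in>ball 0 (r / (supn v + 1)). cmod (h (shift k u (\<lambda>t. x t + \<xi> * v t) z)) \<le> M)) U"
          using ev
        proof eventually_elim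
          case (elim u)
          have in_slab: "shift k u (\<lambda>t. x t + \<xi> * v t) z \<in> slab l e (insert k J)" if "\<xi> \<in> ball 0 (r / (supn v + 1))" for \<xi>
            using elim r scaled_lt[OF K v r, of \<xi>] that CK_add_scaled[OF xC[OF x] v, of \<xi>] by auto
          \<comment> \<open>The shift is affine in x: moving x along v moves the shifted function
            along v - v(k) u, again a direction in C(K).\<close>
          have "(\<lambda>t. v t - v k * u t) \<in> CK" using CK_add_scaled[OF v, of u "- v k"] elim by simp
          then have "(\<lambda>\<xi>. h (shift k u (\<lambda>t. x t + \<xi> * v t) z)) holomorphic_on ball 0 (r / (supn v + 1))"
            unfolding shift_linear(1) by (rule gateaux_line_holomorphic) (use in_slab gd in \<open>simp add: shift_linear(1)\<close>)
          then show ?case using in_slab M by blast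
        qed
      qed
    qed
  }
  {
    fix x assume x: "x \<in> slab l e J"
    show "H x holomorphic_on (ball 0 1 \<inter> ball (l k) e)"
      unfolding holomorphic_on_def
    proof
      fix z assume z: "z \<in> ball 0 1 \<inter> ball (l k) e"
      obtain r where r: "r > 0" and ev: "eventually (\<lambda>u. u \<in> CK \<and> (\<forall>y\<in>CK. \<forall>w. (\<forall>t. cmod (y t - x t) < r) \<longrightarrow> cmod (w - z) < r \<longrightarrow>
          shift k u y w \<in> slab l e (insert k J))) U" using ex[OF x z] by blast
      have "(\<lambda>\<xi>. Lim U (\<lambda>u. h (shift k u x (z + \<xi>)))) field_differentiable at 0"
      proof (rule field_differentiable_Lim_ultrafilter[OF U r, of _ M])
        show "eventually (\<lambda>u. (\<lambda>\<xi>. h (shift k u x (z + \<xi>))) holomorphic_on ball 0 r \<and>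
           (\<forall>\<xi>\<in>ball 0 r. cmod (h (shift k u x (z + \<xi>))) \<le> M)) U"
          using ev
        proof eventually_elim
          case (elim u)
          have in_slab: "shift k u x (z + \<xi>) \<in> slab l e (insert k J)" if "\<xi> \<in> ball 0 r" for \<xi>
            using elim r that xC[OF x] by auto
          have "u \<in> CK" using elim by simp
          then have "(\<lambda>\<xi>. h (shift k u x (z + \<xi>))) holomorphic_on ball 0 r"
            unfolding shift_linear(2) by (rule gateaux_line_holomorphic) (use in_slab gd in \<open>simp add: shift_linear(2)\<close>)
          then show ?case using in_slab M by blast
        qed
      qed
      then have "H x field_differentiable at z"
        unfolding field_differentiable_def H_def using DERIV_shift[of "\<lambda>z. Lim U (\<lambda>u. h (shift k u x z))" _ 0 z] by (simp add: add.commute)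
      then show "H x field_differentiable at z within ball 0 1 \<inter> ball (l k) e"
        by (rule field_differentiable_at_within)
    qed
  }
  \<comment> \<open>For z = x(k) the shift is the identity for every u, so the limit is that of a
    constant.\<close>
  show "H x (x k) = h x" if "x \<in> slab l e (insert k J)" for x
    unfolding H_def shift_def using tendsto_Lim[OF nb tendsto_const] by simp
qed

text \<open>G is differentiable at 0 as a map into the bounded functions on \<open>S\<close>, with a
  quadratic remainder uniform in z, and a bounded linear \<open>T\<close> preserves such an
  expansion. Its coefficient \<open>D\<close> has to be shown holomorphic to be an admissible
  argument of \<open>T\<close>.\<close>

lemma field_differentiable_bounded_functional:
  fixes G :: "complex \<Rightarrow> complex \<Rightarrow> complex" and T :: "(complex \<Rightarrow> complex) \<Rightarrow> complex"
  assumes S: "open S" and r: "0 < r"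
    and hol: "\<And>\<xi>. \<xi> \<in> ball 0 r \<Longrightarrow> G \<xi> holomorphic_on S"
    and bd: "\<And>\<xi> z. \<xi> \<in> ball 0 r \<Longrightarrow> z \<in> S \<Longrightarrow> cmod (G \<xi> z) \<le> M"
    and par: "\<And>z. z \<in> S \<Longrightarrow> (\<lambda>\<xi>. G \<xi> z) holomorphic_on ball 0 r"
    and lin: "\<And>G1 G2 M a b. G1 holomorphic_on S \<Longrightarrow> G2 holomorphic_on S \<Longrightarrow>
        \<forall>z\<in>S. cmod (G1 z) \<le> M \<and> cmod (G2 z) \<le> M \<Longrightarrow> T (\<lambda>w. a * G1 w + b * G2 w) = a * T G1 + b * T G2"
    and Tbd: "\<And>G M. G holomorphic_on S \<Longrightarrow> \<forall>z\<in>S. cmod (G z) \<le> M \<Longrightarrow> cmod (T G) \<le> C * M"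
  shows "(\<lambda>\<xi>. T (G \<xi>)) field_differentiable at 0"
proof -
  define D where "D = (\<lambda>z. deriv (\<lambda>\<xi>. G \<xi> z) 0)"
  define B where "B = 4 * M / r\<^sup>2"
  have tay: "cmod (G \<xi> z - G 0 z - \<xi> * D z) \<le> B * (cmod \<xi>)\<^sup>2" if "z \<in> S" "cmod \<xi> < r" for z \<xi>
    unfolding B_def D_def by (rule holomorphic_taylor2_bound(1)[OF par[OF that(1)] _ r that(2)]) (use bd that in auto)
  have Dbd: "cmod (D z) \<le> 2 * M / r" if "z \<in> S" for z
    unfolding D_def by (rule holomorphic_taylor2_bound(3)[OF par[OF that(1)] _ r, of M 0]) (use bd that r in auto)
  have Dhol: "D holomorphic_on S"
  proof (rule holomorphic_uniform_sequence[OF S])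
    \<comment> \<open>Steps tending to 0 and strictly between 0 and r, so the difference quotients
      are holomorphic in z; by the Taylor bound they converge to \<open>D\<close> uniformly.\<close>
    define s where "s = (\<lambda>n. r / real (n + 2))"
    have s: "0 < s n" "s n < r" for n using r by (auto simp: s_def field_simps intro: add_pos_nonneg)
    define f where "f = (\<lambda>n z. (G (of_real (s n)) z - G 0 z) / of_real (s n))"
    show "f n holomorphic_on S" for n
      unfolding f_def using s[of n] r by (intro holomorphic_intros hol) auto
    fix x assume "x \<in> S"
    then obtain d where d: "d > 0" "cball x d \<subseteq> S" using S open_contains_cball by blast
    have s0: "(\<lambda>n. B * s n) \<longlonglongrightarrow> 0" 
      unfolding s_def by (intro tendsto_mult_right_zero LIMSEQ_ignore_initial_segment lim_const_over_n)
    have "uniform_limit (cball x d) f D sequentially"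
    proof (rule uniform_limitI)
      fix e :: real assume "0 < e"
      then have "eventually (\<lambda>n. B * s n < e) sequentially" using order_tendstoD(2)[OF s0] by blast
      then show "eventually (\<lambda>n. \<forall>z\<in>cball x d. dist (f n z) (D z) < e) sequentially"
      proof eventually_elim
        case (elim n)
        show ?case
        proof
          fix z assume "z \<in> cball x d"
          then have "z \<in> S" using d by blast
          then have "cmod (G (of_real (s n)) z - G 0 z - of_real (s n) * D z) \<le> B * (s n)\<^sup>2"
            using tay[of z "of_real (s n)"] s[of n] by simp
          moreover have "f n z - D z = (G (of_real (s n)) z - G 0 z - of_real (s n) * D z) / of_real (s n)"
            using s[of n] by (simp add: f_def field_simps)
          ultimately have "cmod (f n z - D z) \<le> B * s n"
            using s[of n] by (simp add: norm_divide pos_divide_le_eq power2_eq_square mult_ac)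
          then show "dist (f n z) (D z) < e" using elim by (simp add: dist_norm)
        qed
      qed
    qed
    then show "\<exists>d>0. cball x d \<subseteq> S \<and> uniform_limit (cball x d) f D sequentially" using d by blast
  qed
  have "((\<lambda>\<xi>. T (G \<xi>)) has_field_derivative T D) (at 0)"
  proof (rule has_field_derivative_quadratic_remainder[OF r])
    fix \<xi> assume \<xi>: "cmod \<xi> < r"
    define N where "N = max M (2 * M / r)"
    have h0: "G 0 holomorphic_on S" "G \<xi> holomorphic_on S" using hol r \<xi> by auto
    have b0: "\<forall>z\<in>S. cmod (G 0 z) \<le> N \<and> cmod (D z) \<le> N" "\<forall>z\<in>S. cmod (G \<xi> z) \<le> N"
      using bd[of 0] bd[of \<xi>] Dbd r \<xi> by (auto simp: N_def le_max_iff_disj)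
    have l1: "T (\<lambda>w. 1 * G 0 w + \<xi> * D w) = 1 * T (G 0) + \<xi> * T D"
      by (rule lin[OF h0(1) Dhol b0(1)])
    have h1: "(\<lambda>w. 1 * G 0 w + \<xi> * D w) holomorphic_on S" using h0 Dhol by (intro holomorphic_intros)
    have "\<forall>z\<in>S. cmod (G \<xi> z) \<le> N + cmod \<xi> * N \<and> cmod (1 * G 0 z + \<xi> * D z) \<le> N + cmod \<xi> * N"
    proof
      fix z assume z: "z \<in> S"
      have "cmod (1 * G 0 z + \<xi> * D z) \<le> N + cmod \<xi> * N"
        using b0(1) z by (intro norm_triangle_le add_mono) (auto simp: norm_mult intro: mult_left_mono)
      moreover have "cmod (G \<xi> z) \<le> N" using b0(2) z by blast
      moreover have "0 \<le> cmod \<xi> * N" using order_trans[OF norm_ge_zero \<open>cmod (G \<xi> z) \<le> N\<close>] by simp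
      ultimately show "cmod (G \<xi> z) \<le> N + cmod \<xi> * N \<and> cmod (1 * G 0 z + \<xi> * D z) \<le> N + cmod \<xi> * N" by simp
    qed
    from lin[OF h0(2) h1 this, of 1 "-1"]
    have l2: "T (\<lambda>w. 1 * G \<xi> w + (-1) * (1 * G 0 w + \<xi> * D w)) = T (G \<xi>) - T (G 0) - \<xi> * T D"
      unfolding l1 by simp
    have "cmod (T (\<lambda>w. 1 * G \<xi> w + (-1) * (1 * G 0 w + \<xi> * D w))) \<le> C * (B * (cmod \<xi>)\<^sup>2)"
    proof (rule Tbd)
      show "(\<lambda>w. 1 * G \<xi> w + (-1) * (1 * G 0 w + \<xi> * D w)) holomorphic_on S"
        using h0 Dhol by (intro holomorphic_intros)
      show "\<forall>z\<in>S. cmod (1 * G \<xi> z + (-1) * (1 * G 0 z + \<xi> * D z)) \<le> B * (cmod \<xi>)\<^sup>2"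
        using tay \<xi> by (simp add: algebra_simps)
    qed
    then show "cmod (T (G \<xi>) - T (G 0) - \<xi> * T D) \<le> C * B * (cmod \<xi>)\<^sup>2"
      unfolding l2 by simp
  qed
  then show ?thesis unfolding field_differentiable_def by blast
qed

text \<open>For fixed x the operators act on z \<mapsto> H x z, and the result is evaluated at z =
  x(k). On the smaller slab H x (x k) = h x, so the relation between P and Q turns into the relation
  between h' and \<kappa>.\<close>

lemma slab_extension:
  fixes h :: "('k::t2_space \<Rightarrow> complex) \<Rightarrow> complex"
  assumes K: "compact (UNIV :: 'k set)" and J: "finite J" "k \<notin> J" and l: "cmod (l k) \<le> 1" and e: "0 < e"
    and h: "bhol (slab l e (insert k J)) h"
  shows "\<exists>h' \<kappa>. bhol (slab l e J) h' \<and> bhol (slab l e (insert k J)) \<kappa> \<and>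
     (\<forall>x\<in>slab l e (insert k J). h' x = h x + (x k - l k) * \<kappa> x)"
proof -
  obtain M where M: "\<forall>x\<in>slab l e (insert k J). cmod (h x) \<le> M" using h unfolding bhol_def by blast
  obtain U where U: "ultrafilter U" "\<forall>V. open V \<longrightarrow> k \<in> V \<longrightarrow> eventually (\<lambda>u. u \<in> bump_at k V) U"
    using bump_ultrafilter[OF K, of k] by blast
  define H where "H = (\<lambda>x z. Lim U (\<lambda>u. h (shift k u x z)))"
  let ?O = "ball 0 1 \<inter> ball (l k) e"
  have oO: "open ?O" by auto
  have H: "\<And>x z. x \<in> slab l e J \<Longrightarrow> z \<in> ?O \<Longrightarrow> cmod (H x z) \<le> M"
    "\<And>x z. x \<in> slab l e J \<Longrightarrow> z \<in> ?O \<Longrightarrow> gateaux_at (\<lambda>x. H x z) x"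
    "\<And>x. x \<in> slab l e J \<Longrightarrow> H x holomorphic_on ?O"
    "\<And>x. x \<in> slab l e (insert k J) \<Longrightarrow> H x (x k) = h x"
    unfolding H_def by (fact shift_limit[OF K J h M U])+
  obtain P Q C where ext: "extension_operators (l k) e P Q C" using extension_operators_exist[OF l e] by blast
  have op: "P G holomorphic_on ball 0 1 \<and> (\<forall>z\<in>ball 0 1. cmod (P G z) \<le> C * M)"
      "Q G holomorphic_on ?O \<and> (\<forall>z\<in>?O. cmod (Q G z) \<le> C * M)"
      "\<forall>z\<in>?O. P G z = G z + (z - l k) * Q G z"
    if "G holomorphic_on ?O" "\<forall>z\<in>?O. cmod (G z) \<le> M" for G M
    using ext that unfolding extension_operators_def by blast+
  have lin: "\<forall>z\<in>ball 0 1. P (\<lambda>w. a * G1 w + b * G2 w) z = a * P G1 z + b * P G2 z"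
      "\<forall>z\<in>?O. Q (\<lambda>w. a * G1 w + b * G2 w) z = a * Q G1 z + b * Q G2 z"
    if "G1 holomorphic_on ?O" "G2 holomorphic_on ?O" "\<forall>z\<in>?O. cmod (G1 z) \<le> M \<and> cmod (G2 z) \<le> M" for G1 G2 M a b
    using ext that unfolding extension_operators_def by blast+
  have sub: "slab l e (insert k J) \<subseteq> slab l e J" by (auto simp: slab_def)
  have opJ: "sup_open (slab l e J)" "sup_open (slab l e (insert k J))" using sup_open_slab[OF K] J by auto
  have HM: "\<forall>z\<in>?O. cmod (H x z) \<le> M" if "x \<in> slab l e J" for x by (intro ballI H(1) that)
  \<comment> \<open>One argument for both operators: T = P on the slab over \<open>J\<close> with W
    the disc, and T = Q on the smaller slab with W the domain \<open>?O\<close>.\<close>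
  have key: "bhol A (\<lambda>x. T (H x) (x k))"
    if A: "sup_open A" "A \<subseteq> slab l e J" "\<And>x. x \<in> A \<Longrightarrow> x k \<in> W"
      and T: "\<And>G M. G holomorphic_on ?O \<Longrightarrow> \<forall>z\<in>?O. cmod (G z) \<le> M \<Longrightarrow> T G holomorphic_on W \<and> (\<forall>z\<in>W. cmod (T G z) \<le> C * M)"
      and Tl: "\<And>G1 G2 M a b. G1 holomorphic_on ?O \<Longrightarrow> G2 holomorphic_on ?O \<Longrightarrow> \<forall>z\<in>?O. cmod (G1 z) \<le> M \<and> cmod (G2 z) \<le> M \<Longrightarrow>
         \<forall>z\<in>W. T (\<lambda>w. a * G1 w + b * G2 w) z = a * T G1 z + b * T G2 z"
    for A W and T :: "(complex \<Rightarrow> complex) \<Rightarrow> complex \<Rightarrow> complex"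
  proof -
    have Tb: "cmod (T (H x) z) \<le> C * M" if "x \<in> slab l e J" "z \<in> W" for x z
      using T[OF H(3)[OF that(1)] HM[OF that(1)]] that(2) by blast
    have g1: "gateaux_at (\<lambda>x. T (H x) z) y" if y: "y \<in> slab l e J" and z: "z \<in> W" for y z
      unfolding gateaux_at_def
    proof
      fix v :: "'k \<Rightarrow> complex" assume v: "v \<in> CK"
      obtain r where r: "0 < r" and L: "\<And>\<xi>. cmod \<xi> < r \<Longrightarrow> (\<lambda>t. y t + \<xi> * v t) \<in> slab l e J"
        using sup_open_line[OF K opJ(1) y v] by blast
      show "(\<lambda>\<xi>. T (H (\<lambda>t. y t + \<xi> * v t)) z) field_differentiable at 0"
      proof (rule field_differentiable_bounded_functional[OF oO r, of "\<lambda>\<xi>. H (\<lambda>t. y t + \<xi> * v t)" M "\<lambda>G. T G z" C])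
        fix \<xi> :: complex assume "\<xi> \<in> ball 0 r"
        then have *: "(\<lambda>t. y t + \<xi> * v t) \<in> slab l e J" using L by simp
        show "H (\<lambda>t. y t + \<xi> * v t) holomorphic_on ?O" by (rule H(3)[OF *])
        show "cmod (H (\<lambda>t. y t + \<xi> * v t) w) \<le> M" if "w \<in> ?O" for w by (rule H(1)[OF * that])
      next
        fix w assume w: "w \<in> ?O"
        show "(\<lambda>\<xi>. H (\<lambda>t. y t + \<xi> * v t) w) holomorphic_on ball 0 r"
          by (rule gateaux_line_holomorphic[OF v, where h="\<lambda>x. H x w"]) (rule H(2)[OF L w], simp)
      next
        show "T (\<lambda>w. a * G1 w + b * G2 w) z = a * T G1 z + b * T G2 z"
          if "G1 holomorphic_on ?O" "G2 holomorphic_on ?O" "\<forall>z\<in>?O. cmod (G1 z) \<le> M \<and> cmod (G2 z) \<le> M" for G1 G2 M a b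
          using Tl[OF that] z by blast
        show "cmod (T G z) \<le> C * M" if "G holomorphic_on ?O" "\<forall>z\<in>?O. cmod (G z) \<le> M" for G M
          using T[OF that] z by blast
      qed
    qed
    have "gateaux_at (\<lambda>x. T (H x) (x k)) x" if x: "x \<in> A" for x
      unfolding gateaux_at_def
    proof
      fix v :: "'k \<Rightarrow> complex" assume v: "v \<in> CK"
      obtain r where r: "0 < r" and L: "\<And>\<xi>. cmod \<xi> < r \<Longrightarrow> (\<lambda>t. x t + \<xi> * v t) \<in> A"
        using sup_open_line[OF K A(1) x v] by blast
      have LJ: "(\<lambda>t. x t + \<xi> * v t) \<in> slab l e J" if "cmod \<xi> < r" for \<xi> using L[OF that] A by blast
      have LW: "x k + \<xi> * v k \<in> W" if "cmod \<xi> < r" for \<xi> using A(3)[OF L[OF that]] .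
      \<comment> \<open>The two occurrences of x get independent parameters. In the first, p is
        holomorphic because T is linear and bounded; in the second, because T maps into functions
        holomorphic on \<open>W\<close>.\<close>
      define p where "p = (\<lambda>\<xi> \<eta>. T (H (\<lambda>t. x t + \<xi> * v t)) (x k + \<eta> * v k))"
      have "((\<lambda>z. p z z) has_field_derivative deriv (\<lambda>z. p z 0) 0 + deriv (p 0) 0) (at 0)"
      proof (rule has_field_derivative_diagonal[OF r, of p "C * M"])
        fix \<eta> :: complex assume \<eta>: "\<eta> \<in> ball 0 r"
        show "(\<lambda>\<xi>. p \<xi> \<eta>) holomorphic_on ball 0 r"
          unfolding p_def
          by (rule gateaux_line_holomorphic[OF v, where h="\<lambda>y. T (H y) (x k + \<eta> * v k)"]) (use g1 LJ LW \<eta> in auto)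
        have "(T (H (\<lambda>t. x t + \<eta> * v t)) \<circ> (\<lambda>\<zeta>. x k + \<zeta> * v k)) holomorphic_on ball 0 r"
        proof (rule holomorphic_on_compose_gen)
          show "(\<lambda>\<zeta>. x k + \<zeta> * v k) holomorphic_on ball 0 r" by (intro holomorphic_intros)
          show "T (H (\<lambda>t. x t + \<eta> * v t)) holomorphic_on W"
            using T[OF H(3) HM, OF LJ LJ] \<eta> by auto
          show "(\<lambda>\<zeta>. x k + \<zeta> * v k) ` ball 0 r \<subseteq> W" using LW by auto
        qed
        then show "p \<eta> holomorphic_on ball 0 r" by (simp add: p_def o_def)
      next
        show "cmod (p \<xi> \<eta>) \<le> C * M" if "\<xi> \<in> ball 0 r" "\<eta> \<in> ball 0 r" for \<xi> \<eta>
          unfolding p_def using that LJ LW by (intro Tb) auto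
      qed
      then show "(\<lambda>\<xi>. T (H (\<lambda>t. x t + \<xi> * v t)) (x k + \<xi> * v k)) field_differentiable at 0"
        unfolding p_def field_differentiable_def by blast
    qed
    moreover have "\<forall>x\<in>A. cmod (T (H x) (x k)) \<le> C * M" using Tb A by blast
    ultimately show ?thesis unfolding bhol_def by blast
  qed
  have xk: "x k \<in> ball 0 1" if "x \<in> slab l e J" for x J
    using BallX_norm_less[OF K] that by (auto simp: slab_def)
  have xk': "x k \<in> ?O" if "x \<in> slab l e (insert k J)" for x
    using that xk[OF that] by (auto simp: slab_def dist_norm norm_minus_commute)
  have "bhol (slab l e J) (\<lambda>x. P (H x) (x k))"
    by (rule key[where A="slab l e J" and W="ball 0 1" and T=P]) (fact opJ(1) order_refl xk op(1) lin(1))+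
  moreover have "bhol (slab l e (insert k J)) (\<lambda>x. Q (H x) (x k))"
    by (rule key[where A="slab l e (insert k J)" and W="?O" and T=Q]) (fact opJ(2) sub xk' op(2) lin(2))+
  moreover have "\<forall>x\<in>slab l e (insert k J). P (H x) (x k) = h x + (x k - l k) * Q (H x) (x k)"
  proof
    fix x assume x: "x \<in> slab l e (insert k J)"
    then have xJ: "x \<in> slab l e J" using sub by blast
    show "P (H x) (x k) = h x + (x k - l k) * Q (H x) (x k)"
      using op(3)[OF H(3)[OF xJ] HM[OF xJ]] xk'[OF x] H(4)[OF x] by simp
  qed
  ultimately show ?thesis
    by (intro exI[of _ "\<lambda>x. P (H x) (x k)"] exI[of _ "\<lambda>x. Q (H x) (x k)"]) blast
qed

text \<open>Induction on the set \<open>I\<close> of conditions already dropped: it starts with 1/f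
  on the full slab and ends on the whole ball. Dropping the condition at k means extending all
  coefficients found so far and absorbing the resulting defect into one new term with factor x(k) -
  l(k).\<close>

lemma slab_bezout:
  fixes f :: "('k::t2_space \<Rightarrow> complex) \<Rightarrow> complex"
  assumes K: "compact (UNIV :: 'k set)" and J: "finite J" and l: "\<And>k. cmod (l k) \<le> 1" and e: "0 < e"
    and f: "bhol BallX f" and \<delta>: "0 < \<delta>" "\<And>x. x \<in> slab l e J \<Longrightarrow> \<delta> \<le> cmod (f x)"
  shows "\<exists>g u. bhol BallX g \<and> (\<forall>j\<in>J. bhol BallX (u j)) \<and>
    (\<forall>x\<in>BallX. f x * g x + (\<Sum>j\<in>J. (x j - l j) * u j x) = 1)"
proof -
  have "\<exists>g u. bhol (slab l e (J - I)) g \<and> (\<forall>j\<in>I. bhol (slab l e (J - I)) (u j)) \<and>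
    (\<forall>x\<in>slab l e (J - I). f x * g x + (\<Sum>j\<in>I. (x j - l j) * u j x) = 1)" if "finite I" "I \<subseteq> J" for I
    using that
  proof (induction I rule: finite_induct)
    case empty
    have "bhol (slab l e J) (\<lambda>x. inverse (f x))"
      unfolding bhol_def
    proof (intro conjI ballI exI)
      fix x assume x: "x \<in> slab l e J"
      have d: "\<delta> \<le> cmod (f x)" by (rule \<delta>(2)[OF x])
      show "cmod (inverse (f x)) \<le> inverse \<delta>"
        unfolding norm_inverse using d \<delta>(1) by (rule le_imp_inverse_le)
      have "gateaux_at f x" using f x slab_sub_BallX unfolding bhol_def by blast
      then show "gateaux_at (\<lambda>x. inverse (f x)) x" using d \<delta>(1) by (intro gateaux_at_inverse) auto
    qed
    moreover have "f x * inverse (f x) = 1" if "x \<in> slab l e J" for x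
      using \<delta>(2)[OF that] \<delta>(1) by (intro right_inverse) auto
    ultimately show ?case by (intro exI[of _ "\<lambda>x. inverse (f x)"] exI[of _ "\<lambda>_ _. 0"]) auto
  next
    case (insert k I)
    define J' where "J' = J - insert k I"
    have J': "finite J'" "k \<notin> J'" "J - I = insert k J'" using J insert by (auto simp: J'_def)
    obtain g u where g: "bhol (slab l e (insert k J')) g" and u: "\<forall>j\<in>I. bhol (slab l e (insert k J')) (u j)"
      and eq: "\<forall>x\<in>slab l e (insert k J'). f x * g x + (\<Sum>j\<in>I. (x j - l j) * u j x) = 1"
      using insert unfolding J'(3) by auto
    let ?A = "slab l e J'" and ?B = "slab l e (insert k J')"
    have BA: "?B \<subseteq> ?A" by (auto simp: slab_def)
    have oA: "sup_open ?A" and oB: "sup_open ?B" using sup_open_slab[OF K] J' by auto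
    obtain g' \<kappa> where g': "bhol ?A g'" "bhol ?B \<kappa>" "\<forall>x\<in>?B. g' x = g x + (x k - l k) * \<kappa> x"
      using slab_extension[where l=l, OF K J'(1,2) l e g] by blast
    have "\<forall>j\<in>I. \<exists>p. bhol ?A (fst p) \<and> bhol ?B (snd p) \<and> (\<forall>x\<in>?B. fst p x = u j x + (x k - l k) * snd p x)"
    proof
      fix j assume "j \<in> I"
      then obtain h' \<kappa>' where "bhol ?A h'" "bhol ?B \<kappa>'" "\<forall>x\<in>?B. h' x = u j x + (x k - l k) * \<kappa>' x"
        using slab_extension[where l=l, OF K J'(1,2) l e] u by blast
      then show "\<exists>p. bhol ?A (fst p) \<and> bhol ?B (snd p) \<and> (\<forall>x\<in>?B. fst p x = u j x + (x k - l k) * snd p x)"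
        by (intro exI[of _ "(h', \<kappa>')"]) simp
    qed
    from bchoice[OF this] obtain p where p0: "\<forall>j\<in>I. bhol ?A (fst (p j)) \<and> bhol ?B (snd (p j)) \<and>
      (\<forall>x\<in>?B. fst (p j) x = u j x + (x k - l k) * snd (p j) x)" by blast
    then have p: "\<And>j. j \<in> I \<Longrightarrow> bhol ?A (fst (p j))" "\<And>j. j \<in> I \<Longrightarrow> bhol ?B (snd (p j))"
      "\<And>j x. j \<in> I \<Longrightarrow> x \<in> ?B \<Longrightarrow> fst (p j) x = u j x + (x k - l k) * snd (p j) x" by auto
    \<comment> \<open>The defect of the identity after all coefficients are extended. On the smaller
      slab each of them has changed by a multiple of x(k) - l(k), so the defect is such a multiple
      too, with the bounded quotient \<open>\<rho>\<close> defined next.\<close>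
    define err where "err = (\<lambda>x. 1 - (f x * g' x + (\<Sum>j\<in>I. (x j - l j) * fst (p j) x)))"
    define \<rho> where "\<rho> = (\<lambda>x. (-1) * (f x * \<kappa> x + (\<Sum>j\<in>I. (x j - l j) * snd (p j) x)))"
    have ev: "bhol S (\<lambda>y. y j - l j)" if "S \<subseteq> BallX" for S j
      by (intro bhol_diff bhol_const bhol_eval[OF K that])
    have berr: "bhol ?A err"
      unfolding err_def
      by (intro bhol_diff bhol_const bhol_add bhol_mult bhol_sum g' p ev slab_sub_BallX bhol_subset[OF f])
    have b\<rho>: "bhol ?B \<rho>"
      unfolding \<rho>_def
      by (intro bhol_cmult bhol_add bhol_mult bhol_sum g' p ev slab_sub_BallX bhol_subset[OF f])
    have err\<rho>: "err x = (x k - l k) * \<rho> x" if x: "x \<in> ?B" for x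
    proof -
      have "(\<Sum>j\<in>I. (x j - l j) * fst (p j) x) = (\<Sum>j\<in>I. (x j - l j) * u j x + (x k - l k) * ((x j - l j) * snd (p j) x))"
        by (intro sum.cong refl) (subst p(3)[OF _ x], auto simp: algebra_simps)
      then have "(\<Sum>j\<in>I. (x j - l j) * fst (p j) x) = (\<Sum>j\<in>I. (x j - l j) * u j x) + (x k - l k) * (\<Sum>j\<in>I. (x j - l j) * snd (p j) x)"
        by (simp add: sum.distrib sum_distrib_left)
      note S = this
      have "err x = (1 - (f x * g x + (\<Sum>j\<in>I. (x j - l j) * u j x))) + (x k - l k) * \<rho> x"
        unfolding err_def \<rho>_def S g'(3)[rule_format, OF x] by (simp add: algebra_simps)
      then show ?thesis using eq x by simp
    qed
    \<comment> \<open>The quotient of the defect by x(k) - l(k) on the larger slab: near l(k) it is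
      \<open>\<rho>\<close>, free of singularities, and elsewhere the denominator has modulus at
      least e.\<close>
    define uk where "uk = (\<lambda>x. if cmod (x k - l k) < e then \<rho> x else err x / (x k - l k))"
    have mem: "x \<in> ?B" if "x \<in> ?A" "cmod (x k - l k) < e" for x using that by (auto simp: slab_def)
    have uk: "err x = (x k - l k) * uk x" if "x \<in> ?A" for x
      using err\<rho>[OF mem[OF that]] e by (auto simp: uk_def)
    have "bhol ?A uk"
      unfolding bhol_def
    proof (intro conjI ballI)
      obtain M N where M: "\<forall>x\<in>?A. cmod (err x) \<le> M" and N: "\<forall>x\<in>?B. cmod (\<rho> x) \<le> N"
        using berr b\<rho> unfolding bhol_def by blast
      have "cmod (uk x) \<le> max N (M / e)" if x: "x \<in> ?A" for x
      proof (cases "cmod (x k - l k) < e")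
        case True
        then show ?thesis using N mem[OF x True] by (auto simp: uk_def le_max_iff_disj)
      next
        case False
        have "cmod (err x) / cmod (x k - l k) \<le> M / e"
          using M x False e order_trans[OF norm_ge_zero] by (intro frac_le) auto
        then show ?thesis using False by (auto simp: uk_def norm_divide le_max_iff_disj)
      qed
      then show "\<exists>M. \<forall>x\<in>?A. cmod (uk x) \<le> M" by blast
    next
      fix x assume x: "x \<in> ?A"
      show "gateaux_at uk x"
      proof (cases "cmod (x k - l k) < e")
        case True
        show ?thesis
        proof (rule gateaux_at_cong[OF K oB mem[OF x True], of \<rho>])
          show "gateaux_at \<rho> x" using b\<rho> mem[OF x True] unfolding bhol_def by blast
        qed (auto simp: uk_def slab_def)
      next
        case False
        \<comment> \<open>On the circle |x(k) - l(k)| = e the definition of \<open>uk\<close> may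
          switch cases in every neighbourhood; on the open set x(k) \<noteq> l(k), however, both
          cases give the same quotient.\<close>
        define E where "E = {y \<in> ?A. y k \<noteq> l k}"
        have xE: "x \<in> E" using False e x by (auto simp: E_def)
        have oE: "sup_open E"
          unfolding sup_open_def
        proof (intro conjI ballI)
          show "E \<subseteq> CK" by (auto simp: E_def slab_def BallX_def)
          fix y assume y: "y \<in> E"
          then obtain r where r: "r > 0" "\<forall>z\<in>CK. (\<forall>k. cmod (z k - y k) < r) \<longrightarrow> z \<in> ?A"
            using oA unfolding sup_open_def E_def by blast
          have "0 < cmod (y k - l k)" using y by (simp add: E_def)
          moreover have "z k \<noteq> l k" if "cmod (z k - y k) < cmod (y k - l k)" for z :: "'k \<Rightarrow> complex"
            using that by (auto simp: norm_minus_commute)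
          ultimately show "\<exists>r>0. \<forall>z\<in>CK. (\<forall>k. cmod (z k - y k) < r) \<longrightarrow> z \<in> E"
            using r by (intro exI[of _ "min r (cmod (y k - l k))"]) (auto simp: E_def)
        qed
        show ?thesis
        proof (rule gateaux_at_cong[OF K oE xE, of "\<lambda>y. err y * inverse (y k - l k)"])
          show "err y * inverse (y k - l k) = uk y" if "y \<in> E" for y
            using uk[of y] that by (simp add: E_def field_simps)
          have "gateaux_at err x" using berr x unfolding bhol_def by blast
          moreover have "gateaux_at (\<lambda>y. y k - l k) x"
            using gateaux_at_add[OF gateaux_at_eval[of k] gateaux_at_const[of "- l k"]] by simp
          ultimately show "gateaux_at (\<lambda>y. err y * inverse (y k - l k)) x"
            using xE by (intro gateaux_at_mult gateaux_at_inverse) (auto simp: E_def)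
        qed
      qed
    qed
    moreover have "f x * g' x + (\<Sum>j\<in>insert k I. (x j - l j) * ((\<lambda>j. fst (p j))(k := uk)) j x) = 1" if "x \<in> ?A" for x
    proof -
      have "(\<Sum>j\<in>I. (x j - l j) * ((\<lambda>j. fst (p j))(k := uk)) j x) = (\<Sum>j\<in>I. (x j - l j) * fst (p j) x)"
        using insert by (intro sum.cong) auto
      then show ?thesis using uk[OF that] insert by (simp add: err_def algebra_simps)
    qed
    ultimately show ?case
      unfolding J'_def[symmetric] using g'(1) p(1)
      by (intro exI[of _ g'] exI[of _ "(\<lambda>j. fst (p j))(k := uk)"]) auto
  qed
  from this[OF J order_refl] show ?thesis by (simp add: slab_empty)
qed

section \<open>Point evaluations and characters\<close>

definition point_eval :: "'k::topological_space \<Rightarrow> ('k \<Rightarrow> complex) \<Rightarrow> complex" where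
  "point_eval k = (\<lambda>x. if x \<in> CK then x k else 0)"

lemma point_eval_dualX:
  assumes "compact (UNIV :: 'k::topological_space set)"
  shows "point_eval (k::'k) \<in> dualX"
  unfolding dualX_def
proof (intro CollectI conjI ballI allI)
  show "point_eval k (\<lambda>t. a * x t + b * y t) = a * point_eval k x + b * point_eval k y" if "x \<in> CK" "y \<in> CK" for x y a b
    using that CK_lincomb[OF that] by (simp add: point_eval_def)
  show "\<exists>C. \<forall>x\<in>CK. cmod (point_eval k x) \<le> C * supn x"
    by (rule exI[of _ 1]) (use norm_le_supn[OF assms] in \<open>simp add: point_eval_def\<close>)
qed (simp add: point_eval_def)

lemma dualX_lincomb:
  fixes \<phi> \<psi> :: "('k::topological_space \<Rightarrow> complex) \<Rightarrow> complex"
  assumes \<phi>: "\<phi> \<in> dualX" and \<psi>: "\<psi> \<in> dualX"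
  shows "(\<lambda>x. a * \<phi> x + b * \<psi> x) \<in> dualX"
  unfolding dualX_def
proof (intro CollectI conjI ballI allI)
  show "a * \<phi> (\<lambda>t. c * x t + d * y t) + b * \<psi> (\<lambda>t. c * x t + d * y t) = c * (a * \<phi> x + b * \<psi> x) + d * (a * \<phi> y + b * \<psi> y)"
    if "x \<in> CK" "y \<in> CK" for x y c d
    unfolding dualX_linear[OF \<phi> that] dualX_linear[OF \<psi> that] by (simp add: algebra_simps)
  obtain C D where C: "\<forall>x\<in>CK. cmod (\<phi> x) \<le> C * supn x" and D: "\<forall>x\<in>CK. cmod (\<psi> x) \<le> D * supn x"
    using \<phi> \<psi> unfolding dualX_def by blast
  have "cmod (a * \<phi> x + b * \<psi> x) \<le> (cmod a * C + cmod b * D) * supn x" if "x \<in> CK" for x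
  proof -
    have "cmod (a * \<phi> x + b * \<psi> x) \<le> cmod a * cmod (\<phi> x) + cmod b * cmod (\<psi> x)"
      by (metis norm_mult norm_triangle_ineq)
    also have "\<dots> \<le> cmod a * (C * supn x) + cmod b * (D * supn x)"
      using C D that by (intro add_mono mult_left_mono) auto
    finally show ?thesis by (simp add: algebra_simps)
  qed
  then show "\<exists>C. \<forall>x\<in>CK. cmod (a * \<phi> x + b * \<psi> x) \<le> C * supn x" by blast
  show "x \<notin> CK \<longrightarrow> a * \<phi> x + b * \<psi> x = 0" for x using \<phi> \<psi> by (simp add: dualX_def)
qed

lemma bidual_eval_le_1:
  assumes K: "compact (UNIV :: 'k::topological_space set)" and \<Psi>: "\<Psi> \<in> bidual_ball"
  shows "cmod (\<Psi> (point_eval (k::'k))) \<le> 1"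
proof -
  have "cmod (\<Psi> (point_eval k)) \<le> dnorm (point_eval k)"
    using \<Psi> point_eval_dualX[OF K] unfolding bidual_ball_def by blast
  also have "\<dots> \<le> 1"
    unfolding dnorm_def
  proof (rule cSUP_least)
    have "(\<lambda>_. 0) \<in> {x \<in> CK. supn x \<le> 1}" by (simp add: CK_def supn_def)
    then show "{x \<in> CK. supn x \<le> 1} \<noteq> ({} :: ('k \<Rightarrow> complex) set)" by blast
    show "cmod (point_eval k x) \<le> 1" if "x \<in> {x \<in> CK. supn x \<le> 1}" for x
      using that norm_le_supn[OF K, of x k] by (simp add: point_eval_def)
  qed
  finally show ?thesis .
qed

lemma fiber_value_approximated:
  fixes f :: "('k::t2_space \<Rightarrow> complex) \<Rightarrow> complex"
  assumes K: "compact (UNIV :: 'k set)" and \<Psi>: "\<Psi> \<in> bidual_ball" and f: "f \<in> Hinf" and \<tau>: "\<tau> \<in> fiber \<Psi>"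
    and J: "finite J" and e: "0 < e"
  shows "\<exists>x\<in>slab (\<lambda>j. \<Psi> (point_eval j)) e J. cmod (f x - \<tau> f) < e"
proof (rule ccontr)
  define l where "l = (\<lambda>j. \<Psi> (point_eval j))"
  assume "\<not> ?thesis"
  then have far: "\<And>x. x \<in> slab l e J \<Longrightarrow> e \<le> cmod (f x - \<tau> f)" unfolding l_def by force
  have lb: "cmod (l k) \<le> 1" for k unfolding l_def by (rule bidual_eval_le_1[OF K \<Psi>])
  have bf: "bhol BallX f" by (rule Hinf_imp_bhol[OF K f])
  obtain g u where g: "bhol BallX g" and u: "\<forall>j\<in>J. bhol BallX (u j)"
    and eq: "\<forall>x\<in>BallX. (f x - \<tau> f) * g x + (\<Sum>j\<in>J. (x j - l j) * u j x) = 1"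
    using slab_bezout[where l=l, OF K J _ e bhol_diff[OF bf bhol_const] e far] lb by blast
  note inH = bhol_imp_Hinf[OF K]
  have lin: "\<tau> (\<lambda>x. a * f x + b * g x) = a * \<tau> f + b * \<tau> g" if "f \<in> Hinf" "g \<in> Hinf" for f g a b
    using \<tau> that unfolding fiber_def by blast
  have mult: "\<tau> (\<lambda>x. f x * g x) = \<tau> f * \<tau> g" if "f \<in> Hinf" "g \<in> Hinf" for f g
    using \<tau> that unfolding fiber_def by blast
  \<comment> \<open>Members of \<open>Hinf\<close> are 0 off the ball by convention, so functions
    given by a formula for all x reach \<open>\<tau>\<close> through \<open>restrB\<close>.\<close>
  define t where "t = (\<lambda>h. \<tau> (restrB h))"
  have tadd: "t (\<lambda>x. a * f x + b * g x) = a * t f + b * t g" if "bhol BallX f" "bhol BallX g" for f g a b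
  proof -
    have "restrB (\<lambda>x. a * f x + b * g x) = (\<lambda>x. a * restrB f x + b * restrB g x)" by (auto simp: restrB_def)
    then show ?thesis unfolding t_def using lin[OF inH[OF that(1)] inH[OF that(2)]] by simp
  qed
  have tmult: "t (\<lambda>x. f x * g x) = t f * t g" if "bhol BallX f" "bhol BallX g" for f g
  proof -
    have "restrB (\<lambda>x. f x * g x) = (\<lambda>x. restrB f x * restrB g x)" by (auto simp: restrB_def)
    then show ?thesis unfolding t_def using mult[OF inH[OF that(1)] inH[OF that(2)]] by simp
  qed
  have restr: "restrB h = h" if "h \<in> Hinf" for h :: "('k \<Rightarrow> complex) \<Rightarrow> complex"
    using that by (auto simp: restrB_def Hinf_def)
  \<comment> \<open>Cancel \<open>\<tau> h\<close> in the relation that multiplicativity gives for h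
    = h * 1, where \<open>\<tau> h\<close> is nonzero.\<close>
  have t1: "t (\<lambda>x. 1) = 1"
  proof -
    obtain h where h: "h \<in> Hinf" "\<tau> h \<noteq> 0" using \<tau> unfolding fiber_def by blast
    have "t h = t h * t (\<lambda>x. 1)" using tmult[OF Hinf_imp_bhol[OF K h(1)] bhol_const[of _ 1]] by simp
    moreover have "t h \<noteq> 0" using h restr by (simp add: t_def)
    ultimately show ?thesis by simp
  qed
  have tf: "t (\<lambda>x. f x - \<tau> f) = 0"
    using tadd[OF bf bhol_const[of _ 1], of 1 "- \<tau> f"] restr[OF f] t1 by (simp add: t_def)
  have te: "t (\<lambda>x. x j - l j) = 0" for j
  proof -
    have "restrB (\<lambda>x. x j) = restrB (point_eval j)" by (auto simp: restrB_def point_eval_def BallX_def)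
    then have "t (\<lambda>x. x j) = l j"
      using \<tau> point_eval_dualX[OF K] unfolding t_def l_def fiber_def by simp
    then show ?thesis
      using tadd[OF bhol_eval[OF K order_refl] bhol_const[of _ 1], of 1 j "- l j"] t1 by simp
  qed
  have bev: "bhol BallX (\<lambda>x. x j - l j)" for j by (intro bhol_diff bhol_const bhol_eval[OF K order_refl])
  have tsum: "t (\<lambda>x. \<Sum>j\<in>I. (x j - l j) * u j x) = 0" if "finite I" "I \<subseteq> J" for I
    using that
  proof (induction I rule: finite_induct)
    case empty
    then show ?case using tadd[OF bhol_const[of _ 1] bhol_const[of _ 1], of 0 0] by simp
  next
    case (insert i I)
    have 1: "bhol BallX (\<lambda>x. (x i - l i) * u i x)" using insert u by (intro bhol_mult bev) auto
    have 2: "bhol BallX (\<lambda>x. \<Sum>j\<in>I. (x j - l j) * u j x)" using insert u by (intro bhol_sum bhol_mult bev) auto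
    have "t (\<lambda>x. (x i - l i) * u i x) = 0" using tmult[OF bev, of "u i" i] te[of i] insert u by simp
    then show ?case using tadd[OF 1 2, of 1 1] insert by simp
  qed
  have b1: "bhol BallX (\<lambda>x. (f x - \<tau> f) * g x)" by (intro bhol_mult g bhol_diff bf bhol_const)
  have b2: "bhol BallX (\<lambda>x. \<Sum>j\<in>J. (x j - l j) * u j x)" using u by (intro bhol_sum bhol_mult bev) auto
  have "t (\<lambda>x. (f x - \<tau> f) * g x) = 0"
    using tmult[OF bhol_diff[OF bf bhol_const] g, of "\<tau> f"] tf by simp
  then have "t (\<lambda>x. (f x - \<tau> f) * g x + (\<Sum>j\<in>J. (x j - l j) * u j x)) = 0"
    using tadd[OF b1 b2, of 1 1] tsum[OF J] by simp
  moreover have "restrB (\<lambda>x. (f x - \<tau> f) * g x + (\<Sum>j\<in>J. (x j - l j) * u j x)) = restrB (\<lambda>x. 1)"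
    using eq by (auto simp: restrB_def)
  ultimately show False using t1 by (simp add: t_def)
qed

section \<open>Functionals on C(K) for dispersed K\<close>

definition supported_unit :: "'k::topological_space set \<Rightarrow> ('k \<Rightarrow> complex) set" where
  "supported_unit U = {x \<in> CK. (\<forall>t. cmod (x t) \<le> 1) \<and> (\<forall>t. t \<notin> U \<longrightarrow> x t = 0)}"

text \<open>For open U this is the total variation on U of the measure representing \<phi>,
  expressed through test functions alone.\<close>

definition variation :: "(('k::topological_space \<Rightarrow> complex) \<Rightarrow> complex) \<Rightarrow> 'k set \<Rightarrow> real" where
  "variation \<phi> U = (SUP x\<in>supported_unit U. cmod (\<phi> x))"

text \<open>For the measure representing \<open>\<phi>\<close> this says that its total variation on \<open>U\<close> is purely atomic.\<close>

definition almost_finite :: "(('k::topological_space \<Rightarrow> complex) \<Rightarrow> complex) \<Rightarrow> 'k set \<Rightarrow> bool" where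
  "almost_finite \<phi> U \<longleftrightarrow> (\<forall>\<eta>>0. \<exists>J. finite J \<and> variation \<phi> (U - J) \<le> \<eta>)"

lemma supported_unit_zero: "(\<lambda>_. 0) \<in> supported_unit U"
  by (simp add: supported_unit_def CK_def)

lemma dualX_bound:
  fixes \<phi> :: "('k::topological_space \<Rightarrow> complex) \<Rightarrow> complex"
  assumes K: "compact (UNIV :: 'k set)" and "\<phi> \<in> dualX"
  obtains C where "0 < C" "\<And>x r. x \<in> CK \<Longrightarrow> (\<And>t. cmod (x t) \<le> r) \<Longrightarrow> cmod (\<phi> x) \<le> C * r"
proof -
  obtain C where C: "\<forall>x\<in>CK. cmod (\<phi> x) \<le> C * supn x" using assms unfolding dualX_def by blast
  have "cmod (\<phi> x) \<le> (\<bar>C\<bar> + 1) * r" if x: "x \<in> CK" and r: "\<And>t. cmod (x t) \<le> r" for x r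
  proof -
    have "cmod (\<phi> x) \<le> C * supn x" using C x by blast
    also have "\<dots> \<le> (\<bar>C\<bar> + 1) * supn x" using supn_nonneg[OF K x] by (intro mult_right_mono) auto
    also have "\<dots> \<le> (\<bar>C\<bar> + 1) * r" using supn_le[of x r] r by (intro mult_left_mono) auto
    finally show ?thesis .
  qed
  then show thesis using that[of "\<bar>C\<bar> + 1"] by auto
qed

context
  fixes \<phi> :: "('k::t2_space \<Rightarrow> complex) \<Rightarrow> complex"
  assumes K: "compact (UNIV :: 'k set)" and \<phi>: "\<phi> \<in> dualX"
begin

lemma variation_upper:
  assumes "x \<in> supported_unit U"
  shows "cmod (\<phi> x) \<le> variation \<phi> U"
proof -
  obtain C where C: "\<And>x r. x \<in> CK \<Longrightarrow> (\<And>t. cmod (x t) \<le> r) \<Longrightarrow> cmod (\<phi> x) \<le> C * r"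
    using dualX_bound[OF K \<phi>] by metis
  have "bdd_above ((\<lambda>x. cmod (\<phi> x)) ` supported_unit U)"
    using C[where r=1] by (intro bdd_aboveI[of _ "C * 1"]) (auto simp: supported_unit_def)
  then show ?thesis unfolding variation_def by (rule cSUP_upper[OF assms])
qed

lemma variation_least: "(\<And>x. x \<in> supported_unit U \<Longrightarrow> cmod (\<phi> x) \<le> B) \<Longrightarrow> variation \<phi> U \<le> B"
  unfolding variation_def using supported_unit_zero by (intro cSUP_least) auto

lemma variation_mono: "U \<subseteq> V \<Longrightarrow> variation \<phi> U \<le> variation \<phi> V"
  by (rule variation_least, rule variation_upper) (auto simp: supported_unit_def)

lemma variation_approx:
  assumes "0 < \<eta>"
  obtains x where "x \<in> supported_unit U" "variation \<phi> U - \<eta> < cmod (\<phi> x)"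
proof (rule ccontr)
  assume "\<not> thesis"
  then have "\<And>x. x \<in> supported_unit U \<Longrightarrow> cmod (\<phi> x) \<le> variation \<phi> U - \<eta>" using that by force
  then have "variation \<phi> U \<le> variation \<phi> U - \<eta>" by (rule variation_least)
  then show False using assms by simp
qed

text \<open>A function vanishing off U need not be carried by a closed subset of U, which Urysohn
  separation and compactness require. Shrinking all moduli by s = \<eta> / B, down to 0 at the
  least, costs at most \<eta> in \<phi> and leaves a function carried by the closed set |x| \<ge>
  s.\<close>

lemma soft_threshold:
  assumes x: "x \<in> supported_unit U" and \<eta>: "0 < \<eta>"
  obtains y C where "y \<in> supported_unit U" "closed C" "C \<subseteq> U" "\<And>t. t \<notin> C \<Longrightarrow> y t = 0"
    "cmod (\<phi> x - \<phi> y) \<le> \<eta>"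
proof -
  obtain B where B: "0 < B" "\<And>x r. x \<in> CK \<Longrightarrow> (\<And>t. cmod (x t) \<le> r) \<Longrightarrow> cmod (\<phi> x) \<le> B * r"
    by (rule dualX_bound[OF K \<phi>]) blast
  define s where "s = \<eta> / B"
  have s: "0 < s" using \<eta> B by (simp add: s_def)
  have xC: "continuous_on UNIV x" "\<And>t. cmod (x t) \<le> 1" "\<And>t. t \<notin> U \<Longrightarrow> x t = 0"
    using x by (auto simp: supported_unit_def CK_def)
  \<comment> \<open>Chosen so that w |x| = max(0, |x| - s). The denominator never vanishes and
    differs from |x| only where the numerator is 0.\<close>
  define w where "w = (\<lambda>t. max 0 (cmod (x t) - s) / max s (cmod (x t)))"
  define y where "y = (\<lambda>t. of_real (w t) * x t)"
  have w: "0 \<le> w t" "w t \<le> 1" for t using s by (auto simp: w_def divide_le_eq_1)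
  have "continuous_on UNIV w" unfolding w_def using s xC(1)
    by (intro continuous_intros) (auto simp: max_def)
  then have yC: "y \<in> CK" unfolding CK_def y_def using xC(1) by (auto intro!: continuous_intros)
  have yx: "cmod (y t) \<le> cmod (x t)" for t
    using w[of t] mult_right_mono[of "w t" 1 "cmod (x t)"] by (simp add: y_def norm_mult)
  have d: "cmod (x t - y t) \<le> s" for t
  proof -
    have "x t - y t = of_real (1 - w t) * x t" by (simp add: y_def algebra_simps)
    then have "cmod (x t - y t) = (1 - w t) * cmod (x t)" using w[of t] by (simp only: norm_mult norm_of_real)
    also have "\<dots> \<le> s"
    proof (cases "cmod (x t) \<le> s")
      case True
      then show ?thesis using w[of t] mult_right_mono[of "1 - w t" 1 "cmod (x t)"] by simp
    next
      case False
      then have "w t = (cmod (x t) - s) / cmod (x t)" by (simp add: w_def)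
      then have "w t * cmod (x t) = cmod (x t) - s" using False s by auto
      then have "(1 - w t) * cmod (x t) = s" by (simp add: left_diff_distrib)
      then show ?thesis by simp
    qed
    finally show ?thesis .
  qed
  have "(\<lambda>t. 1 * x t + (-1) * y t) \<in> CK" using x yC by (intro CK_lincomb) (auto simp: supported_unit_def)
  from B(2)[OF this, of s] d have "cmod (\<phi> (\<lambda>t. 1 * x t + (-1) * y t)) \<le> B * s" by simp
  then have "cmod (\<phi> x - \<phi> y) \<le> \<eta>"
    using dualX_linear[OF \<phi>, of x y 1 "-1"] x yC B by (simp add: supported_unit_def s_def)
  moreover have "closed {t. s \<le> cmod (x t)}" using xC(1) by (intro closed_Collect_le continuous_intros)
  moreover have "{t. s \<le> cmod (x t)} \<subseteq> U" using xC(3) s by force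
  moreover have "y t = 0" if "t \<notin> {t. s \<le> cmod (x t)}" for t using that by (simp add: y_def w_def)
  moreover have "y \<in> supported_unit U"
    using yC order_trans[OF yx xC(2)] xC(3) by (auto simp: supported_unit_def y_def)
  ultimately show thesis using that by blast
qed

text \<open>After thresholding, the carrier \<open>C\<close> is closed and covered by U and V, so C
  - U and C - V are disjoint closed sets. A Urysohn function p between them splits y into p y,
  vanishing off U, and (1 - p) y, vanishing off V.\<close>

lemma variation_subadditive:
  assumes U: "open U" "open V"
  shows "variation \<phi> (U \<union> V) \<le> variation \<phi> U + variation \<phi> V"
proof (rule variation_least)
  fix x assume x: "x \<in> supported_unit (U \<union> V)"
  show "cmod (\<phi> x) \<le> variation \<phi> U + variation \<phi> V"
  proof (rule field_le_epsilon)
    fix \<eta> :: real assume "0 < \<eta>"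
    from soft_threshold[OF x this] obtain y C where y: "y \<in> supported_unit (U \<union> V)"
      and C: "closed C" "C \<subseteq> U \<union> V" "\<And>t. t \<notin> C \<Longrightarrow> y t = 0" and xy: "cmod (\<phi> x - \<phi> y) \<le> \<eta>" by blast
    obtain p :: "'k \<Rightarrow> real" where p: "continuous_on UNIV p" "\<And>t. 0 \<le> p t \<and> p t \<le> 1"
      "\<And>t. t \<in> C - U \<Longrightarrow> p t = 0" "\<And>t. t \<in> C - V \<Longrightarrow> p t = 1"
      by (rule Urysohn_compact[OF K, of "C - U" "C - V"]) (use C U in \<open>auto intro: closed_Diff\<close>)
    define y1 where "y1 = (\<lambda>t. of_real (p t) * y t)"
    define y2 where "y2 = (\<lambda>t. of_real (1 - p t) * y t)"
    have yc: "continuous_on UNIV y" "\<And>t. cmod (y t) \<le> 1" using y by (auto simp: supported_unit_def CK_def)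
    have CK12: "y1 \<in> CK" "y2 \<in> CK"
      unfolding CK_def y1_def y2_def using p(1) yc(1) by (auto intro!: continuous_intros)
    have n: "cmod (y1 t) \<le> 1" "cmod (y2 t) \<le> 1" for t
    proof -
      show "cmod (y1 t) \<le> 1" unfolding y1_def norm_mult norm_of_real using p(2)[of t] yc(2)[of t] by (intro mult_le_one) auto
      show "cmod (y2 t) \<le> 1" unfolding y2_def norm_mult norm_of_real using p(2)[of t] yc(2)[of t] by (intro mult_le_one) auto
    qed
    have "y1 t = 0" if "t \<notin> U" for t using p(3)[of t] C(3)[of t] that by (cases "t \<in> C") (auto simp: y1_def)
    moreover have "y2 t = 0" if "t \<notin> V" for t using p(4)[of t] C(3)[of t] that by (cases "t \<in> C") (auto simp: y2_def)
    ultimately have "y1 \<in> supported_unit U" "y2 \<in> supported_unit V" using CK12 n by (auto simp: supported_unit_def)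
    then have "cmod (\<phi> y1) \<le> variation \<phi> U" "cmod (\<phi> y2) \<le> variation \<phi> V" by (auto intro: variation_upper)
    moreover have "y = (\<lambda>t. 1 * y1 t + 1 * y2 t)" by (auto simp: y1_def y2_def algebra_simps)
    then have "\<phi> y = \<phi> y1 + \<phi> y2" using dualX_linear[OF \<phi> CK12, of 1 1] by simp
    moreover have "cmod (\<phi> x) \<le> cmod (\<phi> x - \<phi> y) + cmod (\<phi> y)" using norm_triangle_ineq[of "\<phi> x - \<phi> y" "\<phi> y"] by simp
    ultimately show "cmod (\<phi> x) \<le> variation \<phi> U + variation \<phi> V + \<eta>"
      using xy norm_triangle_ineq[of "\<phi> y1" "\<phi> y2"] by simp
  qed
qed

text \<open>A test function y on W - C is disjoint from x, so unimodular multiples of the two can be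
  added without exceeding modulus 1; the phases are chosen so that |\<phi> x| and |\<phi> y| add
  up.\<close>

lemma variation_superadditive:
  assumes x: "x \<in> supported_unit W" and C: "\<And>t. t \<notin> C \<Longrightarrow> x t = 0"
  shows "variation \<phi> (W - C) \<le> variation \<phi> W - cmod (\<phi> x)"
proof (rule variation_least)
  fix y assume y: "y \<in> supported_unit (W - C)"
  have phase: "\<exists>a. cmod a = 1 \<and> a * c = of_real (cmod c)" for c :: complex
  proof (cases "c = 0")
    case False
    have "cnj c / of_real (cmod c) * c = (of_real (cmod c))\<^sup>2 / of_real (cmod c)"
      using complex_norm_square[of c] by (simp add: mult.commute)
    then have "cnj c / of_real (cmod c) * c = of_real (cmod c)" using False by (simp add: power2_eq_square)
    then show ?thesis using False by (intro exI[of _ "cnj c / of_real (cmod c)"]) (auto simp: norm_divide)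
  qed (auto intro: exI[of _ 1])
  obtain a b where a: "cmod a = 1" "a * \<phi> x = of_real (cmod (\<phi> x))" and b: "cmod b = 1" "b * \<phi> y = of_real (cmod (\<phi> y))"
    using phase by metis
  define z where "z = (\<lambda>t. a * x t + b * y t)"
  have xy: "x \<in> CK" "y \<in> CK" using x y by (auto simp: supported_unit_def)
  have "cmod (z t) \<le> 1" for t
  proof (cases "t \<in> C")
    case True
    then have "y t = 0" using y by (simp add: supported_unit_def)
    then show ?thesis using x a by (simp add: z_def norm_mult supported_unit_def)
  next
    case False
    then show ?thesis using y b C[OF False] by (simp add: z_def norm_mult supported_unit_def)
  qed
  then have "z \<in> supported_unit W"
    using x y CK_lincomb[OF xy] by (auto simp: supported_unit_def z_def)
  then have "cmod (\<phi> z) \<le> variation \<phi> W" by (rule variation_upper)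
  moreover have "\<phi> z = of_real (cmod (\<phi> x) + cmod (\<phi> y))"
    unfolding z_def dualX_linear[OF \<phi> xy] a b by simp
  then have "cmod (\<phi> z) = cmod (\<phi> x) + cmod (\<phi> y)" by (simp only: norm_of_real) simp
  ultimately show "cmod (\<phi> y) \<le> variation \<phi> W - cmod (\<phi> x)" by linarith
qed

section \<open>Finite exhaustion of the variation on dispersed spaces\<close>

lemma almost_finite_Un:
  assumes "open U" "open V" "almost_finite \<phi> U" "almost_finite \<phi> V"
  shows "almost_finite \<phi> (U \<union> V)"
  unfolding almost_finite_def
proof (intro allI impI)
  fix \<eta> :: real assume "0 < \<eta>"
  then have "0 < \<eta> / 2" by simp
  then obtain I J where I: "finite I" "variation \<phi> (U - I) \<le> \<eta> / 2" and J: "finite J" "variation \<phi> (V - J) \<le> \<eta> / 2"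
    using assms(3,4) unfolding almost_finite_def by meson
  have "variation \<phi> ((U \<union> V) - (I \<union> J)) \<le> variation \<phi> ((U - I) \<union> (V - J))" by (rule variation_mono) auto
  also have "\<dots> \<le> variation \<phi> (U - I) + variation \<phi> (V - J)"
    using assms I J by (intro variation_subadditive open_Diff finite_imp_closed)
  finally show "\<exists>J. finite J \<and> variation \<phi> (U \<union> V - J) \<le> \<eta>" using I J by (intro exI[of _ "I \<union> J"]) auto
qed

lemma almost_finite_empty: "almost_finite \<phi> {}"
proof -
  have "variation \<phi> {} \<le> 0"
  proof (rule variation_least)
    fix x :: "'k \<Rightarrow> complex" assume "x \<in> supported_unit {}"
    then have "x = (\<lambda>_. 0)" by (auto simp: supported_unit_def)
    then show "cmod (\<phi> x) \<le> 0" using dualX_scaled[OF \<phi>, of "\<lambda>_. 0" 0] by (simp add: CK_def)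
  qed
  then show ?thesis unfolding almost_finite_def by (auto intro!: exI[of _ "{}"])
qed

lemma almost_finite_cover:
  assumes C: "closed C" and cov: "\<And>t. t \<in> C \<Longrightarrow> \<exists>U. open U \<and> t \<in> U \<and> almost_finite \<phi> U"
  obtains W where "open W" "C \<subseteq> W" "almost_finite \<phi> W"
proof -
  have "compact C" using K C by (metis Int_UNIV_left compact_Int_closed)
  moreover have "C \<subseteq> \<Union>{U. open U \<and> almost_finite \<phi> U}" using cov by blast
  ultimately obtain D where D: "D \<subseteq> {U. open U \<and> almost_finite \<phi> U}" "finite D" "C \<subseteq> \<Union>D"
    by (rule compactE) auto
  have "open (\<Union>D) \<and> almost_finite \<phi> (\<Union>D)"
    using D(2,1)
  proof (induction D rule: finite_induct)
    case empty
    then show ?case by (simp add: almost_finite_empty)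
  next
    case (insert U D)
    then show ?case using almost_finite_Un[of U "\<Union>D"] by auto
  qed
  then show thesis using that D(3) by blast
qed

text \<open>The points without an almost finite neighbourhood form a closed set without isolated points.\<close>

lemma almost_finite_UNIV:
  assumes disp: "dispersed (UNIV :: 'k set)"
  shows "almost_finite \<phi> UNIV"
proof (rule ccontr)
  assume n: "\<not> ?thesis"
  define S where "S = - \<Union>{U. open U \<and> almost_finite \<phi> U}"
  have Sc: "closed S" unfolding S_def by (intro closed_Compl open_Union) auto
  have "S \<noteq> {}"
  proof
    assume "S = {}"
    then have "\<exists>U. open U \<and> t \<in> U \<and> almost_finite \<phi> U" for t by (auto simp: S_def)
    then obtain W where "open W" "UNIV \<subseteq> W" "almost_finite \<phi> W" by (rule almost_finite_cover[OF closed_UNIV])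
    then show False using n by (metis top.extremum_unique)
  qed
  then have "\<not> (\<forall>x\<in>S. x islimpt S)" using disp Sc unfolding dispersed_def by auto
  then obtain k where k: "k \<in> S" "\<not> k islimpt S" by blast
  then obtain V where V: "open V" "k \<in> V" and iso: "\<And>t. t \<in> S \<Longrightarrow> t \<in> V \<Longrightarrow> t = k"
    unfolding islimpt_def by blast
  have "almost_finite \<phi> V"
    unfolding almost_finite_def
  proof (intro allI impI)
    fix \<eta> :: real assume "0 < \<eta>"
    then have \<eta>: "0 < \<eta> / 3" by simp
    \<comment> \<open>\<open>x\<close> nearly attains the variation on the punctured neighbourhood,
      so by superadditivity little of it is left off the carrier \<open>C\<close> of its threshold.
      As \<open>C\<close> avoids \<open>S\<close>, it has an almost finite neighbourhood
      \<open>W\<close>. The thirds of \<eta> are spent on the choice of x, on the threshold, and on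
      W - J.\<close>
    obtain x where x: "x \<in> supported_unit (V - {k})" "variation \<phi> (V - {k}) - \<eta> / 3 < cmod (\<phi> x)"
      using variation_approx[OF \<eta>] by blast
    from soft_threshold[OF x(1) \<eta>] obtain y C where y: "y \<in> supported_unit (V - {k})"
      and C: "closed C" "C \<subseteq> V - {k}" "\<And>t. t \<notin> C \<Longrightarrow> y t = 0" and xy: "cmod (\<phi> x - \<phi> y) \<le> \<eta> / 3" by blast
    have "t \<notin> S" if "t \<in> C" for t using that C(2) iso by blast
    then have "\<exists>U. open U \<and> t \<in> U \<and> almost_finite \<phi> U" if "t \<in> C" for t using that by (auto simp: S_def)
    then obtain W where W: "open W" "C \<subseteq> W" "almost_finite \<phi> W" by (rule almost_finite_cover[OF C(1)])
    obtain J where J: "finite J" "variation \<phi> (W - J) \<le> \<eta> / 3" using W(3) \<eta> unfolding almost_finite_def by blast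
    have "variation \<phi> (V - insert k J) \<le> variation \<phi> ((W - J) \<union> ((V - {k}) - C))"
      using W(2) by (intro variation_mono) auto
    also have "\<dots> \<le> variation \<phi> (W - J) + variation \<phi> ((V - {k}) - C)"
      using W V J C by (intro variation_subadditive open_Diff C(1) finite_imp_closed[OF J(1)]) auto
    also have "variation \<phi> ((V - {k}) - C) \<le> variation \<phi> (V - {k}) - cmod (\<phi> y)"
      by (rule variation_superadditive[OF y C(3)])
    also have "cmod (\<phi> x) \<le> cmod (\<phi> y) + \<eta> / 3" using norm_triangle_ineq[of "\<phi> x - \<phi> y" "\<phi> y"] xy by simp
    then have "variation \<phi> (V - {k}) - cmod (\<phi> y) \<le> 2 * \<eta> / 3" using x(2) by simp
    finally have "variation \<phi> (V - insert k J) \<le> \<eta>" using J(2) by simp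
    then show "\<exists>J. finite J \<and> variation \<phi> (V - J) \<le> \<eta>" using J(1) by blast
  qed
  then show False using k V by (auto simp: S_def)
qed

text \<open>Interpolate x on \<open>J\<close> by bumps \<open>u j\<close> that are 1 at j and 0 at
  the other points of \<open>J\<close>. The difference vanishes on \<open>J\<close>, so only the
  small variation of \<phi> off \<open>J\<close> acts on it, and \<phi> x is close to the
  combination with coefficients \<open>\<phi> (u j)\<close>.\<close>

lemma dualX_approx_point_evals:
  assumes disp: "dispersed (UNIV :: 'k set)" and \<eta>: "0 < \<eta>"
  obtains J c where "finite J" "\<And>x r. x \<in> CK \<Longrightarrow> (\<And>t. cmod (x t) \<le> r) \<Longrightarrow> cmod (\<phi> x - (\<Sum>j\<in>J. c j * x j)) \<le> \<eta> * r"
proof -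
  \<comment> \<open>Half of \<eta>, because x minus its interpolant may have modulus up to 2
    r.\<close>
  obtain J where J: "finite J" "variation \<phi> (UNIV - J) \<le> \<eta> / 2"
    using almost_finite_UNIV[OF disp] \<eta> unfolding almost_finite_def by (meson half_gt_zero)
  have small: "cmod (\<phi> x) \<le> \<eta> / 2 * r" if x: "x \<in> CK" "\<And>t. cmod (x t) \<le> r" "\<And>j. j \<in> J \<Longrightarrow> x j = 0" and r: "0 < r" for x r
  proof -
    have "(\<lambda>t. of_real (1 / r) * x t) \<in> supported_unit (UNIV - J)"
      using x r CK_scaled[OF x(1), of "of_real (1 / r)"] by (auto simp: supported_unit_def norm_mult norm_divide divide_simps)
    then have "cmod (\<phi> (\<lambda>t. of_real (1 / r) * x t)) \<le> \<eta> / 2" using variation_upper J(2) by (meson order_trans)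
    then show ?thesis using r unfolding dualX_scaled[OF \<phi> x(1)] by (simp add: norm_mult norm_divide field_simps)
  qed
  have "\<exists>v. v \<in> bump_at j (- (J - {j}))" for j
  proof -
    have "open (- (J - {j}))" using J(1) by (intro open_Compl finite_imp_closed) auto
    from bump_at_nonempty[OF K this, of j] show ?thesis by blast
  qed
  then obtain v where v: "\<And>j. v j \<in> bump_at j (- (J - {j}))" by metis
  have vr: "\<exists>s. 0 \<le> s \<and> s \<le> 1 \<and> v j t = complex_of_real s" for j t using v[of j] by (auto simp: bump_at_def)
  define a where "a = (\<lambda>j t. Re (v j t))"
  have a: "0 \<le> a j t" "a j t \<le> 1" "v j t = of_real (a j t)" for j t using vr[of j t] by (auto simp: a_def)
  have ajj: "a j j = 1" for j using v[of j] by (simp add: a_def bump_at_def)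
  have aij: "a j i = 0" if "i \<in> J" "i \<noteq> j" for i j using v[of j] that by (auto simp: a_def bump_at_def)
  have ac: "continuous_on UNIV (a j)" for j
    unfolding a_def using v[of j] by (intro continuous_intros) (auto simp: bump_at_def CK_def)
  \<comment> \<open>dividing by \<open>s\<close> makes the bumps add up to at most \<open>1\<close> without changing them on \<open>J\<close>\<close>
  define s where "s = (\<lambda>t. max 1 (\<Sum>j\<in>J. a j t))"
  have s: "1 \<le> s t" "(\<Sum>j\<in>J. a j t) \<le> s t" for t by (auto simp: s_def)
  have sJ: "s i = 1" if "i \<in> J" for i
  proof -
    have "(\<Sum>j\<in>J. a j i) = (\<Sum>j\<in>J. if j = i then 1 else 0)" using ajj aij that by (intro sum.cong) auto
    then show ?thesis using that J(1) by (simp add: s_def)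
  qed
  define u where "u = (\<lambda>j t. complex_of_real (a j t / s t))"
  have uC: "u j \<in> CK" for j
  proof -
    have "continuous_on UNIV s" unfolding s_def by (intro continuous_intros ac)
    moreover have "s t \<noteq> 0" for t using s(1)[of t] by linarith
    ultimately show ?thesis unfolding u_def CK_def using ac by (auto intro!: continuous_intros)
  qed
  have uij: "u j i = (if j = i then 1 else 0)" if "i \<in> J" for i j
    using sJ[OF that] ajj[of i] aij[OF that, of j] by (auto simp: u_def)
  have usum: "(\<Sum>j\<in>J. cmod (u j t)) \<le> 1" for t
  proof -
    have "(\<Sum>j\<in>J. cmod (u j t)) = (\<Sum>j\<in>J. a j t) / s t"
      unfolding u_def sum_divide_distrib using a s(1)[of t] by (intro sum.cong refl) (simp only: norm_of_real, simp)
    then show ?thesis using s[of t] by simp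
  qed
  have phisum: "(\<lambda>t. \<Sum>j\<in>I. x j * u j t) \<in> CK \<and> \<phi> (\<lambda>t. \<Sum>j\<in>I. x j * u j t) = (\<Sum>j\<in>I. \<phi> (u j) * x j)" if "finite I" for I and x :: "'k \<Rightarrow> complex"
    using that
  proof (induction I rule: finite_induct)
    case empty
    then show ?case using dualX_scaled[OF \<phi>, of "\<lambda>_. 0" 0] by (simp add: CK_def)
  next
    case (insert i I)
    then show ?case
      using dualX_linear[OF \<phi> uC[of i], of "\<lambda>t. \<Sum>j\<in>I. x j * u j t" "x i" 1]
        CK_lincomb[OF uC[of i], of "\<lambda>t. \<Sum>j\<in>I. x j * u j t" "x i" 1] by (simp add: mult.commute)
  qed
  show thesis
  proof (rule that[OF J(1), of "\<lambda>j. \<phi> (u j)"])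
    fix x :: "'k \<Rightarrow> complex" and r assume x: "x \<in> CK" and r: "\<And>t. cmod (x t) \<le> r"
    let ?p = "\<lambda>t. \<Sum>j\<in>J. x j * u j t"
    let ?y = "\<lambda>t. 1 * x t + (-1) * ?p t"
    have p: "?p \<in> CK" "\<phi> ?p = (\<Sum>j\<in>J. \<phi> (u j) * x j)" using phisum[OF J(1)] by auto
    have yC: "?y \<in> CK" using x p(1) by (rule CK_lincomb)
    have "\<phi> ?y = \<phi> x - (\<Sum>j\<in>J. \<phi> (u j) * x j)" using dualX_linear[OF \<phi> x p(1), of 1 "-1"] p(2) by simp
    moreover have "cmod (\<phi> ?y) \<le> \<eta> * r"
    proof (cases "0 < r")
      case True
      have "cmod (?y t) \<le> 2 * r" for t
      proof -
        have "cmod (?p t) \<le> (\<Sum>j\<in>J. cmod (x j * u j t))" by (rule norm_sum)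
        also have "\<dots> \<le> (\<Sum>j\<in>J. r * cmod (u j t))" unfolding norm_mult using r by (intro sum_mono mult_right_mono) auto
        also have "\<dots> = r * (\<Sum>j\<in>J. cmod (u j t))" by (simp add: sum_distrib_left)
        also have "\<dots> \<le> r * 1" using usum True by (intro mult_left_mono) auto
        finally have "cmod (?p t) \<le> r" by simp
        then show ?thesis using norm_triangle_ineq4[of "x t" "?p t"] r[of t] by simp
      qed
      moreover have "?y i = 0" if "i \<in> J" for i
      proof -
        have "?p i = (\<Sum>j\<in>J. if j = i then x j else 0)" using uij[OF that] by (intro sum.cong) auto
        then show ?thesis using J(1) that by simp
      qed
      ultimately show ?thesis using small[OF yC, of "2 * r"] True by simp
    next
      case False
      then have "x t = 0" for t using r[of t] norm_ge_zero[of "x t"] by (metis linorder_not_less norm_le_zero_iff order_trans)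
      moreover have "r = 0" using False r[of undefined] norm_ge_zero[of "x undefined"] by linarith
      ultimately show ?thesis using dualX_scaled[OF \<phi>, of "\<lambda>_. 0" 0] by (simp add: CK_def)
    qed
    ultimately show "cmod (\<phi> x - (\<Sum>j\<in>J. \<phi> (u j) * x j)) \<le> \<eta> * r" by simp
  qed
qed

end

section \<open>Cluster values and fibers\<close>

text \<open>The given filter is only known to converge on f and on the dual. A finer ultrafilter has
  limits on all of \<open>Hinf\<close>, and taking these limits is the required character.\<close>

lemma cluster_subset_fiber_values:
  fixes f :: "('k::t2_space \<Rightarrow> complex) \<Rightarrow> complex"
  assumes K: "compact (UNIV :: 'k set)" and f: "f \<in> Hinf" and c: "c \<in> cluster f \<Psi>"
  shows "c \<in> (\<lambda>\<tau>. \<tau> f) ` fiber \<Psi>"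
proof -
  obtain F :: "('k \<Rightarrow> complex) filter" where F: "F \<noteq> bot" "eventually (\<lambda>x. x \<in> BallX) F"
    "\<And>\<phi>. \<phi> \<in> dualX \<Longrightarrow> (\<phi> \<longlongrightarrow> \<Psi> \<phi>) F" "(f \<longlongrightarrow> c) F"
    using c unfolding cluster_def by auto
  obtain U where U: "U \<le> F" "ultrafilter U" using ultrafilter_exists[OF F(1)] by blast
  have nb: "U \<noteq> bot" using U(2) by (simp add: ultrafilter_def)
  have B: "eventually (\<lambda>x. x \<in> BallX) U" using F(2) U(1) by (rule filter_leD[rotated])
  define \<tau> :: "(('k \<Rightarrow> complex) \<Rightarrow> complex) \<Rightarrow> complex" where "\<tau> = (\<lambda>g. Lim U g)"
  have lim: "(g \<longlongrightarrow> \<tau> g) U" if "g \<in> Hinf" for g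
  proof -
    obtain M where "\<forall>x\<in>BallX. cmod (g x) \<le> M" using \<open>g \<in> Hinf\<close> unfolding Hinf_def by blast
    then show ?thesis unfolding \<tau>_def
      by (intro ultrafilter_bounded_tendsto_Lim[OF U(2), of _ M] eventually_mono[OF B]) auto
  qed
  have lim_eq: "\<tau> g = d" if "(g \<longlongrightarrow> d) U" for g d
    unfolding \<tau>_def by (rule tendsto_Lim[OF nb that])
  have "\<tau> \<in> fiber \<Psi>"
    unfolding fiber_def
  proof (intro CollectI conjI ballI allI)
    show "\<tau> (\<lambda>x. a * f x + b * g x) = a * \<tau> f + b * \<tau> g" if "f \<in> Hinf" "g \<in> Hinf" for f g a b
      by (intro lim_eq tendsto_intros lim that)
    show "\<tau> (\<lambda>x. f x * g x) = \<tau> f * \<tau> g" if "f \<in> Hinf" "g \<in> Hinf" for f g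
      by (intro lim_eq tendsto_intros lim that)
    have "restrB (\<lambda>_ :: 'k \<Rightarrow> complex. 1) \<in> Hinf" by (rule bhol_imp_Hinf[OF K bhol_const])
    moreover have "\<tau> (restrB (\<lambda>_. 1)) = 1"
    proof (rule lim_eq, rule tendsto_eventually)
      show "eventually (\<lambda>x. restrB (\<lambda>_. 1) x = 1) U" using B by eventually_elim (simp add: restrB_def)
    qed
    ultimately show "\<exists>f\<in>Hinf. \<tau> f \<noteq> 0" by (metis zero_neq_one)
    show "\<tau> (restrB \<phi>) = \<Psi> \<phi>" if "\<phi> \<in> dualX" for \<phi>
    proof (rule lim_eq)
      have "(\<phi> \<longlongrightarrow> \<Psi> \<phi>) U" using F(3)[OF that] U(1) by (rule tendsto_mono[rotated])
      moreover have "eventually (\<lambda>x. \<phi> x = restrB \<phi> x) U" using B by eventually_elim (simp add: restrB_def)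
      ultimately show "(restrB \<phi> \<longlongrightarrow> \<Psi> \<phi>) U" by (rule Lim_transform_eventually)
    qed
  qed
  moreover have "\<tau> f = c" using F(4) U(1) by (intro lim_eq) (rule tendsto_mono)
  ultimately show ?thesis by blast
qed

lemma bidual_finite_combination:
  assumes K: "compact (UNIV :: 'k::topological_space set)" and \<Psi>: "\<Psi> \<in> bidual_ball" and J: "finite J"
  shows "(\<lambda>x. \<Sum>j\<in>J. c j * point_eval (j::'k) x) \<in> dualX \<and>
    \<Psi> (\<lambda>x. \<Sum>j\<in>J. c j * point_eval j x) = (\<Sum>j\<in>J. c j * \<Psi> (point_eval j))"
proof -
  have lin: "\<Psi> (\<lambda>x. a * \<phi> x + b * \<psi> x) = a * \<Psi> \<phi> + b * \<Psi> \<psi>" if "\<phi> \<in> dualX" "\<psi> \<in> dualX" for \<phi> \<psi> a b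
    using \<Psi> that unfolding bidual_ball_def by blast
  have zero: "(\<lambda>x. 0) \<in> (dualX :: (('k \<Rightarrow> complex) \<Rightarrow> complex) set)" by (auto simp: dualX_def intro: exI[of _ 0])
  show ?thesis using J
  proof (induction J rule: finite_induct)
    case empty
    then show ?case using zero lin[OF zero zero, of 0 0] by simp
  next
    case (insert i I)
    have "(\<lambda>x. c i * point_eval i x + 1 * (\<Sum>j\<in>I. c j * point_eval j x)) \<in> dualX"
      using dualX_lincomb[OF point_eval_dualX[OF K]] insert by blast
    then show ?case using insert lin[OF point_eval_dualX[OF K], of "\<lambda>x. \<Sum>j\<in>I. c j * point_eval j x" "c i" i 1] by simp
  qed
qed

theorem theorem3p1:
  fixes f :: "('k::t2_space \<Rightarrow> complex) \<Rightarrow> complex"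
    and \<Psi> :: "(('k \<Rightarrow> complex) \<Rightarrow> complex) \<Rightarrow> complex"
  assumes "compact (UNIV :: 'k set)"
    and "dispersed (UNIV :: 'k set)"
    and "\<Psi> \<in> bidual_ball"
    and "f \<in> Hinf"
  shows "cluster f \<Psi> = (\<lambda>\<tau>. \<tau> f) ` fiber \<Psi>"
proof
  note K = assms(1)
  show "cluster f \<Psi> \<subseteq> (\<lambda>\<tau>. \<tau> f) ` fiber \<Psi>"
    using cluster_subset_fiber_values[OF K assms(4)] by blast
  show "(\<lambda>\<tau>. \<tau> f) ` fiber \<Psi> \<subseteq> cluster f \<Psi>"
  proof
    fix c assume "c \<in> (\<lambda>\<tau>. \<tau> f) ` fiber \<Psi>"
    then obtain \<tau> where \<tau>: "\<tau> \<in> fiber \<Psi>" "c = \<tau> f" by blast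
    define l where "l = (\<lambda>j. \<Psi> (point_eval j))"
    \<comment> \<open>A single e controls both the weak-star conditions and the distance of f(x) to
      c. These sets form a filter base, as (J \<union> J', min e e') refines both (J, e) and (J',
      e'), and they are nonempty by \<open>fiber_value_approximated\<close>.\<close>
    define A where "A = (\<lambda>(J, e). {x \<in> slab l e J. cmod (f x - c) < e})"
    define I where "I = {(J :: 'k set, e :: real). finite J \<and> 0 < e}"
    define F where "F = (INF i\<in>I. principal (A i))"
    have ev: "eventually P F \<longleftrightarrow> (\<exists>i\<in>I. eventually P (principal (A i)))" for P
      unfolding F_def
    proof (rule eventually_INF_base)
      show "I \<noteq> {}" by (auto simp: I_def intro!: exI[of _ "{}"] exI[of _ 1])
      fix i i' assume i: "i \<in> I" "i' \<in> I"
      obtain J e J' e' where eq: "i = (J, e)" "i' = (J', e')" by (cases i, cases i') auto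
      show "\<exists>x\<in>I. principal (A x) \<le> inf (principal (A i)) (principal (A i'))"
        by (rule bexI[of _ "(J \<union> J', min e e')"]) (use i eq in \<open>auto simp: I_def A_def slab_def\<close>)
    qed
    have "A i \<noteq> {}" if "i \<in> I" for i
      using fiber_value_approximated[OF K assms(3,4) \<tau>(1)] that unfolding A_def I_def l_def \<tau>(2) by auto
    then have "F \<noteq> bot"
      unfolding trivial_limit_def ev eventually_principal by auto
    moreover have "eventually (\<lambda>x. x \<in> BallX) F"
      unfolding ev eventually_principal
      by (rule bexI[of _ "({}, 1)"]) (auto simp: I_def A_def slab_def)
    moreover have "(f \<longlongrightarrow> c) F"
    proof (rule tendstoI)
      fix e :: real assume "0 < e"
      then show "eventually (\<lambda>x. dist (f x) c < e) F"
        unfolding ev eventually_principal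
        by (intro bexI[of _ "({}, e)"]) (auto simp: I_def A_def dist_norm)
    qed
    moreover have "(\<phi> \<longlongrightarrow> \<Psi> \<phi>) F" if \<phi>: "\<phi> \<in> dualX" for \<phi>
    proof (rule tendstoI)
      fix e :: real assume e: "0 < e"
      \<comment> \<open>Three errors of at most \<eta> will add up to less than e: \<phi> against a
        finite combination \<open>\<psi>\<close> at x, the same for their images under \<Psi>, and
        \<psi> x against \<Psi> \<psi>.\<close>
      define \<eta> where "\<eta> = e / 4"
      have \<eta>: "0 < \<eta>" using e by (simp add: \<eta>_def)
      obtain J d where J: "finite J" and
        ap: "\<And>x r. x \<in> CK \<Longrightarrow> (\<And>t. cmod (x t) \<le> r) \<Longrightarrow> cmod (\<phi> x - (\<Sum>j\<in>J. d j * x j)) \<le> \<eta> * r"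
        using dualX_approx_point_evals[OF K \<phi> assms(2) \<eta>] by blast
      define \<psi> where "\<psi> = (\<lambda>x. \<Sum>j\<in>J. d j * point_eval j x)"
      have \<psi>: "\<psi> \<in> dualX" "\<Psi> \<psi> = (\<Sum>j\<in>J. d j * l j)"
        using bidual_finite_combination[OF K assms(3) J, of d] by (auto simp: \<psi>_def l_def)
      have ap': "cmod (\<phi> x - \<psi> x) \<le> \<eta>" if "x \<in> CK" "supn x \<le> 1" for x
        using ap[of x 1] that order_trans[OF norm_le_supn[OF K that(1)] that(2)] by (simp add: \<psi>_def point_eval_def)
      \<comment> \<open>The approximation of \<phi> by \<psi> holds in the dual norm, so it passes
        to \<Psi>, which lies in the unit ball of the bidual.\<close>
      have "cmod (\<Psi> \<phi> - \<Psi> \<psi>) \<le> \<eta>"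
      proof -
        let ?\<chi> = "\<lambda>x. 1 * \<phi> x + (-1) * \<psi> x"
        have \<chi>: "?\<chi> \<in> dualX" by (rule dualX_lincomb[OF \<phi> \<psi>(1)])
        have "\<Psi> ?\<chi> = 1 * \<Psi> \<phi> + (-1) * \<Psi> \<psi>" using assms(3) \<phi> \<psi>(1) unfolding bidual_ball_def by blast
        moreover have "cmod (\<Psi> ?\<chi>) \<le> dnorm ?\<chi>" using assms(3) \<chi> unfolding bidual_ball_def by blast
        moreover have "dnorm ?\<chi> \<le> \<eta>"
          unfolding dnorm_def
        proof (rule cSUP_least)
          have "(\<lambda>_. 0) \<in> {x \<in> CK. supn x \<le> 1}" by (simp add: CK_def supn_def)
          then show "{x \<in> CK. supn x \<le> 1} \<noteq> ({} :: ('k \<Rightarrow> complex) set)" by blast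
        qed (use ap' in auto)
        ultimately show ?thesis by simp
      qed
      define N where "N = (\<Sum>j\<in>J. cmod (d j))"
      have N: "0 \<le> N" by (simp add: N_def sum_nonneg)
      \<comment> \<open>Accuracy e' at each point of \<open>J\<close> keeps the error of the
        combination below N e' \<le> \<eta>; the + 1 covers N = 0.\<close>
      define e' where "e' = \<eta> / (N + 1)"
      have e': "0 < e'" using \<eta> N by (simp add: e'_def)
      have "dist (\<phi> x) (\<Psi> \<phi>) < e" if x: "x \<in> A (J, e')" for x
      proof -
        have xB: "x \<in> CK" "supn x \<le> 1" "\<forall>j\<in>J. cmod (x j - l j) < e'" using x by (auto simp: A_def slab_def BallX_def)
        have "\<psi> x - \<Psi> \<psi> = (\<Sum>j\<in>J. d j * (x j - l j))"
        proof -
          have "\<psi> x = (\<Sum>j\<in>J. d j * x j)" using xB(1) by (simp add: \<psi>_def point_eval_def)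
          then show ?thesis by (simp add: \<psi>(2) sum_subtractf right_diff_distrib)
        qed
        also have "cmod \<dots> \<le> (\<Sum>j\<in>J. cmod (d j) * e')"
          using xB(3) by (intro sum_norm_le) (simp add: norm_mult mult_left_mono less_imp_le)
        also have "\<dots> = N * e'" by (simp add: N_def sum_distrib_right)
        also have "\<dots> \<le> \<eta>" using N \<eta> by (simp add: e'_def field_simps)
        finally have "cmod (\<psi> x - \<Psi> \<psi>) \<le> \<eta>" .
        moreover have "\<phi> x - \<Psi> \<phi> = (\<phi> x - \<psi> x) + (\<psi> x - \<Psi> \<psi>) - (\<Psi> \<phi> - \<Psi> \<psi>)" by simp
        then have "cmod (\<phi> x - \<Psi> \<phi>) \<le> cmod (\<phi> x - \<psi> x) + cmod (\<psi> x - \<Psi> \<psi>) + cmod (\<Psi> \<phi> - \<Psi> \<psi>)"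
          using norm_triangle_ineq[of "\<phi> x - \<psi> x" "\<psi> x - \<Psi> \<psi>"]
            norm_triangle_ineq4[of "(\<phi> x - \<psi> x) + (\<psi> x - \<Psi> \<psi>)" "\<Psi> \<phi> - \<Psi> \<psi>"] by simp
        ultimately have "cmod (\<phi> x - \<Psi> \<phi>) \<le> 3 * \<eta>"
          using ap'[OF xB(1,2)] \<open>cmod (\<Psi> \<phi> - \<Psi> \<psi>) \<le> \<eta>\<close> by linarith
        then show ?thesis using e by (simp add: dist_norm \<eta>_def)
      qed
      then show "eventually (\<lambda>x. dist (\<phi> x) (\<Psi> \<phi>) < e) F"
        unfolding ev eventually_principal using J e' by (intro bexI[of _ "(J, e')"]) (auto simp: I_def)
    qed
    ultimately show "c \<in> cluster f \<Psi>" unfolding cluster_def by blast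
  qed
qed

end
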